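(* Suppose that the potential $V$ is locally H\"older continuous on $\mathbb{R}^d$ and that the spectrum of the operator $H=-\Delta+V$ is discrete and bounded below. Then for any $r>0$: (i) the functions $\mathcal{W}_{\mathbf y}(t)=\int_{B_t(\mathbf y)}V(\mathbf x)\,d\mathbf x$ tend to infinity in measure on $(0,r)$ as $|\mathbf y|\to\infty$, i.e. $$\forall A>0:\quad \lim_{|\mathbf y|\to\infty}\mathrm{mes}_1\big(\{t\in(0,r):\ \mathcal{W}_{\mathbf y}(t)\le A\}\big)=0;$$ (ii) the functions $\mathcal{V}_{\mathbf y}(s,t)=\mathcal{W}_{\mathbf y}(t)-\mathcal{W}_{\mathbf y}(s)=\int_{B_t(\mathbf y)\setminus\overline{B}_s(\mathbf y)}V(\mathbf x)\,d\mathbf x$ tend to infinity in measure on the triangle $\Delta_r=\{(s,t)\in\mathbb{R}^2:\ 0<s<t<r\}$ as $|\mathbf y|\to\infty$, i.e. $$\forall A>0:\quad \lim_{|\mathbf y|\to\infty}\mathrm{mes}_2\big(\{(s,t)\in\Delta_r:\ \mathcal{V}_{\mathbf y}(s,t)\le A\}\big)=0.$$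
   Context: Let $d\ge 3$ and let $V:\mathbb{R}^d\to\mathbb{R}$ belong to $L_{\infty,loc}(\mathbb{R}^d)$. The Schr\"odinger operator $H$ in $L_2(\mathbb{R}^d)$ is the closure of the operator $H^0=-\Delta+V(\mathbf x)\cdot$ defined on $C_0^\infty(\mathbb{R}^d)$ (if $H^0$ is bounded below, $H$ is known to be self-adjoint). "Discrete spectrum" means that the spectrum consists only of isolated eigenvalues of finite multiplicity. $B_t(\mathbf y)$ is the open ball of radius $t$ centered at $\mathbf y\in\mathbb{R}^d$, $\overline{B}_s(\mathbf y)$ is the closed ball of radius $s$, and $\mathrm{mes}_k$ is Lebesgue measure in $\mathbb{R}^k$. *)

theory Defs
  imports "HOL-Analysis.Analysis"
begin

definition locally_Holder_continuous :: "('a::euclidean_space \<Rightarrow> real) \<Rightarrow> bool" where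
  "locally_Holder_continuous V \<longleftrightarrow>
     (\<forall>K. compact K \<longrightarrow>
        (\<exists>\<alpha> C. 0 < \<alpha> \<and> \<alpha> \<le> 1 \<and>
               (\<forall>x\<in>K. \<forall>y\<in>K. \<bar>V x - V y\<bar> \<le> C * dist x y powr \<alpha>)))"


definition partial_deriv :: "'a::euclidean_space \<Rightarrow> ('a \<Rightarrow> complex) \<Rightarrow> 'a \<Rightarrow> complex" where
  "partial_deriv b f x = vector_derivative (\<lambda>t. f (x + t *\<^sub>R b)) (at 0)"

primrec C_k :: "nat \<Rightarrow> ('a::euclidean_space \<Rightarrow> complex) \<Rightarrow> bool" where
  "C_k 0 f \<longleftrightarrow> continuous_on UNIV f"
| "C_k (Suc k) f \<longleftrightarrow> continuous_on UNIV f \<and>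
     (\<forall>b\<in>Basis. (\<forall>x. (\<lambda>t::real. f (x + t *\<^sub>R b)) differentiable (at 0)) \<and>
                 C_k k (partial_deriv b f))"

text \<open>The space \<open>C\<^sub>0\<^sup>\<infinity>\<close> of complex-valued test functions.\<close>

definition test_functions :: "('a::euclidean_space \<Rightarrow> complex) set" where
  "test_functions = {f. (\<forall>k. C_k k f) \<and> compact (closure {x. f x \<noteq> 0})}"

definition laplacian :: "('a::euclidean_space \<Rightarrow> complex) \<Rightarrow> 'a \<Rightarrow> complex" where
  "laplacian f x = (\<Sum>b\<in>Basis. partial_deriv b (partial_deriv b f) x)"


text \<open>
  Elements of the Hilbert space \<open>L\<^sub>2\<close> are represented by Borel functions; every class modulo
  null sets of a Lebesgue measurable function has such a representative. Equality in \<open>L\<^sub>2\<close> is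
  equality almost everywhere.
\<close>

definition L2 :: "('a::euclidean_space \<Rightarrow> complex) set" where
  "L2 = {f \<in> borel_measurable lborel. integrable lborel (\<lambda>x. (cmod (f x))\<^sup>2)}"

definition L2_norm :: "('a::euclidean_space \<Rightarrow> complex) \<Rightarrow> real" where
  "L2_norm f = sqrt (LINT x|lborel. (cmod (f x))\<^sup>2)"

text \<open>
  A (possibly unbounded) linear operator in \<open>L\<^sub>2\<close> is given by its graph, a subset of
  \<open>L2 \<times> L2\<close>.
\<close>

type_synonym 'a L2_operator = "(('a \<Rightarrow> complex) \<times> ('a \<Rightarrow> complex)) set"

text \<open>
  The closure of an operator, whose graph is the closure of the given graph in
  \<open>L\<^sub>2 \<times> L\<^sub>2\<close>. It contains with each pair all pairs that agree with it almost everywhere.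
\<close>

definition op_closure :: "'a::euclidean_space L2_operator \<Rightarrow> 'a L2_operator" where
  "op_closure T =
     {(u, f). u \<in> L2 \<and> f \<in> L2 \<and>
        (\<exists>p g. (\<forall>n::nat. (p n, g n) \<in> T) \<and>
               (\<lambda>n. L2_norm (\<lambda>x. p n x - u x)) \<longlonglongrightarrow> 0 \<and>
               (\<lambda>n. L2_norm (\<lambda>x. g n x - f x)) \<longlonglongrightarrow> 0)}"

definition schrodinger_op0 :: "('a::euclidean_space \<Rightarrow> real) \<Rightarrow> 'a L2_operator" where
  "schrodinger_op0 V =
     {(\<phi>, \<lambda>x. - laplacian \<phi> x + complex_of_real (V x) * \<phi> x) |\<phi>. \<phi> \<in> test_functions}"

definition schrodinger_op :: "('a::euclidean_space \<Rightarrow> real) \<Rightarrow> 'a L2_operator" where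
  "schrodinger_op V = op_closure (schrodinger_op0 V)"


text \<open>
  The point \<open>l\<close> is in the resolvent set when \<open>T - l\<close> is a bijection from the domain of \<open>T\<close> onto
  \<open>L\<^sub>2\<close> with bounded inverse. The second condition expresses both injectivity and
  boundedness of the inverse.
\<close>

definition resolvent_set :: "'a::euclidean_space L2_operator \<Rightarrow> complex set" where
  "resolvent_set T =
     {l. (\<forall>g\<in>L2. \<exists>(u, f)\<in>T. AE x in lborel. f x - l * u x = g x) \<and>
         (\<exists>C. \<forall>(u, f)\<in>T. L2_norm u \<le> C * L2_norm (\<lambda>x. f x - l * u x))}"

definition op_spectrum :: "'a::euclidean_space L2_operator \<Rightarrow> complex set" where
  "op_spectrum T = - resolvent_set T"

definition op_eigenspace :: "'a::euclidean_space L2_operator \<Rightarrow> complex \<Rightarrow> ('a \<Rightarrow> complex) set" where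
  "op_eigenspace T l = {u. \<exists>f. (u, f) \<in> T \<and> (AE x in lborel. f x = l * u x)}"

definition op_eigenvalue :: "'a::euclidean_space L2_operator \<Rightarrow> complex \<Rightarrow> bool" where
  "op_eigenvalue T l \<longleftrightarrow> (\<exists>u\<in>op_eigenspace T l. \<not> (AE x in lborel. u x = 0))"

definition finite_multiplicity :: "'a::euclidean_space L2_operator \<Rightarrow> complex \<Rightarrow> bool" where
  "finite_multiplicity T l \<longleftrightarrow>
     (\<exists>B. finite B \<and> B \<subseteq> L2 \<and>
        (\<forall>u\<in>op_eigenspace T l. \<exists>c. AE x in lborel. u x = (\<Sum>e\<in>B. c e * e x)))"

definition discrete_spectrum :: "'a::euclidean_space L2_operator \<Rightarrow> bool" where
  "discrete_spectrum T \<longleftrightarrow>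
     (\<forall>l\<in>op_spectrum T.
        l isolated_in op_spectrum T \<and> op_eigenvalue T l \<and> finite_multiplicity T l)"

text \<open>
  The spectrum is a priori a set of complex numbers, hence the real part; for a self-adjoint
  operator it is real.
\<close>

definition spectrum_bounded_below :: "'a::euclidean_space L2_operator \<Rightarrow> bool" where
  "spectrum_bounded_below T \<longleftrightarrow> (\<exists>c. \<forall>l\<in>op_spectrum T. c \<le> Re l)"


definition ball_integral :: "('a::euclidean_space \<Rightarrow> real) \<Rightarrow> 'a \<Rightarrow> real \<Rightarrow> real" where
  "ball_integral V y t = (LINT x:ball y t|lborel. V x)"

definition shell_integral :: "('a::euclidean_space \<Rightarrow> real) \<Rightarrow> 'a \<Rightarrow> real \<Rightarrow> real \<Rightarrow> real" where
  "shell_integral V y s t = ball_integral V y t - ball_integral V y s"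

definition open_triangle :: "real \<Rightarrow> (real \<times> real) set" where
  "open_triangle r = {(s, t). 0 < s \<and> s < t \<and> t < r}"

end

theory Submission
  imports Defs
begin

text \<open>
  Discreteness and semiboundedness of the spectrum force the quadratic form of \<open>H\<close> on test
  functions supported in a ball \<open>B\<^sub>r\<^sub>+\<^sub>1(y)\<close> to exceed \<open>l \<parallel>\<phi>\<parallel>\<^sup>2\<close> once \<open>\<bar>y\<bar>\<close> is large, for every \<open>l\<close>.
  The bound extends to radial Lipschitz functions \<open>\<phi>(x) = \<psi>(\<bar>x - y\<bar>)\<close>. If \<open>\<W>\<^sub>y \<le> A\<close> on a set
  \<open>T\<close> of measure at least \<open>\<epsilon>\<close>, take \<open>\<psi>(t) = \<bar>T \<inter> (t, \<infinity>)\<bar> / \<bar>T\<bar>\<close>. Then \<open>\<psi>\<^sup>2\<close> is the average over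
  \<open>(u, v) \<in> T \<times> T\<close> of the indicator of \<open>t < min u v\<close>, so \<open>\<integral> V \<phi>\<^sup>2\<close> is an average of values
  \<open>\<W>\<^sub>y (min u v) \<le> A\<close>, while the gradient of \<open>\<phi>\<close> is bounded in terms of \<open>\<epsilon>\<close>; this bounds \<open>l\<close>.
  For shells, a quantile \<open>c\<close> of \<open>\<W>\<^sub>y\<close> separates two sets \<open>S\<close>, \<open>T\<close> with \<open>\<W>\<^sub>y \<ge> c\<close> on \<open>S\<close> and
  \<open>\<W>\<^sub>y \<le> A + 1 + c\<close> on \<open>T\<close>, and the profile increases on \<open>S\<close> and decreases on \<open>T\<close>.
\<close>

section \<open>Symmetric relations in a real Hilbert space\<close>

text \<open>Of the spectrum, the argument sees only real numbers at which the shifted relation is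
  bijective with bounded inverse. A gap around such numbers, evaluated at points tending to minus
  infinity, gives lower bounds of the form. Eigenvectors are split off eigenvalue by eigenvalue, so
  the form exceeds any given \<open>l\<close> after finitely many linear constraints; functions with
  disjoint supports escape finitely many constraints.

  The second obstacle is that \<open>V\<close> has no sign, so integrals of \<open>V\<close> against
  a squared profile cannot be compared pointwise with ball integrals. The square itself has to be a
  mixture of indicators of balls whose radii lie in the bad set. This is why two independent radii
  occur: the square of a tail probability is the tail probability of their minimum.

  For shells the condition couples \<open>s\<close> and \<open>t\<close>. The quantile decouples
  them, and its level \<open>c\<close> cancels between two averages. The squared profile splits into
  these averages because \<open>S\<close> lies below \<open>T\<close>, and its norm is bounded below
  by the volume of the shell between them. Hence the triangle is exhausted by boxes away from the
  diagonal.\<close>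

definition regular_value :: "'h::real_inner set \<Rightarrow> ('h \<times> 'h) set \<Rightarrow> real \<Rightarrow> bool" where
  "regular_value K H l \<longleftrightarrow>
     (\<forall>g\<in>K. \<exists>u f. (u, f) \<in> H \<and> f - l *\<^sub>R u = g) \<and>
     (\<exists>C. \<forall>(u, f)\<in>H. norm u \<le> C * norm (f - l *\<^sub>R u))"

lemma regular_valueE:
  assumes "regular_value K H l"
  obtains C where "C > 0" "\<And>u f. (u, f) \<in> H \<Longrightarrow> norm u \<le> C * norm (f - l *\<^sub>R u)"
proof -
  obtain C where C: "\<And>u f. (u, f) \<in> H \<Longrightarrow> norm u \<le> C * norm (f - l *\<^sub>R u)"
    using assms unfolding regular_value_def by blast
  have "norm u \<le> max C 1 * norm (f - l *\<^sub>R u)" if "(u, f) \<in> H" for u f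
    using C[OF that] by (smt (verit) mult_right_mono norm_ge_zero)
  then show thesis using that[of "max C 1"] by auto
qed

text \<open>The ambient subspace \<open>K\<close> is \<open>UNIV\<close> for the operator itself and
  becomes the orthogonal complement of eigenvectors once these are split off. Graphs make closure
  and restriction plain set operations.\<close>

locale symmetric_relation =
  fixes K :: "'h::{real_inner, banach} set" and H :: "('h \<times> 'h) set"
  assumes subspace_K: "subspace K" and closed_K: "closed K"
    and subspace_H: "subspace H" and H_sub: "H \<subseteq> K \<times> K"
    and sym: "\<And>u f v g. (u, f) \<in> H \<Longrightarrow> (v, g) \<in> H \<Longrightarrow> inner f v = inner u g"
begin

lemmas K_0 = subspace_0[OF subspace_K] and K_add = subspace_add[OF subspace_K]
  and K_diff = subspace_diff[OF subspace_K] and K_scale = subspace_scale[OF subspace_K]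

lemma H_add: "(u, f) \<in> H \<Longrightarrow> (v, g) \<in> H \<Longrightarrow> (u + v, f + g) \<in> H"
  using subspace_add[OF subspace_H, of "(u, f)" "(v, g)"] by simp

lemma H_diff: "(u, f) \<in> H \<Longrightarrow> (v, g) \<in> H \<Longrightarrow> (u - v, f - g) \<in> H"
  using subspace_diff[OF subspace_H, of "(u, f)" "(v, g)"] by simp

lemma H_scale: "(u, f) \<in> H \<Longrightarrow> (c *\<^sub>R u, c *\<^sub>R f) \<in> H"
  using subspace_scale[OF subspace_H, of "(u, f)" c] by simp

lemma H_mem: "(u, f) \<in> H \<Longrightarrow> u \<in> K" "(u, f) \<in> H \<Longrightarrow> f \<in> K"
  using H_sub by auto

lemma H_solve:
  assumes "regular_value K H l" "g \<in> K"
  obtains u f where "(u, f) \<in> H" "f - l *\<^sub>R u = g"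
  using assms unfolding regular_value_def by blast

section \<open>Resolvents at regular values\<close>

definition resolvent :: "real \<Rightarrow> 'h \<Rightarrow> 'h" where
  "resolvent l g = (SOME u. (u, g + l *\<^sub>R u) \<in> H)"

context
  fixes l :: real
  assumes reg: "regular_value K H l"
begin

lemma resolvent_graph:
  assumes "g \<in> K"
  shows "(resolvent l g, g + l *\<^sub>R resolvent l g) \<in> H"
proof -
  obtain u f where "(u, f) \<in> H" "f - l *\<^sub>R u = g" using H_solve[OF reg assms] .
  then have "(u, g + l *\<^sub>R u) \<in> H" by auto
  then show ?thesis unfolding resolvent_def by (rule someI)
qed

lemma resolvent_mem: "g \<in> K \<Longrightarrow> resolvent l g \<in> K"
  using H_mem(1)[OF resolvent_graph] .

lemma resolvent_unique:
  assumes "(u, f) \<in> H" "f - l *\<^sub>R u = g" "g \<in> K"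
  shows "resolvent l g = u"
proof -
  obtain C where C: "C > 0" "\<And>u f. (u, f) \<in> H \<Longrightarrow> norm u \<le> C * norm (f - l *\<^sub>R u)"
    using regular_valueE[OF reg] by blast
  have "g + l *\<^sub>R resolvent l g - f - l *\<^sub>R (resolvent l g - u) = 0"
    using assms(2) by (auto simp: algebra_simps)
  then have "norm (resolvent l g - u) \<le> 0"
    using C(2)[OF H_diff[OF resolvent_graph[OF assms(3)] assms(1)]] by simp
  then show ?thesis by simp
qed

lemma resolvent_add: "g \<in> K \<Longrightarrow> h \<in> K \<Longrightarrow> resolvent l (g + h) = resolvent l g + resolvent l h"
  by (rule resolvent_unique[OF H_add[OF resolvent_graph resolvent_graph]])
     (auto simp: algebra_simps intro: K_add)

lemma resolvent_diff: "g \<in> K \<Longrightarrow> h \<in> K \<Longrightarrow> resolvent l (g - h) = resolvent l g - resolvent l h"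
  by (rule resolvent_unique[OF H_diff[OF resolvent_graph resolvent_graph]])
     (auto simp: algebra_simps intro: K_diff)

lemma resolvent_scale: "g \<in> K \<Longrightarrow> resolvent l (c *\<^sub>R g) = c *\<^sub>R resolvent l g"
  by (rule resolvent_unique[OF H_scale[OF resolvent_graph]])
     (auto simp: algebra_simps intro: K_scale)

lemma resolvent_bounded:
  obtains C where "C > 0" "\<And>g. g \<in> K \<Longrightarrow> norm (resolvent l g) \<le> C * norm g"
proof -
  obtain C where C: "C > 0" "\<And>u f. (u, f) \<in> H \<Longrightarrow> norm u \<le> C * norm (f - l *\<^sub>R u)"
    using regular_valueE[OF reg] by blast
  show thesis
    by (rule that[of C]) (use C(1) C(2)[OF resolvent_graph] in auto)
qed

end

section \<open>Spectral gaps and lower bounds of the form\<close>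

lemma sym_shift:
  assumes "(u, f) \<in> H" "(v, g) \<in> H"
  shows "inner (f - l *\<^sub>R u) v = inner u (g - l *\<^sub>R v)"
  using sym[OF assms] by (simp add: inner_diff_left inner_diff_right)

text \<open>
  With \<open>R = (H - z)\<^sup>-\<^sup>1\<close> and \<open>N\<close> its norm, a maximising sequence \<open>g\<close> of \<open>R\<close> satisfies
  \<open>(R - N) (R + N) g \<longlonglongrightarrow> 0\<close>, so one of \<open>z \<plusminus> 1/N\<close> is not regular.
\<close>

lemma gap_bound:
  assumes rho: "\<rho> > 0"
    and reg: "\<And>l. \<bar>l - z\<bar> < \<rho> \<Longrightarrow> regular_value K H l"
    and uf: "(u, f) \<in> H"
  shows "\<rho> * norm u \<le> norm (f - z *\<^sub>R u)"
proof -
  have regz: "regular_value K H z" using reg[of z] rho by simp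
  obtain C0 where C0: "C0 > 0" "\<And>u f. (u, f) \<in> H \<Longrightarrow> norm u \<le> C0 * norm (f - z *\<^sub>R u)"
    using regular_valueE[OF regz] by blast
  define U where "U = {norm u | u f. (u, f) \<in> H \<and> norm (f - z *\<^sub>R u) \<le> 1}"
  define N where "N = Sup U"
  have U0: "0 \<in> U" unfolding U_def using subspace_0[OF subspace_H]
    by (force simp: zero_prod_def)
  have Ub: "bdd_above U"
  proof (rule bdd_aboveI[of _ C0])
    fix x assume "x \<in> U"
    then obtain u f where "x = norm u" "(u, f) \<in> H" "norm (f - z *\<^sub>R u) \<le> 1"
      unfolding U_def by blast
    then show "x \<le> C0" using C0(2)[of u f] C0(1)
      by (smt (verit) mult_left_le)
  qed
  have le_N: "norm u \<le> N" if "(u, f) \<in> H" "norm (f - z *\<^sub>R u) \<le> 1" for u f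
    unfolding N_def by (rule cSup_upper[OF _ Ub]) (use that U_def in blast)
  have N_bound: "norm u \<le> N * norm (f - z *\<^sub>R u)" if h: "(u, f) \<in> H" for u f
  proof (cases "f - z *\<^sub>R u = 0")
    case True
    then show ?thesis using C0(2)[OF h] by simp
  next
    case False
    define c where "c = inverse (norm (f - z *\<^sub>R u))"
    have c: "c > 0" using False by (simp add: c_def)
    have e: "c *\<^sub>R f - z *\<^sub>R (c *\<^sub>R u) = c *\<^sub>R (f - z *\<^sub>R u)"
      by (simp add: scaleR_diff_right)
    have "norm (c *\<^sub>R u) \<le> N"
      by (rule le_N[OF H_scale[OF h, of c]]) (subst e, use False in \<open>simp add: c_def\<close>)
    then show ?thesis using c False by (simp add: c_def field_simps)
  qed
  have "N \<le> 1 / \<rho>"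
  proof (rule ccontr)
    assume "\<not> N \<le> 1 / \<rho>"
    then have NN: "N > 1 / \<rho>" by simp
    have N0: "N > 0" using NN rho by (meson divide_pos_pos less_trans zero_less_one)
    have iN: "1 / N < \<rho>" using NN N0 rho by (simp add: field_simps)
    have r1: "regular_value K H (z + 1 / N)" and r2: "regular_value K H (z - 1 / N)"
      by (rule reg, use iN N0 in simp)+
    obtain C1 where C1: "C1 > 0"
      "\<And>u f. (u, f) \<in> H \<Longrightarrow> norm u \<le> C1 * norm (f - (z + 1 / N) *\<^sub>R u)"
      using regular_valueE[OF r1] by blast
    obtain C2 where C2: "C2 > 0"
      "\<And>u f. (u, f) \<in> H \<Longrightarrow> norm u \<le> C2 * norm (f - (z - 1 / N) *\<^sub>R u)"
      using regular_valueE[OF r2] by blast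
    define M where "M = C2 / N * (1 / N + C1 / N / N)"
    define D where "D = M\<^sup>2 * N\<^sup>2"
    have D0: "D \<ge> 0" unfolding D_def by simp
    \<comment> \<open>With \<open>R\<close> the resolvent at \<open>z\<close> and
      \<open>u = R g\<close>, one has \<open>w = R (R g)\<close>, and \<open>d\<close> is
      \<open>(R - N) (R + N) g\<close>, which is small when \<open>norm u\<close> is close to
      \<open>N\<close>. Regularity at \<open>z + 1 / N\<close> bounds \<open>h' = (R + N) g\<close>
      by \<open>d\<close>; regularity at \<open>z - 1 / N\<close> bounds \<open>u\<close> by
      \<open>h'\<close>. So \<open>norm u\<close> stays away from \<open>N\<close>.\<close>
    have key: "(norm u)\<^sup>2 \<le> D * (N\<^sup>2 - (norm u)\<^sup>2)"
      if h: "(u, f) \<in> H" and g1: "norm (f - z *\<^sub>R u) \<le> 1" for u f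
    proof -
      define g where "g = f - z *\<^sub>R u"
      obtain w k where w: "(w, k) \<in> H" "k - z *\<^sub>R w = u"
        using H_solve[OF regz H_mem(1)[OF h]] by blast
      have "inner w g = inner (k - z *\<^sub>R w) u"
        unfolding g_def using sym_shift[OF w(1) h, of z] by simp
      then have wg: "inner w g = (norm u)\<^sup>2" using w(2) by (simp add: power2_norm_eq_inner)
      have wn: "norm w \<le> N * norm u" using N_bound[OF w(1)] w(2) by simp
      define d where "d = w - N\<^sup>2 *\<^sub>R g"
      have "(norm d)\<^sup>2 = (norm w)\<^sup>2 - 2 * N\<^sup>2 * inner w g + N\<^sup>2 * N\<^sup>2 * (norm g)\<^sup>2"
        unfolding d_def power2_norm_eq_inner
        by (simp add: inner_diff_left inner_diff_right inner_commute power2_eq_square)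
      moreover have "(norm w)\<^sup>2 \<le> N\<^sup>2 * (norm u)\<^sup>2"
        using power_mono[OF wn, of 2] by (simp add: power_mult_distrib)
      moreover have "N\<^sup>2 * N\<^sup>2 * (norm g)\<^sup>2 \<le> N\<^sup>2 * N\<^sup>2"
        using g1 g_def by (simp add: mult_left_le power_le_one)
      ultimately have dn: "(norm d)\<^sup>2 \<le> N\<^sup>2 * (N\<^sup>2 - (norm u)\<^sup>2)"
        using wg by (simp add: algebra_simps)
      define h' where "h' = u + N *\<^sub>R g"
      define v where "v = w + N *\<^sub>R u"
      define k' where "k' = k + N *\<^sub>R f"
      have vk: "(v, k') \<in> H" unfolding v_def k'_def by (intro H_add H_scale w h)
      have kz: "k' - z *\<^sub>R v = h'"
        unfolding v_def k'_def h'_def g_def using w(2) by (simp add: algebra_simps)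
      have "k' - (z + 1 / N) *\<^sub>R v = h' - (1 / N) *\<^sub>R v"
        using kz by (simp add: algebra_simps)
      also have "\<dots> = - (1 / N) *\<^sub>R d"
        unfolding h'_def v_def d_def using N0
        by (simp add: algebra_simps power2_eq_square)
      finally have e1: "k' - (z + 1 / N) *\<^sub>R v = - (1 / N) *\<^sub>R d" .
      have v1: "norm v \<le> C1 / N * norm d"
        using C1(2)[OF vk] N0 unfolding e1 by simp
      have "h' = (1 / N) *\<^sub>R v - (1 / N) *\<^sub>R d"
        using e1 kz by (simp add: algebra_simps)
      then have "norm h' \<le> 1 / N * norm v + 1 / N * norm d"
        using norm_triangle_ineq4[of "(1 / N) *\<^sub>R v" "(1 / N) *\<^sub>R d"] N0 by simp
      also have "\<dots> \<le> 1 / N * (C1 / N * norm d) + 1 / N * norm d"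
        using v1 N0 by (intro add_mono mult_left_mono) auto
      finally have h1: "norm h' \<le> (1 / N + C1 / N / N) * norm d"
        by (simp add: algebra_simps)
      have e2: "f - (z - 1 / N) *\<^sub>R u = (1 / N) *\<^sub>R h'"
        unfolding h'_def g_def using N0 by (simp add: algebra_simps)
      have "norm u \<le> C2 / N * norm h'"
        using C2(2)[OF h] N0 unfolding e2 by simp
      also have "\<dots> \<le> C2 / N * ((1 / N + C1 / N / N) * norm d)"
        using h1 C2(1) N0 by (intro mult_left_mono) auto
      finally have "norm u \<le> M * norm d" by (simp add: M_def)
      then have "(norm u)\<^sup>2 \<le> M\<^sup>2 * (norm d)\<^sup>2"
        unfolding power_mult_distrib[symmetric] by (intro power_mono) auto
      also have "\<dots> \<le> M\<^sup>2 * (N\<^sup>2 * (N\<^sup>2 - (norm u)\<^sup>2))"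
        using dn by (intro mult_left_mono) auto
      finally show ?thesis unfolding D_def by simp
    qed
    \<comment> \<open>\<open>q\<close> solves
      \<open>q\<^sup>2 = D * (N\<^sup>2 - q\<^sup>2)\<close>, so \<open>key\<close> bounds every
      element of \<open>U\<close> by \<open>q\<close>.\<close>
    define q where "q = sqrt (D / (1 + D)) * N"
    have "x \<le> q" if "x \<in> U" for x
    proof -
      obtain u f where x: "x = norm u" "(u, f) \<in> H" "norm (f - z *\<^sub>R u) \<le> 1"
        using \<open>x \<in> U\<close> unfolding U_def by blast
      have "(1 + D) * x\<^sup>2 \<le> D * N\<^sup>2" using key[OF x(2,3)] x(1) by (simp add: algebra_simps)
      then have "x\<^sup>2 \<le> D / (1 + D) * N\<^sup>2" using D0 by (simp add: field_simps)
      then have "x\<^sup>2 \<le> q\<^sup>2" unfolding q_def using D0 by (simp add: power_mult_distrib)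
      moreover have "q \<ge> 0" unfolding q_def using D0 N0 by simp
      ultimately show ?thesis using power2_le_imp_le by blast
    qed
    then have "N \<le> q" unfolding N_def using U0 by (intro cSup_least) auto
    moreover have "sqrt (D / (1 + D)) < 1" using D0 by simp
    then have "q < N" unfolding q_def using N0 by simp
    ultimately show False by simp
  qed
  then have "norm u \<le> 1 / \<rho> * norm (f - z *\<^sub>R u)"
    using N_bound[OF uf] by (smt (verit) mult_right_mono norm_ge_zero)
  then show ?thesis using rho by (simp add: field_simps)
qed

text \<open>For \<open>z < c\<close> all numbers within \<open>c - z\<close> of \<open>z\<close> are
  regular, so \<open>gap_bound\<close> gives
  \<open>(c - z) * norm u \<le> norm (f - z *\<^sub>R u)\<close>. After squaring, the terms in
  \<open>z\<^sup>2\<close> cancel and an inequality linear in \<open>z\<close> remains; a violation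
  of the claim is refuted by taking \<open>z\<close> far below \<open>c\<close>.\<close>

lemma form_lower_bound:
  assumes reg: "\<And>l. l < c \<Longrightarrow> regular_value K H l" and uf: "(u, f) \<in> H"
  shows "c * (norm u)\<^sup>2 \<le> inner f u"
proof (rule ccontr)
  assume "\<not> ?thesis"
  then have neg: "c * (norm u)\<^sup>2 - inner f u > 0" by simp
  define e where "e = c * (norm u)\<^sup>2 - inner f u"
  define B where "B = (norm f)\<^sup>2 - c\<^sup>2 * (norm u)\<^sup>2"
  have main: "- 2 * z * e \<le> B" if "z < c" for z
  proof -
    have "(c - z) * norm u \<le> norm (f - z *\<^sub>R u)"
      by (rule gap_bound[OF _ _ uf]) (use that reg in auto)
    then have "((c - z) * norm u)\<^sup>2 \<le> (norm (f - z *\<^sub>R u))\<^sup>2"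
      using that by (intro power_mono) auto
    moreover have "(norm (f - z *\<^sub>R u))\<^sup>2 = (norm f)\<^sup>2 - 2 * z * inner f u + z\<^sup>2 * (norm u)\<^sup>2"
      unfolding power2_norm_eq_inner
      by (simp add: inner_diff_left inner_diff_right inner_commute power2_eq_square)
    ultimately show ?thesis unfolding e_def B_def
      by (simp add: power_mult_distrib power2_eq_square algebra_simps)
  qed
  define z where "z = min (c - 1) (- (\<bar>B\<bar> + 1) / (2 * e))"
  have "z < c" unfolding z_def by simp
  have "z \<le> - (\<bar>B\<bar> + 1) / (2 * e)" unfolding z_def by simp
  then have "- 2 * z * e \<ge> \<bar>B\<bar> + 1" using neg unfolding e_def[symmetric]
    by (simp add: field_simps)
  then show False using main[OF \<open>z < c\<close>] by linarith
qed

text \<open>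
  For \<open>R = (H - l + 1)\<^sup>-\<^sup>1\<close> the gap above \<open>l\<close> makes \<open>R\<close> a contraction on the range of \<open>1 - R\<close>.
  As \<open>1 - R\<close> is injective, \<open>R\<^sup>n g \<longlonglongrightarrow> 0\<close>, so that range is dense and \<open>1 - R\<close> is invertible.
\<close>

lemma regular_at_bottom:
  assumes eps: "\<epsilon> > 0"
    and below: "\<And>z. z < l \<Longrightarrow> regular_value K H z"
    and above: "\<And>z. l < z \<Longrightarrow> z < l + \<epsilon> \<Longrightarrow> regular_value K H z"
    and ker: "\<And>u. (u, l *\<^sub>R u) \<in> H \<Longrightarrow> u = 0"
  shows "regular_value K H l"
proof -
  have pos: "0 \<le> inner (f - l *\<^sub>R u) u" if "(u, f) \<in> H" for u f
    using form_lower_bound[OF below that]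
    by (simp add: inner_diff_left power2_norm_eq_inner)
  \<comment> \<open>In operator form this is
    \<open>(H - l)\<^sup>2 \<ge> \<epsilon> (H - l)\<close>: \<open>gap_bound\<close> is applied at
    the midpoint of the gap above \<open>l\<close>, with radius
    \<open>\<epsilon> / 2\<close>.\<close>
  have gap: "\<epsilon> * inner (f - l *\<^sub>R u) u \<le> (norm (f - l *\<^sub>R u))\<^sup>2" if h: "(u, f) \<in> H" for u f
  proof -
    define k where "k = f - l *\<^sub>R u"
    have "\<epsilon> / 2 * norm u \<le> norm (f - (l + \<epsilon> / 2) *\<^sub>R u)"
      by (rule gap_bound[OF _ _ h]) (use eps in \<open>auto intro!: above simp: abs_if split: if_splits\<close>)
    moreover have "f - (l + \<epsilon> / 2) *\<^sub>R u = k - (\<epsilon> / 2) *\<^sub>R u"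
      unfolding k_def by (simp add: algebra_simps)
    ultimately have "(\<epsilon> / 2 * norm u)\<^sup>2 \<le> (norm (k - (\<epsilon> / 2) *\<^sub>R u))\<^sup>2"
      using eps by (intro power_mono) auto
    also have "\<dots> = (norm k)\<^sup>2 - \<epsilon> * inner k u + (\<epsilon> / 2 * norm u)\<^sup>2"
      unfolding power_mult_distrib power2_norm_eq_inner
      by (simp add: inner_diff_left inner_diff_right inner_commute power2_eq_square)
    finally show ?thesis unfolding k_def by simp
  qed
  have regm: "regular_value K H (l - 1)" using below by simp
  define R where "R = resolvent (l - 1)"
  define F where "F g = g + (l - 1) *\<^sub>R R g" for g
  note RF = resolvent_graph[OF regm, folded R_def, folded F_def]
    and RK = resolvent_mem[OF regm, folded R_def]
    and R_unique = resolvent_unique[OF regm, folded R_def]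
    and R_add = resolvent_add[OF regm, folded R_def]
    and R_diff = resolvent_diff[OF regm, folded R_def]
    and R_scale = resolvent_scale[OF regm, folded R_def]
  have FB: "F g - l *\<^sub>R R g = g - R g" for g unfolding F_def by (simp add: algebra_simps)
  obtain C where R_bound: "C > 0" "\<And>g. g \<in> K \<Longrightarrow> norm (R g) \<le> C * norm g"
    using resolvent_bounded[OF regm, folded R_def] by blast
  have BK: "g - R g \<in> K" if "g \<in> K" for g using K_diff RK that by blast
  have Bsym: "inner (g - R g) h = inner g (h - R h)" if "g \<in> K" "h \<in> K" for g h
  proof -
    have "inner (F g) (R h) = inner (R g) (F h)" by (rule sym[OF RF[OF that(1)] RF[OF that(2)]])
    then have "inner g (R h) = inner (R g) h"
      unfolding F_def by (simp add: inner_add_left inner_add_right)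
    then show ?thesis by (simp add: inner_diff_left inner_diff_right)
  qed
  have Bpos: "0 \<le> inner (g - R g) g" if "g \<in> K" for g
  proof -
    have "0 \<le> inner (g - R g) (R g)" using pos[OF RF[OF that]] unfolding FB .
    moreover have "0 \<le> inner (g - R g) (g - R g)" by simp
    ultimately show ?thesis by (simp add: inner_diff_left inner_diff_right)
  qed
  \<comment> \<open>\<open>1 - R\<close> is the function \<open>x / (x + 1)\<close> of
    \<open>x = H - l\<close>, and \<open>1 / \<kappa>\<close> is its value at
    \<open>x = \<epsilon>\<close>. A lower bound \<open>1 / \<kappa>\<close> for
    \<open>1 - R\<close> on its range produces the contraction factor \<open>q\<close>.\<close>
  define \<kappa> where "\<kappa> = 1 + 1 / \<epsilon>"
  have kap: "\<kappa> > 1" unfolding \<kappa>_def using eps by simp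
  define q where "q = sqrt (1 - 1 / \<kappa>)"
  have q: "0 \<le> q" "q < 1" unfolding q_def using kap by auto
  have contr_ran: "norm (R (g - R g)) \<le> q * norm (g - R g)" if g: "g \<in> K" for g
  proof -
    define y where "y = g - R g"
    have y: "y \<in> K" unfolding y_def using BK[OF g] .
    have "inner y g = inner y (R g) + inner y y"
      unfolding y_def by (simp add: inner_diff_left inner_diff_right)
    moreover have "\<epsilon> * inner y (R g) \<le> (norm y)\<^sup>2"
      using gap[OF RF[OF g]] unfolding FB y_def .
    ultimately have a: "inner y g \<le> \<kappa> * (norm y)\<^sup>2"
      unfolding \<kappa>_def using eps by (simp add: field_simps power2_norm_eq_inner)
    have gk: "g - \<kappa> *\<^sub>R y \<in> K"
      using g y K_diff K_scale by blast
    have sK: "\<kappa> *\<^sub>R y \<in> K" using y K_scale by blast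
    have e1: "g - \<kappa> *\<^sub>R y - R (g - \<kappa> *\<^sub>R y) = y - \<kappa> *\<^sub>R (y - R y)"
      unfolding R_diff[OF g sK] R_scale[OF y] by (simp add: y_def algebra_simps)
    have e2: "inner (y - R y) g = inner y y"
      using Bsym[OF y g] unfolding y_def[symmetric] .
    \<comment> \<open>Positivity of \<open>1 - R\<close> is tested at the shifted vector
      \<open>g - \<kappa> *\<^sub>R y\<close>. Together with the upper bound \<open>a\<close> for
      \<open>inner y g\<close> it becomes the lower bound \<open>b\<close> for
      \<open>inner (y - R y) y\<close>.\<close>
    have "0 \<le> inner (y - \<kappa> *\<^sub>R (y - R y)) (g - \<kappa> *\<^sub>R y)"
      using Bpos[OF gk] unfolding e1 .
    also have "\<dots> = inner y g - 2 * \<kappa> * (norm y)\<^sup>2 + \<kappa>\<^sup>2 * inner (y - R y) y"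
      using e2 unfolding power2_norm_eq_inner
      by (simp add: inner_diff_left inner_diff_right inner_commute power2_eq_square algebra_simps)
    finally have "\<kappa> * (norm y)\<^sup>2 \<le> \<kappa> * (\<kappa> * inner (y - R y) y)"
      using a by (simp add: power2_eq_square algebra_simps)
    then have b: "(norm y)\<^sup>2 \<le> \<kappa> * inner (y - R y) y" using kap by simp
    have "0 \<le> inner (y - R y) (R y)" using pos[OF RF[OF y]] unfolding FB .
    then have "(norm (R y))\<^sup>2 \<le> inner y (R y)"
      by (simp add: inner_diff_left power2_norm_eq_inner)
    also have "\<dots> = (norm y)\<^sup>2 - inner (y - R y) y"
      by (simp add: inner_diff_left inner_diff_right power2_norm_eq_inner inner_commute)
    also have "\<dots> \<le> (1 - 1 / \<kappa>) * (norm y)\<^sup>2"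
      using b kap by (simp add: field_simps)
    also have "\<dots> = (q * norm y)\<^sup>2" unfolding q_def using kap by (simp add: power_mult_distrib)
    finally show ?thesis unfolding y_def[symmetric] using q(1)
      by (meson mult_nonneg_nonneg norm_ge_zero power2_le_imp_le)
  qed
  have Rn_K: "(R ^^ n) g \<in> K" if "g \<in> K" for g n
    by (induction n) (auto intro: RK that)
  have Rn_diff: "(R ^^ n) (g - h) = (R ^^ n) g - (R ^^ n) h" if "g \<in> K" "h \<in> K" for g h n
    by (induction n) (auto simp: R_diff Rn_K that)
  have Rn_lim: "(\<lambda>n. (R ^^ n) g) \<longlonglongrightarrow> 0" if g: "g \<in> K" for g
  proof -
    \<comment> \<open>Up to sign, the increments of \<open>(R ^^ n) g\<close> are
      \<open>(R ^^ n) y\<close> with \<open>y\<close> in the range of \<open>1 - R\<close>. They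
      decay geometrically, so the iterates converge; the limit is a fixed point of \<open>R\<close>,
      which means a vector in the kernel of \<open>H - l\<close>.\<close>
    define y where "y = g - R g"
    have dn: "(R ^^ n) y = (R ^^ n) g - (R ^^ Suc n) g" for n
      unfolding y_def Rn_diff[OF g RK[OF g]] by (simp add: funpow_swap1)
    have nn: "norm ((R ^^ n) y) \<le> q ^ n * norm y" for n
    proof (induction n)
      case (Suc n)
      have "norm ((R ^^ Suc n) y) = norm (R ((R ^^ n) g - R ((R ^^ n) g)))"
        using dn[of n] by simp
      also have "\<dots> \<le> q * norm ((R ^^ n) y)"
        using contr_ran[OF Rn_K[OF g, of n]] dn[of n] by simp
      also have "\<dots> \<le> q * (q ^ n * norm y)" using Suc q by (intro mult_left_mono) auto
      finally show ?case by simp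
    qed simp
    have "summable (\<lambda>n. q ^ n * norm y)"
      using q by (intro summable_mult2 summable_geometric) auto
    then have "summable (\<lambda>n. (R ^^ n) y)"
      by (rule summable_comparison_test'[where N = 0]) (rule nn)
    then have "convergent (\<lambda>n. \<Sum>m<n. (R ^^ m) y)" using summable_iff_convergent by blast
    moreover have "(\<Sum>m<n. (R ^^ m) y) = g - (R ^^ n) g" for n
      unfolding dn using sum_lessThan_telescope'[of "\<lambda>n. (R ^^ n) g" n] by simp
    ultimately obtain p' where "(\<lambda>n. g - (R ^^ n) g) \<longlonglongrightarrow> p'" unfolding convergent_def by auto
    from tendsto_diff[OF tendsto_const[of g] this]
    obtain p where p: "(\<lambda>n. (R ^^ n) g) \<longlonglongrightarrow> p" by auto
    have pK: "p \<in> K" using closed_sequentially[OF closed_K _ p] Rn_K[OF g] by blast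
    have "(\<lambda>n. R ((R ^^ n) g) - R p) \<longlonglongrightarrow> 0"
    proof (rule Lim_null_comparison)
      show "\<forall>\<^sub>F n in sequentially. norm (R ((R ^^ n) g) - R p) \<le> C * norm ((R ^^ n) g - p)"
        using R_bound(2)[OF K_diff[OF Rn_K[OF g] pK]]
        by (simp add: R_diff[OF Rn_K[OF g] pK])
      show "(\<lambda>n. C * norm ((R ^^ n) g - p)) \<longlonglongrightarrow> 0"
        using p by (intro tendsto_mult_right_zero tendsto_norm_zero) (simp add: LIM_zero)
    qed
    then have "(\<lambda>n. (R ^^ Suc n) g) \<longlonglongrightarrow> R p" by (simp add: LIM_zero_iff)
    then have "R p = p" using LIMSEQ_Suc[OF p] LIMSEQ_unique by blast
    then have "(p, l *\<^sub>R p) \<in> H" using RF[OF pK] unfolding F_def by (simp add: algebra_simps)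
    then have "p = 0" by (rule ker)
    then show ?thesis using p by simp
  qed
  have contr: "norm (R g) \<le> q * norm g" if g: "g \<in> K" for g
  proof -
    \<comment> \<open>Every \<open>s n\<close> lies in the range of \<open>1 - R\<close> and
      \<open>s n\<close> tends to \<open>g\<close>, so the contraction bound passes from the range
      to all of \<open>K\<close>.\<close>
    define s where "s n = g - (R ^^ n) g" for n
    have s_ran: "\<exists>h\<in>K. s n = h - R h" for n
    proof (induction n)
      case 0
      have "0 \<in> K" using K_0 .
      moreover have "R 0 = 0" using R_scale[OF g, of 0] by simp
      ultimately show ?case by (intro bexI[of _ 0]) (simp_all add: s_def)
    next
      case (Suc n)
      then obtain h where h: "h \<in> K" "s n = h - R h" by blast
      have "s (Suc n) = (h + (R ^^ n) g) - R (h + (R ^^ n) g)"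
        unfolding R_add[OF h(1) Rn_K[OF g]] using h(2) unfolding s_def
        by (simp add: algebra_simps)
      then show ?case by (intro bexI[of _ "h + (R ^^ n) g"] K_add[OF h(1) Rn_K[OF g]])
    qed
    have sK: "s n \<in> K" for n unfolding s_def using K_diff[OF g Rn_K[OF g]] .
    have s_lim: "s \<longlonglongrightarrow> g"
      using tendsto_diff[OF tendsto_const[of g] Rn_lim[OF g]] unfolding s_def by simp
    have "R (s n) = R g - (R ^^ Suc n) g" for n
      unfolding s_def R_diff[OF g Rn_K[OF g]] by simp
    then have Rs_lim: "(\<lambda>n. R (s n)) \<longlonglongrightarrow> R g"
      using tendsto_diff[OF tendsto_const[of "R g"] LIMSEQ_Suc[OF Rn_lim[OF g]]] by simp
    have "norm (R (s n)) \<le> q * norm (s n)" for n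
    proof -
      obtain h where "h \<in> K" "s n = h - R h" using s_ran[of n] by blast
      then show ?thesis using contr_ran[of h] by simp
    qed
    then show ?thesis
      by (intro LIMSEQ_le[OF tendsto_norm[OF Rs_lim] tendsto_mult_left[OF tendsto_norm[OF s_lim]]])
         (rule exI[of _ 0], simp)
  qed
  have surj: "\<exists>u f. (u, f) \<in> H \<and> f - l *\<^sub>R u = g" if g: "g \<in> K" for g
  proof -
    \<comment> \<open>The fixed point \<open>w\<close> inverts \<open>1 - R\<close> at
      \<open>g\<close>; then \<open>u = R w\<close> solves the equation at \<open>l\<close>.\<close>
    have "\<exists>!w\<in>K. g + R w = w"
    proof (rule Banach_fix[OF _ _ q])
      show "complete K" using closed_K complete_eq_closed by blast
      show "K \<noteq> {}" using g by auto
      show "(\<lambda>w. g + R w) ` K \<subseteq> K" using g RK K_add by blast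
      fix w v assume "w \<in> K" "v \<in> K"
      then show "dist (g + R w) (g + R v) \<le> q * dist w v"
        using contr[OF K_diff[of w v]] by (simp add: dist_norm R_diff)
    qed
    then obtain w where w: "w \<in> K" "g + R w = w" by blast
    then have "F w - l *\<^sub>R R w = g" unfolding FB by (simp add: algebra_simps)
    then show ?thesis using RF[OF w(1)] by blast
  qed
  have "norm u \<le> q / (1 - q) * norm (f - l *\<^sub>R u)" if h: "(u, f) \<in> H" for u f
  proof -
    have gK: "f - (l - 1) *\<^sub>R u \<in> K"
      using H_mem[OF h] K_diff K_scale by blast
    have "u = R (f - (l - 1) *\<^sub>R u)" by (rule R_unique[OF h refl gK, symmetric])
    then have "norm u \<le> q * norm (f - (l - 1) *\<^sub>R u)" using contr[OF gK] by simp
    also have "f - (l - 1) *\<^sub>R u = (f - l *\<^sub>R u) + u" by (simp add: algebra_simps)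
    also have "q * norm \<dots> \<le> q * (norm (f - l *\<^sub>R u) + norm u)"
      using q by (intro mult_left_mono norm_triangle_ineq)
    finally show ?thesis using q by (simp add: field_simps)
  qed
  then show ?thesis unfolding regular_value_def using surj by blast
qed

text \<open>Solving at \<open>z\<close> is the fixed point problem
  \<open>w = g + (z - l) R w\<close> for the resolvent \<open>R\<close> at \<open>l\<close>. Within
  distance \<open>1 / (2 * C)\<close> it is a contraction with constant \<open>1/2\<close>.\<close>

lemma regular_value_open:
  assumes "regular_value K H l"
  obtains \<epsilon> where "\<epsilon> > 0" "\<And>z. \<bar>z - l\<bar> < \<epsilon> \<Longrightarrow> regular_value K H z"
proof -
  obtain C where C: "C > 0" "\<And>u f. (u, f) \<in> H \<Longrightarrow> norm u \<le> C * norm (f - l *\<^sub>R u)"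
    using regular_valueE[OF assms] by blast
  define R where "R = resolvent l"
  note RH = resolvent_graph[OF assms, folded R_def] and RK = resolvent_mem[OF assms, folded R_def]
  have R_dist: "norm (R g - R h) \<le> C * norm (g - h)" if "g \<in> K" "h \<in> K" for g h
    using C(2)[OF RH[OF K_diff[OF that]]]
    by (simp add: resolvent_diff[OF assms, folded R_def] that)
  have "regular_value K H z" if z: "\<bar>z - l\<bar> < 1 / (2 * C)" for z
  proof -
    have zC: "\<bar>z - l\<bar> * C \<le> 1 / 2" using z C(1) by (simp add: field_simps)
    have "\<exists>u f. (u, f) \<in> H \<and> f - z *\<^sub>R u = g" if g: "g \<in> K" for g
    proof -
      have "\<exists>!w\<in>K. g + (z - l) *\<^sub>R R w = w"
      proof (rule Banach_fix[of K "1/2"])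
        show "complete K" using closed_K complete_eq_closed by blast
        show "K \<noteq> {}" using g by auto
        show "(\<lambda>w. g + (z - l) *\<^sub>R R w) ` K \<subseteq> K"
          using g RK K_add K_scale by blast
        fix w v assume wv: "w \<in> K" "v \<in> K"
        have "norm ((z - l) *\<^sub>R (R w - R v)) \<le> \<bar>z - l\<bar> * (C * norm (w - v))"
          using R_dist[OF wv] by (simp add: mult_left_mono)
        also have "\<dots> \<le> 1 / 2 * norm (w - v)"
          using zC mult_right_mono[of "\<bar>z - l\<bar> * C" "1/2" "norm (w - v)"] by (simp add: mult.assoc)
        finally show "dist (g + (z - l) *\<^sub>R R w) (g + (z - l) *\<^sub>R R v) \<le> 1 / 2 * dist w v"
          by (simp add: dist_norm scaleR_diff_right)
      qed auto
      then obtain w where w: "w \<in> K" "g + (z - l) *\<^sub>R R w = w" by blast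
      have "w + l *\<^sub>R R w - z *\<^sub>R R w = w - (z - l) *\<^sub>R R w" by (simp add: algebra_simps)
      also have "\<dots> = g" using w(2) by (simp add: algebra_simps)
      finally show ?thesis using RH[OF w(1)] by blast
    qed
    moreover have "norm u \<le> 2 * C * norm (f - z *\<^sub>R u)" if h: "(u, f) \<in> H" for u f
    proof -
      have "norm u \<le> C * norm ((f - z *\<^sub>R u) + (z - l) *\<^sub>R u)"
        using C(2)[OF h] by (simp add: algebra_simps)
      also have "\<dots> \<le> C * (norm (f - z *\<^sub>R u) + \<bar>z - l\<bar> * norm u)"
        using C(1) norm_triangle_ineq[of "f - z *\<^sub>R u" "(z - l) *\<^sub>R u"] by simp
      also have "\<dots> \<le> C * norm (f - z *\<^sub>R u) + 1 / 2 * norm u"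
        using mult_right_mono[OF zC, of "norm u"] by (simp add: algebra_simps)
      finally show ?thesis by simp
    qed
    ultimately show ?thesis unfolding regular_value_def by blast
  qed
  then show thesis using that[of "1 / (2 * C)"] C(1) by simp
qed

end

section \<open>Splitting off finitely many eigenvectors\<close>

definition orth_compl :: "'h::real_inner set \<Rightarrow> 'h set" where
  "orth_compl E = {u. \<forall>e\<in>E. inner u e = 0}"

lemma subspace_orth_compl: "subspace (orth_compl E)"
  unfolding orth_compl_def subspace_def by (auto simp: inner_add_left)

lemma closed_orth_compl: "closed (orth_compl E)"
proof -
  have "orth_compl E = (\<Inter>e\<in>E. {u. inner u e = 0})" unfolding orth_compl_def by auto
  then show ?thesis by (auto intro!: closed_INT closed_Collect_eq continuous_intros)
qed

definition restrict_rel :: "('h \<times> 'h) set \<Rightarrow> 'h::real_inner set \<Rightarrow> ('h \<times> 'h) set" where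
  "restrict_rel H E = H \<inter> (orth_compl E \<times> orth_compl E)"

text \<open>The hypotheses on the spectrum as they appear at real parameters. Multiplicity is an
  inclusion in a span, since the finite set \<open>B\<close> need not consist of
  eigenvectors.\<close>

locale discrete_symmetric_relation = symmetric_relation UNIV H
  for H :: "('h::{real_inner, banach} \<times> 'h) set" +
  fixes c :: real
  assumes below_c: "\<And>l. l < c \<Longrightarrow> regular_value UNIV H l"
    and isolated: "\<And>l. \<not> regular_value UNIV H l \<Longrightarrow>
        \<exists>\<epsilon>>0. \<forall>z. z \<noteq> l \<longrightarrow> \<bar>z - l\<bar> < \<epsilon> \<longrightarrow> regular_value UNIV H z"
    and finite_mult: "\<And>l. \<not> regular_value UNIV H l \<Longrightarrow>
        \<exists>B. finite B \<and> {u. (u, l *\<^sub>R u) \<in> H} \<subseteq> span B"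
begin

definition eigenvectors :: "'h set \<Rightarrow> bool" where
  "eigenvectors E \<longleftrightarrow> (\<forall>e\<in>E. \<exists>l. (e, l *\<^sub>R e) \<in> H)"

lemma restrict_symmetric_relation:
  "symmetric_relation (orth_compl E) (restrict_rel H E)"
proof
  show "subspace (restrict_rel H E)"
    unfolding restrict_rel_def
    by (intro subspace_inter subspace_H subspace_Times subspace_orth_compl)
qed (auto simp: restrict_rel_def intro: sym subspace_orth_compl closed_orth_compl)

text \<open>Symmetry gives \<open>(l - z) * inner u e = inner (f - z *\<^sub>R u) e\<close>. So
  solving at \<open>z\<close> preserves orthogonality to eigenvectors whose eigenvalue differs from
  \<open>z\<close>.\<close>

lemma eigen_orth:
  assumes "(u, f) \<in> H" "(e, l *\<^sub>R e) \<in> H" "inner (f - z *\<^sub>R u) e = 0" "l \<noteq> z"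
  shows "inner u e = 0"
proof -
  have "inner f e = l * inner u e" using sym[OF assms(1,2)] by simp
  then have "(l - z) * inner u e = 0" using assms(3) by (simp add: inner_diff_left algebra_simps)
  then show ?thesis using assms(4) by simp
qed

lemma restrict_mem:
  assumes "(u, f) \<in> H" "u \<in> orth_compl E" "eigenvectors E"
  shows "(u, f) \<in> restrict_rel H E"
proof -
  have "inner f e = 0" if "e \<in> E" for e
  proof -
    have "\<exists>l. (e, l *\<^sub>R e) \<in> H" using assms(3) that by (simp add: eigenvectors_def)
    then obtain l where l: "(e, l *\<^sub>R e) \<in> H" ..
    have "inner u e = 0" using assms(2) that unfolding orth_compl_def by blast
    moreover have "inner f e = inner u (l *\<^sub>R e)" by (rule sym[OF assms(1) l])
    ultimately show ?thesis by simp
  qed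
  then show ?thesis using assms unfolding restrict_rel_def orth_compl_def by auto
qed

text \<open>By \<open>eigen_orth\<close> the solution found in the larger complement is orthogonal
  to the new eigenvectors and stays in the smaller one. Vectors already in \<open>E\<close> may well
  have eigenvalue \<open>z\<close>; orthogonality to them comes from the assumption on
  \<open>E\<close>.\<close>

lemma regular_restrict:
  assumes reg: "regular_value (orth_compl E) (restrict_rel H E) z"
    and sub: "E \<subseteq> E'" and eig: "eigenvectors E'"
    and ne: "\<And>e. e \<in> E' - E \<Longrightarrow> \<exists>l. l \<noteq> z \<and> (e, l *\<^sub>R e) \<in> H"
  shows "regular_value (orth_compl E') (restrict_rel H E') z"
proof -
  have oc: "orth_compl E' \<subseteq> orth_compl E" using sub unfolding orth_compl_def by auto
  then have rs: "restrict_rel H E' \<subseteq> restrict_rel H E" unfolding restrict_rel_def by auto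
  have "\<exists>u f. (u, f) \<in> restrict_rel H E' \<and> f - z *\<^sub>R u = g" if g: "g \<in> orth_compl E'" for g
  proof -
    obtain u f where uf: "(u, f) \<in> restrict_rel H E" "f - z *\<^sub>R u = g"
      using reg g oc unfolding regular_value_def by blast
    have uH: "(u, f) \<in> H" "u \<in> orth_compl E" using uf unfolding restrict_rel_def by auto
    have "inner u e = 0" if e: "e \<in> E'" for e
    proof (cases "e \<in> E")
      case True
      then show ?thesis using uH unfolding orth_compl_def by simp
    next
      case False
      then obtain l where "l \<noteq> z" "(e, l *\<^sub>R e) \<in> H" using ne e by blast
      then show ?thesis using eigen_orth[OF uH(1)] uf(2) g e unfolding orth_compl_def by auto
    qed
    then have "u \<in> orth_compl E'" unfolding orth_compl_def by simp
    then show ?thesis using restrict_mem[OF uH(1) _ eig] uf by blast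
  qed
  then show ?thesis using reg rs unfolding regular_value_def by blast
qed

lemma restrict_empty: "orth_compl {} = UNIV" "restrict_rel H {} = H"
  unfolding restrict_rel_def orth_compl_def by auto

lemma regular_not_eigenvalue:
  assumes "regular_value UNIV H z" "(e, z *\<^sub>R e) \<in> H"
  shows "e = 0"
proof -
  obtain C where C: "C > 0" "\<And>u f. (u, f) \<in> H \<Longrightarrow> norm u \<le> C * norm (f - z *\<^sub>R u)"
    using regular_valueE[OF assms(1)] by blast
  from C(2)[OF assms(2)] show ?thesis by simp
qed

lemma regular_restrict_UNIV:
  assumes reg: "regular_value UNIV H z" and eig: "eigenvectors E"
  shows "regular_value (orth_compl E) (restrict_rel H E) z"
proof (rule regular_restrict[where E = "{}"])
  fix e assume e: "e \<in> E - {}"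
  then obtain l where l: "(e, l *\<^sub>R e) \<in> H" using eig unfolding eigenvectors_def by blast
  show "\<exists>l. l \<noteq> z \<and> (e, l *\<^sub>R e) \<in> H"
  proof (cases "l = z")
    case True
    then have "e = 0" using regular_not_eigenvalue[OF reg] l by simp
    \<comment> \<open>The zero vector is an eigenvector for every number, so \<open>z + 1\<close>
      can serve.\<close>
    then show ?thesis using l by (intro exI[of _ "z + 1"]) auto
  qed (use l in blast)
qed (use reg eig in \<open>auto simp: restrict_empty\<close>)

text \<open>Continuation along the real line. If the admissible bounds \<open>l\<close> had a finite
  supremum \<open>m\<close>, a basis of the eigenspace at \<open>m\<close> could be added to a set
  \<open>E\<close> that works up to a point close to \<open>m\<close>. On the new complement
  everything below \<open>m\<close> and just above it is regular and the kernel at \<open>m\<close>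
  is trivial, so \<open>regular_at_bottom\<close> makes \<open>m\<close> regular and
  \<open>m + \<epsilon>\<close> admissible.\<close>

lemma finite_restrict_regular:
  "\<exists>E. finite E \<and> eigenvectors E \<and>
       (\<forall>z<l. regular_value (orth_compl E) (restrict_rel H E) z)"
proof -
  define S where "S = {l. \<exists>E. finite E \<and> eigenvectors E \<and>
       (\<forall>z<l. regular_value (orth_compl E) (restrict_rel H E) z)}"
  have cS: "c \<in> S" unfolding S_def
    using below_c by (auto intro!: exI[of _ "{}"] simp: restrict_empty eigenvectors_def)
  have "\<not> bdd_above S"
  proof
    assume bdd: "bdd_above S"
    define m where "m = Sup S"
    obtain \<epsilon> where eps: "\<epsilon> > 0"
      "\<And>z. z \<noteq> m \<Longrightarrow> \<bar>z - m\<bar> < \<epsilon> \<Longrightarrow> regular_value UNIV H z"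
      using isolated[of m] regular_value_open[of m] by metis
    define N where "N = {u. (u, m *\<^sub>R u) \<in> H}"
    \<comment> \<open>\<open>finite_mult\<close> yields a finite spanning set whose elements may lie
      outside the eigenspace. A basis inside \<open>N\<close> is taken so that \<open>E'\<close>
      consists of eigenvectors.\<close>
    obtain B where B: "finite B" "B \<subseteq> N" "N \<subseteq> span B"
    proof (cases "regular_value UNIV H m")
      case True
      then have "N \<subseteq> {0}" using regular_not_eigenvalue unfolding N_def by auto
      then show thesis using that[of "{}"] by simp
    next
      case False
      then obtain B0 where B0: "finite B0" "N \<subseteq> span B0" using finite_mult unfolding N_def by blast
      obtain B where B: "B \<subseteq> N" "independent B" "N \<subseteq> span B"
        using maximal_independent_subset[of N] by blast
      have "finite B" using independent_span_bound[OF B0(1) B(2)] B B0 by blast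
      then show thesis using that B by blast
    qed
    \<comment> \<open>Numbers below \<open>s\<close> are covered by \<open>E\<close>, those between
      \<open>s\<close> and \<open>m\<close> by the punctured neighbourhood of radius
      \<open>\<epsilon>\<close> around \<open>m\<close>.\<close>
    obtain s where s: "s \<in> S" "m - \<epsilon> < s"
      using less_cSupD[of S "m - \<epsilon>"] cS eps(1) unfolding m_def by auto
    then obtain E where E: "finite E" "eigenvectors E"
      "\<And>z. z < s \<Longrightarrow> regular_value (orth_compl E) (restrict_rel H E) z"
      unfolding S_def by blast
    define E' where "E' = E \<union> B"
    have E': "finite E'" "eigenvectors E'"
      using E B unfolding E'_def eigenvectors_def N_def by auto
    interpret r: symmetric_relation "orth_compl E'" "restrict_rel H E'"
      by (rule restrict_symmetric_relation)
    have below: "regular_value (orth_compl E') (restrict_rel H E') z" if z: "z < m" for z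
    proof (cases "z < s")
      case True
      show ?thesis
      proof (rule regular_restrict[OF E(3)[OF True]])
        show "\<exists>l. l \<noteq> z \<and> (e, l *\<^sub>R e) \<in> H" if "e \<in> E' - E" for e
          using that B(2) z unfolding E'_def N_def by (intro exI[of _ m]) auto
      qed (use E' in \<open>auto simp: E'_def\<close>)
    next
      case False
      then show ?thesis using regular_restrict_UNIV[OF eps(2) E'(2)] z s by simp
    qed
    have above: "regular_value (orth_compl E') (restrict_rel H E') z"
      if "m < z" "z < m + \<epsilon>" for z
      using regular_restrict_UNIV[OF eps(2) E'(2)] that by simp
    have "regular_value (orth_compl E') (restrict_rel H E') m"
    proof (rule r.regular_at_bottom[OF eps(1) below above])
      fix u assume u: "(u, m *\<^sub>R u) \<in> restrict_rel H E'"
      then have "u \<in> N" "u \<in> orth_compl B"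
        unfolding restrict_rel_def N_def E'_def orth_compl_def by auto
      then have "u \<in> span B" using B by blast
      moreover have "orthogonal u b" if "b \<in> B" for b
        using \<open>u \<in> orth_compl B\<close> that unfolding orth_compl_def orthogonal_def by simp
      ultimately have "orthogonal u u" using orthogonal_to_span by blast
      then show "u = 0" by (simp add: orthogonal_def)
    qed
    then have "regular_value (orth_compl E') (restrict_rel H E') z" if "z < m + \<epsilon>" for z
      using below above that by (cases z m rule: linorder_cases) auto
    then have "m + \<epsilon> \<in> S" unfolding S_def using E' by blast
    then show False using cSup_upper[OF _ bdd] eps(1) unfolding m_def by fastforce
  qed
  then obtain s where "s \<in> S" "l < s" unfolding bdd_above_def by (meson not_le)
  then show ?thesis unfolding S_def by (smt (verit) mem_Collect_eq)
qed

text \<open>The part of the min-max principle that localisation at infinity requires: finitely many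
  linear constraints push the form up to any prescribed level.\<close>

theorem finite_codim_form_bound:
  "\<exists>E. finite E \<and> (\<forall>(u, f)\<in>H. u \<in> orth_compl E \<longrightarrow> l * (norm u)\<^sup>2 \<le> inner f u)"
proof -
  obtain E where E: "finite E" "eigenvectors E"
    "\<And>z. z < l \<Longrightarrow> regular_value (orth_compl E) (restrict_rel H E) z"
    using finite_restrict_regular by blast
  interpret r: symmetric_relation "orth_compl E" "restrict_rel H E"
    by (rule restrict_symmetric_relation)
  show ?thesis
    using r.form_lower_bound[OF E(3)] restrict_mem[OF _ _ E(2)] E(1) by blast
qed

end

text \<open>\<open>P\<close> takes values in the span of \<open>E\<close> and vanishes only on
  \<open>orth_compl E\<close>. The \<open>card E + 1\<close> values \<open>P (x i)\<close> are
  linearly dependent, and the same coefficients serve for the \<open>x i\<close>.\<close>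

lemma exists_combination_orth:
  fixes x :: "nat \<Rightarrow> 'h::real_inner"
  assumes "finite E"
  shows "\<exists>a. (\<exists>i\<le>card E. a i \<noteq> 0) \<and> (\<Sum>i\<le>card E. a i *\<^sub>R x i) \<in> orth_compl E"
proof -
  define n where "n = card E"
  define P where "P w = (\<Sum>e\<in>E. inner w e *\<^sub>R e)" for w
  have P_lin: "linear P" unfolding P_def
    by (rule linearI) (auto simp: inner_add_left scaleR_add_left sum.distrib scaleR_sum_right)
  have P_orth: "w \<in> orth_compl E" if "P w = 0" for w
  proof -
    have "0 = inner w (P w)" using that by simp
    also have "\<dots> = (\<Sum>e\<in>E. (inner w e)\<^sup>2)"
      unfolding P_def by (simp add: inner_sum_right power2_eq_square)
    finally show ?thesis using assms unfolding orth_compl_def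
      by (simp add: sum_nonneg_eq_0_iff)
  qed
  have P_span: "P w \<in> span E" for w
    unfolding P_def by (intro span_sum span_scale span_base)
  have "\<exists>a. (\<exists>i\<le>n. a i \<noteq> 0) \<and> (\<Sum>i\<le>n. a i *\<^sub>R P (x i)) = 0"
  \<comment> \<open>Dependence is a property of sets and does not see repeated values, so coinciding
    images are treated separately.\<close>
  proof (cases "inj_on (\<lambda>i. P (x i)) {..n}")
    case False
    then obtain i j where ij: "i \<le> n" "j \<le> n" "i \<noteq> j" "P (x i) = P (x j)"
      unfolding inj_on_def by auto
    define a where "a k = (if k = i then 1 else if k = j then - 1 else 0 :: real)" for k
    have "(\<Sum>k\<le>n. a k *\<^sub>R P (x k)) = (\<Sum>k\<in>{i, j}. a k *\<^sub>R P (x k))"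
      by (rule sum.mono_neutral_right) (use ij in \<open>auto simp: a_def\<close>)
    also have "\<dots> = 0" using ij by (simp add: a_def)
    finally show ?thesis using ij by (intro exI[of _ a]) (auto simp: a_def)
  next
    case True
    define T where "T = (\<lambda>i. P (x i)) ` {..n}"
    have "card T = Suc n" unfolding T_def using card_image[OF True] by simp
    moreover have "T \<subseteq> span E" unfolding T_def using P_span by auto
    ultimately have "dependent T"
      using independent_span_bound[OF assms, of T] unfolding n_def by auto
    moreover have "finite T" unfolding T_def by simp
    ultimately obtain u v where u: "v \<in> T" "u v \<noteq> 0" "(\<Sum>v\<in>T. u v *\<^sub>R v) = 0"
      using dependent_finite by metis
    have "(\<Sum>i\<le>n. u (P (x i)) *\<^sub>R P (x i)) = 0"
      using u(3) unfolding T_def sum.reindex[OF True] by simp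
    then show ?thesis using u(1,2) unfolding T_def by (intro exI[of _ "\<lambda>i. u (P (x i))"]) auto
  qed
  then obtain a where a: "\<exists>i\<le>n. a i \<noteq> 0" "(\<Sum>i\<le>n. a i *\<^sub>R P (x i)) = 0" by blast
  have "P (\<Sum>i\<le>n. a i *\<^sub>R x i) = 0"
    using a(2) by (simp add: linear_sum[OF P_lin] linear_scale[OF P_lin])
  then show ?thesis using P_orth a(1) unfolding n_def by blast
qed

section \<open>The Hilbert space of square integrable functions\<close>

lemma L2_integrable: "f \<in> L2 \<Longrightarrow> integrable lborel (\<lambda>x. (cmod (f x))\<^sup>2)"
  and L2_measurable: "f \<in> L2 \<Longrightarrow> f \<in> borel_measurable borel"
  unfolding L2_def by auto

lemma L2_inner_integrable:
  assumes "f \<in> L2" "g \<in> L2"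
  shows "integrable lborel (\<lambda>x. inner (f x) (g x))"
proof (rule Bochner_Integration.integrable_bound)
  show "integrable lborel (\<lambda>x. (cmod (f x))\<^sup>2 + (cmod (g x))\<^sup>2)"
    by (intro Bochner_Integration.integrable_add L2_integrable assms)
  have [measurable]: "f \<in> borel_measurable lborel" "g \<in> borel_measurable lborel"
    using assms L2_measurable by auto
  show "(\<lambda>x. inner (f x) (g x)) \<in> borel_measurable lborel" by measurable
  have "\<bar>inner a b\<bar> \<le> (cmod a)\<^sup>2 + (cmod b)\<^sup>2" for a b :: complex
  proof -
    have "\<bar>inner a b\<bar> \<le> cmod a * cmod b" by (rule Cauchy_Schwarz_ineq2)
    moreover have "2 * (cmod a * cmod b) \<le> (cmod a)\<^sup>2 + (cmod b)\<^sup>2"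
      using sum_squares_bound[of "cmod a" "cmod b"] by (simp add: mult.assoc)
    moreover have "0 \<le> cmod a * cmod b" by simp
    ultimately show ?thesis by linarith
  qed
  then show "AE x in lborel. norm (inner (f x) (g x)) \<le> norm ((cmod (f x))\<^sup>2 + (cmod (g x))\<^sup>2)"
    by simp
qed

lemma L2_zero: "(\<lambda>x. 0) \<in> L2"
  unfolding L2_def by simp

lemma L2_mult_const:
  assumes "f \<in> L2"
  shows "(\<lambda>x. c * f x) \<in> L2"
proof -
  have [measurable]: "f \<in> borel_measurable lborel" using assms L2_measurable by auto
  show ?thesis using L2_integrable[OF assms] unfolding L2_def
    by (simp add: norm_mult power_mult_distrib)
qed

lemma L2_scale: "f \<in> L2 \<Longrightarrow> (\<lambda>x. c *\<^sub>R f x) \<in> L2"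
  using L2_mult_const[of f "complex_of_real c"] by (simp add: scaleR_conv_of_real)

lemma L2_add:
  assumes "f \<in> L2" "g \<in> L2"
  shows "(\<lambda>x. f x + g x) \<in> L2"
proof -
  have [measurable]: "f \<in> borel_measurable lborel" "g \<in> borel_measurable lborel"
    using assms L2_measurable by auto
  have "integrable lborel (\<lambda>x. (cmod (f x))\<^sup>2 + (cmod (g x))\<^sup>2 + 2 * inner (f x) (g x))"
    by (intro Bochner_Integration.integrable_add integrable_mult_right L2_integrable
        L2_inner_integrable assms)
  moreover have "(cmod a)\<^sup>2 + (cmod b)\<^sup>2 + 2 * inner a b = (cmod (a + b))\<^sup>2" for a b
    unfolding power2_norm_eq_inner by (simp add: inner_add_left inner_add_right inner_commute)
  ultimately show ?thesis unfolding L2_def by simp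
qed

lemma L2_uminus: "f \<in> L2 \<Longrightarrow> (\<lambda>x. - f x) \<in> L2"
  using L2_scale[of f "-1"] by simp

lemma L2_diff: "f \<in> L2 \<Longrightarrow> g \<in> L2 \<Longrightarrow> (\<lambda>x. f x - g x) \<in> L2"
  using L2_add[OF _ L2_uminus, of f g] by simp

text \<open>
  Only real spectral parameters are needed, so complex-valued functions are regarded as a real
  Hilbert space, with the real part of the usual inner product.
\<close>

quotient_type (overloaded) 'a l2 = "'a::euclidean_space \<Rightarrow> complex" / partial:
  "\<lambda>f g. f \<in> L2 \<and> g \<in> L2 \<and> (AE x in lborel. f x = g x)"
proof (rule part_equivpI)
  show "\<exists>f::'a \<Rightarrow> complex. f \<in> L2 \<and> f \<in> L2 \<and> (AE x in lborel. f x = f x)"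
    using L2_zero by auto
  show "symp (\<lambda>f g::'a \<Rightarrow> complex. f \<in> L2 \<and> g \<in> L2 \<and> (AE x in lborel. f x = g x))"
    by (auto simp: symp_def elim: eventually_mono)
  show "transp (\<lambda>f g::'a \<Rightarrow> complex. f \<in> L2 \<and> g \<in> L2 \<and> (AE x in lborel. f x = g x))"
    by (auto simp: transp_def elim: eventually_elim2)
qed

instantiation l2 :: (euclidean_space) real_vector
begin

lift_definition zero_l2 :: "'a l2" is "\<lambda>x. 0" by (simp add: L2_zero)

lift_definition plus_l2 :: "'a l2 \<Rightarrow> 'a l2 \<Rightarrow> 'a l2" is "\<lambda>f g x. f x + g x"
  by (auto simp: L2_add elim: eventually_elim2)

lift_definition minus_l2 :: "'a l2 \<Rightarrow> 'a l2 \<Rightarrow> 'a l2" is "\<lambda>f g x. f x - g x"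
  by (auto simp: L2_diff elim: eventually_elim2)

lift_definition uminus_l2 :: "'a l2 \<Rightarrow> 'a l2" is "\<lambda>f x. - f x"
  by (auto simp: L2_uminus elim: eventually_mono)

lift_definition scaleR_l2 :: "real \<Rightarrow> 'a l2 \<Rightarrow> 'a l2" is "\<lambda>c f x. c *\<^sub>R f x"
  by (auto simp: L2_scale elim: eventually_mono)

instance
proof
  fix x y z :: "'a l2" and r s :: real
  show "x + y + z = x + (y + z)" by transfer (auto simp: L2_add add.assoc)
  show "x + y = y + x" by transfer (auto simp: L2_add add.commute)
  show "0 + x = x" by transfer auto
  show "- x + x = 0" by transfer (auto simp: L2_add L2_uminus L2_zero)
  show "x - y = x + - y" by transfer (auto simp: L2_add L2_uminus L2_diff)
  show "r *\<^sub>R (x + y) = r *\<^sub>R x + r *\<^sub>R y"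
    by transfer (auto simp: L2_add L2_scale scaleR_add_right)
  show "(r + s) *\<^sub>R x = r *\<^sub>R x + s *\<^sub>R x"
    by transfer (auto simp: L2_add L2_scale scaleR_add_left)
  show "r *\<^sub>R s *\<^sub>R x = (r * s) *\<^sub>R x" by transfer (auto simp: L2_scale)
  show "1 *\<^sub>R x = x" by transfer auto
qed

end

instantiation l2 :: (euclidean_space) real_inner
begin

lift_definition inner_l2 :: "'a l2 \<Rightarrow> 'a l2 \<Rightarrow> real" is "\<lambda>f g. LINT x|lborel. inner (f x) (g x)"
proof -
  fix f f' g g' :: "'a \<Rightarrow> complex"
  assume h: "f \<in> L2 \<and> f' \<in> L2 \<and> (AE x in lborel. f x = f' x)"
    "g \<in> L2 \<and> g' \<in> L2 \<and> (AE x in lborel. g x = g' x)"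
  show "(LINT x|lborel. inner (f x) (g x)) = (LINT x|lborel. inner (f' x) (g' x))"
    by (rule integral_cong_AE) (use h in \<open>auto intro!: borel_measurable_inner dest: L2_measurable\<close>)
qed

definition norm_l2 :: "'a l2 \<Rightarrow> real" where "norm_l2 x = sqrt (inner x x)"
definition dist_l2 :: "'a l2 \<Rightarrow> 'a l2 \<Rightarrow> real" where "dist_l2 x y = norm (x - y)"
definition sgn_l2 :: "'a l2 \<Rightarrow> 'a l2" where "sgn_l2 x = x /\<^sub>R norm x"
definition uniformity_l2 :: "('a l2 \<times> 'a l2) filter" where
  "uniformity_l2 = (INF e\<in>{0<..}. principal {(x, y). dist x y < e})"
definition open_l2 :: "'a l2 set \<Rightarrow> bool" where
  "open_l2 U \<longleftrightarrow> (\<forall>x\<in>U. eventually (\<lambda>(x', y). x' = x \<longrightarrow> y \<in> U) uniformity)"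

instance
proof
  fix x y z :: "'a l2" and r s :: real
  show "inner x y = inner y x" by transfer (auto simp: inner_commute)
  show "inner (x + y) z = inner x z + inner y z"
    by transfer (auto simp: inner_add_left L2_inner_integrable)
  show "inner (r *\<^sub>R x) y = r * inner x y" by transfer auto
  show "0 \<le> inner x x" by transfer auto
  show "inner x x = 0 \<longleftrightarrow> x = 0"
  proof transfer
    fix f :: "'a \<Rightarrow> complex"
    assume "f \<in> L2 \<and> f \<in> L2 \<and> (AE x in lborel. f x = f x)"
    then show "(LINT x|lborel. inner (f x) (f x)) = 0 \<longleftrightarrow>
       f \<in> L2 \<and> (\<lambda>x. 0) \<in> L2 \<and> (AE x in lborel. f x = 0)"
      using integral_nonneg_eq_0_iff_AE[OF L2_inner_integrable[of f f]] by (simp add: L2_zero)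
  qed
qed (rule norm_l2_def dist_l2_def sgn_l2_def uniformity_l2_def open_l2_def)+

end

section \<open>Passing between functions and their classes\<close>

lemma abs_l2_eq_iff:
  assumes "f \<in> L2" "g \<in> L2"
  shows "abs_l2 f = abs_l2 g \<longleftrightarrow> (AE x in lborel. f x = g x)"
  using Quotient3_rel[OF Quotient3_l2, of f g] assms by auto

lemma l2_cases:
  obtains f where "f \<in> L2" "x = abs_l2 f"
  using Quotient3_rep_reflp[OF Quotient3_l2, of x] Quotient3_abs_rep[OF Quotient3_l2, of x] by metis

lemma abs_l2_zero: "0 = abs_l2 (\<lambda>x. 0)"
  by (simp add: zero_l2.abs_eq)

lemma abs_l2_add: "f \<in> L2 \<Longrightarrow> g \<in> L2 \<Longrightarrow> abs_l2 f + abs_l2 g = abs_l2 (\<lambda>x. f x + g x)"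
  by (intro plus_l2.abs_eq) (auto simp: eq_onp_def)

lemma abs_l2_diff: "f \<in> L2 \<Longrightarrow> g \<in> L2 \<Longrightarrow> abs_l2 f - abs_l2 g = abs_l2 (\<lambda>x. f x - g x)"
  by (intro minus_l2.abs_eq) (auto simp: eq_onp_def)

lemma abs_l2_scaleR: "f \<in> L2 \<Longrightarrow> c *\<^sub>R abs_l2 f = abs_l2 (\<lambda>x. c *\<^sub>R f x)"
  by (intro scaleR_l2.abs_eq) (auto simp: eq_onp_def)

lemma inner_abs_l2:
  "f \<in> L2 \<Longrightarrow> g \<in> L2 \<Longrightarrow> inner (abs_l2 f) (abs_l2 g) = (LINT x|lborel. inner (f x) (g x))"
  by (intro inner_l2.abs_eq) (auto simp: eq_onp_def)

lemma norm_abs_l2: "f \<in> L2 \<Longrightarrow> norm (abs_l2 f) = L2_norm f"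
  unfolding norm_eq_sqrt_inner L2_norm_def by (simp add: inner_abs_l2 power2_norm_eq_inner)

lemma dist_abs_l2: "f \<in> L2 \<Longrightarrow> g \<in> L2 \<Longrightarrow> dist (abs_l2 f) (abs_l2 g) = L2_norm (\<lambda>x. f x - g x)"
  by (simp add: dist_norm abs_l2_diff norm_abs_l2 L2_diff)

lemma L2_nn_integral:
  assumes "f \<in> L2"
  shows "(\<integral>\<^sup>+x. ennreal ((cmod (f x))\<^sup>2) \<partial>lborel) = ennreal ((norm (abs_l2 f))\<^sup>2)"
  by (subst nn_integral_eq_integral)
     (use assms in \<open>auto simp: L2_integrable norm_abs_l2 L2_norm_def\<close>)

text \<open>The weight \<open>4 ^ n\<close> on squares forces increments of order
  \<open>(1 / 2) ^ n\<close>. This is applied pointwise in the completeness proof.\<close>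

lemma summable_fast_increments:
  fixes f :: "nat \<Rightarrow> 'b::banach"
  assumes "\<And>n. 4 ^ n * (norm (f (Suc n) - f n))\<^sup>2 \<le> C"
  shows "convergent f"
proof -
  have "norm (f (Suc n) - f n) \<le> sqrt C * (1 / 2) ^ n" for n
  proof -
    have "(2 ^ n * norm (f (Suc n) - f n))\<^sup>2 \<le> C"
      using assms[of n] power_mult[of "2::real" n 2] power_mult[of "2::real" 2 n]
      by (simp add: power_mult_distrib mult.commute)
    then have "2 ^ n * norm (f (Suc n) - f n) \<le> sqrt C" by (rule real_le_rsqrt)
    then show ?thesis by (simp add: field_simps)
  qed
  moreover have "summable (\<lambda>n. sqrt C * (1 / 2) ^ n)"
    by (intro summable_mult summable_geometric) auto
  ultimately have "summable (\<lambda>n. f (Suc n) - f n)"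
    using summable_comparison_test'[of "\<lambda>n. sqrt C * (1 / 2) ^ n" 0 "\<lambda>n. f (Suc n) - f n"] by blast
  then have "convergent (\<lambda>n. \<Sum>m<n. f (Suc m) - f m)" using summable_iff_convergent by blast
  then obtain l where "(\<lambda>n. f n - f 0) \<longlonglongrightarrow> l"
    unfolding sum_lessThan_telescope convergent_def by blast
  from tendsto_add[OF this tendsto_const[of "f 0"]] show ?thesis
    unfolding convergent_def by auto
qed

text \<open>Riesz-Fischer. Along a subsequence the norm increments are of order
  \<open>(1 / 8) ^ k\<close>; their squares, of order \<open>(1 / 64) ^ k\<close>, remain summable
  after the weight \<open>4 ^ k\<close>. So the weighted sum \<open>S\<close> of squared pointwise
  increments is finite almost everywhere, the subsequence converges there, and Fatou's lemma turns
  this into convergence in norm.\<close>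

instance l2 :: (euclidean_space) banach
proof
  fix X :: "nat \<Rightarrow> 'a l2"
  assume X: "Cauchy X"
  have "\<exists>N. \<forall>m\<ge>N. norm (X m - X N) < (1 / 8) ^ k" for k
  proof -
    obtain N where "\<And>m n. m \<ge> N \<Longrightarrow> n \<ge> N \<Longrightarrow> norm (X m - X n) < (1 / 8) ^ k"
      using CauchyD[OF X, of "(1 / 8) ^ k"] by auto
    then show ?thesis by blast
  qed
  then obtain N where N: "\<And>k m. m \<ge> N k \<Longrightarrow> norm (X m - X (N k)) < (1 / 8) ^ k" by metis
  obtain r where r: "\<And>k. r k \<ge> N k" "\<And>k. r k < r (Suc k)"
  proof -
    have "\<exists>r. \<forall>k. r k \<ge> N k \<and> r k < r (Suc k)"
    proof (rule dependent_nat_choice)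
      show "\<exists>y. y \<ge> N (Suc k) \<and> x < y" for x k
        by (rule exI[of _ "max (N (Suc k)) (Suc x)"]) auto
    qed blast
    then show thesis using that by blast
  qed
  have rs: "strict_mono r" using r(2) by (simp add: strict_mono_Suc_iff)
  have Xr: "norm (X m - X (r k)) \<le> 2 * (1 / 8) ^ k" if "m \<ge> N k" for m k
    using N[OF that] N[OF r(1)[of k]] norm_triangle_ineq4[of "X m - X (N k)" "X (r k) - X (N k)"]
    by simp
  have "\<exists>f. f \<in> L2 \<and> X (r k) = abs_l2 f" for k by (rule l2_cases[of "X (r k)"]) blast
  then obtain f where f: "\<And>k. f k \<in> L2" "\<And>k. X (r k) = abs_l2 (f k)" by metis
  have [measurable]: "f k \<in> borel_measurable lborel" for k using f L2_measurable by auto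
  have fd: "(\<integral>\<^sup>+x. ennreal ((cmod (f m x - f k x))\<^sup>2) \<partial>lborel) \<le> ennreal (4 * (1 / 64) ^ k)"
    if "m \<ge> k" for m k
  proof -
    have "r m \<ge> N k" using r(1)[of k] strict_mono_less_eq[OF rs, of k m] that by linarith
    then have "(norm (X (r m) - X (r k)))\<^sup>2 \<le> (2 * (1 / 8) ^ k)\<^sup>2" by (intro power_mono Xr) auto
    also have "\<dots> = 4 * (1 / 64) ^ k"
      by (simp add: power_mult_distrib power2_eq_square flip: power_mult_distrib)
    finally show ?thesis
      using L2_nn_integral[OF L2_diff[OF f(1)[of m] f(1)[of k]]]
      by (simp add: f abs_l2_diff ennreal_leI)
  qed
  define S where "S x = (\<Sum>n. ennreal (4 ^ n * (cmod (f (Suc n) x - f n x))\<^sup>2))" for x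
  have "(\<integral>\<^sup>+x. S x \<partial>lborel) = (\<Sum>n. \<integral>\<^sup>+x. ennreal (4 ^ n * (cmod (f (Suc n) x - f n x))\<^sup>2) \<partial>lborel)"
    unfolding S_def by (rule nn_integral_suminf) measurable
  also have "\<dots> \<le> (\<Sum>n. ennreal (4 * (1 / 16) ^ n))"
  proof (rule suminf_le)
    fix n
    have "(\<integral>\<^sup>+x. ennreal (4 ^ n * (cmod (f (Suc n) x - f n x))\<^sup>2) \<partial>lborel) =
        ennreal (4 ^ n) * (\<integral>\<^sup>+x. ennreal ((cmod (f (Suc n) x - f n x))\<^sup>2) \<partial>lborel)"
      by (subst nn_integral_cmult[symmetric]) (auto simp: ennreal_mult)
    also have "\<dots> \<le> ennreal (4 ^ n) * ennreal (4 * (1 / 64) ^ n)"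
      by (intro mult_left_mono fd) auto
    also have "\<dots> = ennreal (4 * (1 / 16) ^ n)"
      by (subst ennreal_mult[symmetric]) (auto simp: power_divide field_simps simp flip: power_mult_distrib)
    finally show "(\<integral>\<^sup>+x. ennreal (4 ^ n * (cmod (f (Suc n) x - f n x))\<^sup>2) \<partial>lborel)
        \<le> ennreal (4 * (1 / 16) ^ n)" .
  qed auto
  also have "\<dots> < \<infinity>"
    by (subst suminf_ennreal2) (auto intro!: summable_mult summable_geometric)
  finally have "AE x in lborel. S x \<noteq> \<infinity>"
    by (intro nn_integral_PInf_AE) (auto simp: S_def)
  then have AEc: "AE x in lborel. convergent (\<lambda>n. f n x)"
  proof eventually_elim
    fix x assume S: "S x \<noteq> \<infinity>"
    have "4 ^ n * (cmod (f (Suc n) x - f n x))\<^sup>2 \<le> enn2real (S x)" for n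
    proof -
      have "(\<Sum>i\<in>{n}. ennreal (4 ^ i * (cmod (f (Suc i) x - f i x))\<^sup>2)) \<le> S x"
        unfolding S_def by (rule sum_le_suminf) (rule summableI, simp_all)
      then have "ennreal (4 ^ n * (cmod (f (Suc n) x - f n x))\<^sup>2) \<le> S x" by simp
      from enn2real_mono[OF this] show ?thesis using S by (simp add: top.not_eq_extremum)
    qed
    then show "convergent (\<lambda>n. f n x)" by (rule summable_fast_increments)
  qed
  define g where "g x = lim (\<lambda>n. f n x)" for x
  have [measurable]: "g \<in> borel_measurable lborel" unfolding g_def by measurable
  have gd: "(\<integral>\<^sup>+x. ennreal ((cmod (g x - f k x))\<^sup>2) \<partial>lborel) \<le> ennreal (4 * (1 / 64) ^ k)" for k
  proof -
    have "(\<integral>\<^sup>+x. ennreal ((cmod (g x - f k x))\<^sup>2) \<partial>lborel) =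
        (\<integral>\<^sup>+x. liminf (\<lambda>m. ennreal ((cmod (f m x - f k x))\<^sup>2)) \<partial>lborel)"
    proof (rule nn_integral_cong_AE, use AEc in eventually_elim)
      fix x assume "convergent (\<lambda>n. f n x)"
      then have "(\<lambda>n. f n x) \<longlonglongrightarrow> g x" unfolding g_def by (simp add: convergent_LIMSEQ_iff)
      then have "(\<lambda>m. ennreal ((cmod (f m x - f k x))\<^sup>2)) \<longlonglongrightarrow> ennreal ((cmod (g x - f k x))\<^sup>2)"
        by (intro tendsto_intros)
      then show "ennreal ((cmod (g x - f k x))\<^sup>2) = liminf (\<lambda>m. ennreal ((cmod (f m x - f k x))\<^sup>2))"
        using lim_imp_Liminf[OF sequentially_bot] by metis
    qed
    also have "\<dots> \<le> liminf (\<lambda>m. \<integral>\<^sup>+x. ennreal ((cmod (f m x - f k x))\<^sup>2) \<partial>lborel)"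
      by (rule nn_integral_liminf) measurable
    also have "\<dots> \<le> ennreal (4 * (1 / 64) ^ k)"
      by (rule Liminf_le) (auto simp: eventually_sequentially intro!: exI[of _ k] fd)
    finally show ?thesis .
  qed
  have gf: "(\<lambda>x. g x - f k x) \<in> L2" for k
    unfolding L2_def using gd[of k]
    by (auto intro!: integrableI_bounded elim!: order_le_less_trans)
  have gL: "g \<in> L2" using L2_add[OF gf[of 0] f(1)[of 0]] by simp
  have "(norm (abs_l2 g - X (r k)))\<^sup>2 \<le> 4 * (1 / 64) ^ k" for k
    using gd[of k] unfolding L2_nn_integral[OF gf] f(2) abs_l2_diff[OF gL f(1)]
    by (simp add: ennreal_le_iff)
  then have "(\<lambda>k. (norm (abs_l2 g - X (r k)))\<^sup>2) \<longlonglongrightarrow> 0"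
    by (intro Lim_null_comparison[of "\<lambda>k. (norm (abs_l2 g - X (r k)))\<^sup>2" "\<lambda>k. 4 * (1 / 64) ^ k"]
        always_eventually tendsto_mult_right_zero LIMSEQ_power_zero) auto
  then have "(\<lambda>k. norm (abs_l2 g - X (r k))) \<longlonglongrightarrow> 0" by (simp add: tendsto_power_zero)
  then have "(X \<circ> r) \<longlonglongrightarrow> abs_l2 g"
    unfolding tendsto_dist_iff[of "X \<circ> r"] by (simp add: dist_norm norm_minus_commute)
  then show "convergent X"
    using Cauchy_converges_subseq[OF X rs] convergentI by blast
qed

section \<open>Test functions and the Schroedinger relation\<close>

definition vanishes_outside :: "real \<Rightarrow> ('a::real_normed_vector \<Rightarrow> 'b::zero) \<Rightarrow> bool" where
  "vanishes_outside R f \<longleftrightarrow> (\<forall>x. norm x > R \<longrightarrow> f x = 0)"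

lemma vanishes_outsideD: "vanishes_outside R f \<Longrightarrow> norm x > R \<Longrightarrow> f x = 0"
  unfolding vanishes_outside_def by simp

lemma vanishes_indicator:
  fixes f :: "'a::real_normed_vector \<Rightarrow> 'b::real_vector"
  assumes "vanishes_outside R f" "cball 0 R \<subseteq> S"
  shows "(\<lambda>x. indicator S x *\<^sub>R f x) = f"
proof
  fix x
  show "indicator S x *\<^sub>R f x = f x"
    using assms vanishes_outsideD[OF assms(1), of x]
    by (cases "norm x > R") (auto simp: indicator_def subset_iff)
qed

lemma compact_support_integrable:
  fixes f :: "'a::euclidean_space \<Rightarrow> 'b::{banach, second_countable_topology}"
  assumes "continuous_on UNIV f" "vanishes_outside R f"
  shows "integrable lborel f"
  using borel_integrable_compact[of "cball 0 R" f] vanishes_indicator[OF assms(2), of "cball 0 R"]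
    continuous_on_subset[OF assms(1)] by simp

lemma compact_support_integral_cbox:
  fixes f :: "'a::euclidean_space \<Rightarrow> real"
  assumes "continuous_on UNIV f" "vanishes_outside R f" "cball 0 R \<subseteq> cbox a c"
  shows "integral (cbox a c) f = (LINT x|lborel. f x)"
proof -
  have "integrable lborel f" by (rule compact_support_integrable[OF assms(1,2)])
  then have "set_integrable lborel (cbox a c) f"
    unfolding set_integrable_def vanishes_indicator[OF assms(2,3)] .
  then have "(LINT x:cbox a c|lborel. f x) = integral (cbox a c) f"
    by (rule set_borel_integral_eq_integral)
  then show ?thesis
    unfolding set_lebesgue_integral_def vanishes_indicator[OF assms(2,3)] by simp
qed

section \<open>Directional derivatives and integration by parts\<close>

lemma lborel_integral_translate:
  fixes g :: "'a::euclidean_space \<Rightarrow> 'b::{banach, second_countable_topology}"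
  assumes [measurable]: "g \<in> borel_measurable borel"
  shows "(LINT x|lborel. g (x + c)) = (LINT x|lborel. g x)"
proof -
  have "(LINT x|lborel. g x) = (LINT x|distr lborel borel ((+) c). g x)"
    by (simp add: lborel_distr_plus)
  also have "\<dots> = (LINT x|lborel. g (c + x))" by (rule integral_distr) auto
  finally show ?thesis by (simp add: add.commute)
qed

text \<open>\<open>partial_deriv\<close> has an arbitrary value where no derivative exists; this
  relation asserts differentiability along \<open>b\<close> at every point, and it covers
  real-valued functions as well.\<close>

definition has_partial ::
    "'a::real_normed_vector \<Rightarrow> ('a \<Rightarrow> 'b::real_normed_vector) \<Rightarrow> ('a \<Rightarrow> 'b) \<Rightarrow> bool" where
  "has_partial b f g \<longleftrightarrow> (\<forall>x. ((\<lambda>t. f (x + t *\<^sub>R b)) has_vector_derivative g x) (at 0))"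

lemma has_partial_at:
  assumes "has_partial b f g"
  shows "((\<lambda>t. f (x + t *\<^sub>R b)) has_vector_derivative g (x + s *\<^sub>R b)) (at s)"
proof -
  have "((\<lambda>t. f (x + s *\<^sub>R b + t *\<^sub>R b)) has_vector_derivative g (x + s *\<^sub>R b)) (at (s - s))"
    using assms unfolding has_partial_def by simp
  moreover have "((\<lambda>t. t - s) has_vector_derivative 1) (at s)"
    by (auto intro!: derivative_eq_intros)
  ultimately have "((\<lambda>t. f (x + s *\<^sub>R b + t *\<^sub>R b)) \<circ> (\<lambda>t. t - s)
      has_vector_derivative 1 *\<^sub>R g (x + s *\<^sub>R b)) (at s)"
    by (intro vector_diff_chain_at)
  moreover have "(\<lambda>t. f (x + s *\<^sub>R b + t *\<^sub>R b)) \<circ> (\<lambda>t. t - s) = (\<lambda>t. f (x + t *\<^sub>R b))"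
    by (auto simp: algebra_simps)
  ultimately show ?thesis by simp
qed

lemma has_partial_zero_on_open:
  assumes "has_partial b f g" "open S" "\<And>x. x \<in> S \<Longrightarrow> f x = 0" "x \<in> S"
  shows "g x = 0"
proof -
  have "open ((\<lambda>t::real. x + t *\<^sub>R b) -` S)"
    by (rule open_vimage[OF assms(2)]) (intro continuous_intros)
  then have "((\<lambda>t. 0) has_vector_derivative g x) (at 0)"
    by (rule has_vector_derivative_transform_within_open[rotated, where f = "\<lambda>t. f (x + t *\<^sub>R b)"])
       (use assms in \<open>auto simp: has_partial_def\<close>)
  then show "g x = 0" using vector_derivative_at vector_derivative_const_at by metis
qed

lemma has_partial_vanishes:
  fixes f g :: "'a::real_normed_vector \<Rightarrow> 'b::real_normed_vector"
  assumes "has_partial b f g" "vanishes_outside R f"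
  shows "vanishes_outside R g"
proof -
  have "open {x::'a. R < norm x}" by (intro open_Collect_less continuous_intros)
  from has_partial_zero_on_open[OF assms(1) this] show ?thesis
    using assms(2) unfolding vanishes_outside_def by blast
qed

text \<open>The integral of a translate of \<open>f\<close> does not depend on the translation.
  Differentiating it along \<open>b\<close> under the integral sign gives the integral of
  \<open>g\<close>.\<close>

lemma integral_partial_zero:
  fixes f g :: "'a::euclidean_space \<Rightarrow> real"
  assumes f: "continuous_on UNIV f" and g: "continuous_on UNIV g"
    and fg: "has_partial b f g" and vf: "vanishes_outside R f"
  shows "(LINT x|lborel. g x) = 0"
proof -
  \<comment> \<open>The margin \<open>norm b\<close> keeps the supports of all translates by
    \<open>t *\<^sub>R b\<close> with \<open>\<bar>t\<bar> \<le> 1\<close> in one fixed box, as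
    differentiation under the integral demands.\<close>
  obtain a c where ac: "cball (0::'a) (R + norm b) \<subseteq> cbox a c"
    using bounded_subset_cbox_symmetric[OF bounded_cball] by metis
  have cball: "cball (0::'a) R \<subseteq> cbox a c" using ac by (auto simp: subset_iff)
       (smt (verit) norm_ge_zero)
  have vg: "vanishes_outside R g" by (rule has_partial_vanishes[OF fg vf])
  define F where "F t = integral (cbox a c) (\<lambda>x. f (x + t *\<^sub>R b))" for t :: real
  have cf: "continuous_on UNIV (\<lambda>x. f (x + t *\<^sub>R b))" for t
    by (intro continuous_on_compose2[OF f] continuous_intros) auto
  have Fc: "F t = (LINT x|lborel. f x)" if t: "t \<in> {-1..1}" for t
  proof -
    have "vanishes_outside (R + norm b) (\<lambda>x. f (x + t *\<^sub>R b))"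
      unfolding vanishes_outside_def
    proof (intro allI impI)
      fix x :: 'a assume x: "R + norm b < norm x"
      have "\<bar>t\<bar> * norm b \<le> norm b" using t by (simp add: mult_left_le_one_le abs_le_iff)
      moreover have "norm x \<le> norm (x + t *\<^sub>R b) + norm (t *\<^sub>R b)"
        using norm_triangle_ineq4[of "x + t *\<^sub>R b" "t *\<^sub>R b"] by simp
      ultimately show "f (x + t *\<^sub>R b) = 0" using x by (intro vanishes_outsideD[OF vf]) simp
    qed
    then have "F t = (LINT x|lborel. f (x + t *\<^sub>R b))"
      unfolding F_def by (intro compact_support_integral_cbox[OF cf _ ac])
    also have "\<dots> = (LINT x|lborel. f x)"
      by (rule lborel_integral_translate) (use f in \<open>simp add: borel_measurable_continuous_onI\<close>)
    finally show ?thesis .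
  qed
  have "(F has_field_derivative integral (cbox a c) (\<lambda>x. g (x + 0 *\<^sub>R b))) (at 0 within {-1..1})"
    unfolding F_def
  proof (rule leibniz_rule_field_derivative)
    show "((\<lambda>s. f (x + s *\<^sub>R b)) has_field_derivative g (x + t *\<^sub>R b)) (at t within {-1..1})" for t x
      using has_partial_at[OF fg, of x t]
      by (simp add: has_real_derivative_iff_has_vector_derivative has_vector_derivative_at_within)
    show "(\<lambda>x. f (x + t *\<^sub>R b)) integrable_on cbox a c" for t
      by (rule integrable_continuous[OF continuous_on_subset[OF cf]]) simp
    show "continuous_on ({-1..1} \<times> cbox a c) (\<lambda>(t, x). g (x + t *\<^sub>R b))"
      unfolding split_beta by (intro continuous_on_compose2[OF g] continuous_intros) auto
  qed auto
  then have "(F has_vector_derivative integral (cbox a c) g) (at 0 within {-1..1})"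
    by (simp add: has_real_derivative_iff_has_vector_derivative)
  then have "(F has_vector_derivative integral (cbox a c) g) (at 0)"
    using at_within_interior[of "0::real" "{-1..1}"] by simp
  then have "((\<lambda>t. LINT x|lborel. f x) has_vector_derivative integral (cbox a c) g) (at 0)"
    by (rule has_vector_derivative_transform_within_open[where S = "{-1<..<1}"]) (use Fc in auto)
  then have "integral (cbox a c) g = 0"
    using vector_derivative_at vector_derivative_const_at by metis
  then show ?thesis using compact_support_integral_cbox[OF g vg cball] by simp
qed

section \<open>Calculus of test functions\<close>

lemma has_partial_unique: "has_partial b f g \<Longrightarrow> g = partial_deriv b f"
  unfolding has_partial_def partial_deriv_def by (intro ext vector_derivative_at[symmetric]) blast

lemma C_k_partial:
  assumes "C_k (Suc k) f" "b \<in> Basis"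
  shows "has_partial b f (partial_deriv b f)" "C_k k (partial_deriv b f)"
  using assms by (auto simp: has_partial_def partial_deriv_def vector_derivative_works[symmetric])

lemma C_k_continuous: "C_k k f \<Longrightarrow> continuous_on UNIV f"
  by (cases k) auto

lemma C_k_SucI:
  assumes "continuous_on UNIV f"
    and "\<And>b. b \<in> Basis \<Longrightarrow> \<exists>g. has_partial b f g \<and> C_k k g"
  shows "C_k (Suc k) f"
proof -
  have "(\<forall>x. (\<lambda>t::real. f (x + t *\<^sub>R b)) differentiable (at 0)) \<and> C_k k (partial_deriv b f)"
    if b: "b \<in> Basis" for b
  proof -
    obtain g where g: "has_partial b f g" "C_k k g" using assms(2)[OF b] by blast
    have "(\<lambda>t::real. f (x + t *\<^sub>R b)) differentiable (at 0)" for x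
      using g(1) unfolding has_partial_def by (blast intro: differentiableI_vector)
    then show ?thesis using g has_partial_unique[OF g(1)] by simp
  qed
  then show ?thesis using assms(1) by simp
qed

lemma has_partial_add:
  "has_partial b f f' \<Longrightarrow> has_partial b g g' \<Longrightarrow> has_partial b (\<lambda>x. f x + g x) (\<lambda>x. f' x + g' x)"
  unfolding has_partial_def by (auto intro!: derivative_intros)

lemma has_partial_add_scaleR:
  "has_partial b f f' \<Longrightarrow> has_partial b g g' \<Longrightarrow>
    has_partial b (\<lambda>x. f x + c *\<^sub>R g x) (\<lambda>x. f' x + c *\<^sub>R g' x)"
  by (rule has_partial_add)
     (auto simp: has_partial_def
       intro: bounded_linear.has_vector_derivative[OF bounded_linear_scaleR_right])

lemma has_partial_inner:
  fixes f g :: "'a::real_normed_vector \<Rightarrow> 'b::real_inner"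
  assumes "has_partial b f f'" "has_partial b g g'"
  shows "has_partial b (\<lambda>x. inner (f x) (g x)) (\<lambda>x. inner (f x) (g' x) + inner (f' x) (g x))"
  unfolding has_partial_def
proof
  fix x
  have "((\<lambda>t. f (x + t *\<^sub>R b)) has_vector_derivative f' x) (at 0)"
    "((\<lambda>t. g (x + t *\<^sub>R b)) has_vector_derivative g' x) (at 0)"
    using assms unfolding has_partial_def by auto
  from bounded_bilinear.has_vector_derivative[OF bounded_bilinear_inner this]
  show "((\<lambda>t. inner (f (x + t *\<^sub>R b)) (g (x + t *\<^sub>R b))) has_vector_derivative
      inner (f x) (g' x) + inner (f' x) (g x)) (at 0)" by simp
qed

lemma C_k_add_scaleR: "C_k k f \<Longrightarrow> C_k k g \<Longrightarrow> C_k k (\<lambda>x. f x + c *\<^sub>R g x)"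
proof (induction k arbitrary: f g)
  case 0
  then show ?case by (auto intro!: continuous_intros)
next
  case (Suc k)
  show ?case
  proof (rule C_k_SucI)
    show "continuous_on UNIV (\<lambda>x. f x + c *\<^sub>R g x)"
      using Suc.prems by (intro continuous_intros C_k_continuous)
    fix b :: 'a assume b: "b \<in> Basis"
    show "\<exists>h. has_partial b (\<lambda>x. f x + c *\<^sub>R g x) h \<and> C_k k h"
      using has_partial_add_scaleR C_k_partial[OF Suc.prems(1) b] C_k_partial[OF Suc.prems(2) b] Suc.IH
      by blast
  qed
qed

lemma C_k_zero: "C_k k (\<lambda>x::'a::euclidean_space. 0)"
proof (induction k)
  case (Suc k)
  have "has_partial b (\<lambda>x::'a. 0::complex) (\<lambda>x. 0)" for b unfolding has_partial_def by simp
  with Suc show ?case by (intro C_k_SucI) auto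
qed simp

lemma test_functions_iff:
  "f \<in> test_functions \<longleftrightarrow> (\<forall>k. C_k k f) \<and> (\<exists>R. vanishes_outside R f)"
proof -
  have "compact (closure {x. f x \<noteq> 0}) \<longleftrightarrow> (\<exists>R. vanishes_outside R f)"
    unfolding compact_closure bounded_iff vanishes_outside_def by (simp, metis not_le)
  then show ?thesis unfolding test_functions_def by simp
qed

lemma test_vanishes:
  assumes "f \<in> test_functions"
  obtains R where "vanishes_outside R f"
  using assms test_functions_iff by blast

lemma test_continuous: "f \<in> test_functions \<Longrightarrow> continuous_on UNIV f"
  using C_k_continuous test_functions_iff by blast

lemma test_partial:
  assumes "f \<in> test_functions" "b \<in> Basis"
  shows "has_partial b f (partial_deriv b f)" "partial_deriv b f \<in> test_functions"
proof -
  show p: "has_partial b f (partial_deriv b f)"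
    using assms C_k_partial test_functions_iff by blast
  show "partial_deriv b f \<in> test_functions"
    using assms C_k_partial has_partial_vanishes[OF p] unfolding test_functions_iff by blast
qed

lemma test_zero: "(\<lambda>x. 0) \<in> test_functions"
  unfolding test_functions_iff by (simp add: C_k_zero vanishes_outside_def)

lemma test_add_scaleR:
  assumes f: "f \<in> test_functions" and g: "g \<in> test_functions"
  shows "(\<lambda>x. f x + c *\<^sub>R g x) \<in> test_functions"
proof -
  obtain R where R: "vanishes_outside R f" using test_vanishes[OF f] .
  obtain S where S: "vanishes_outside S g" using test_vanishes[OF g] .
  have "vanishes_outside (max R S) (\<lambda>x. f x + c *\<^sub>R g x)"
    using R S unfolding vanishes_outside_def by simp
  then show ?thesis using f g C_k_add_scaleR unfolding test_functions_iff by blast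
qed

lemma laplacian_add_scaleR:
  assumes f: "f \<in> test_functions" and g: "g \<in> test_functions"
  shows "laplacian (\<lambda>x. f x + c *\<^sub>R g x) x = laplacian f x + c *\<^sub>R laplacian g x"
  unfolding laplacian_def scaleR_sum_right sum.distrib[symmetric]
proof (rule sum.cong[OF refl])
  fix b :: 'a assume b: "b \<in> Basis"
  note p = test_partial[OF _ b]
  have "partial_deriv b (\<lambda>x. f x + c *\<^sub>R g x) = (\<lambda>x. partial_deriv b f x + c *\<^sub>R partial_deriv b g x)"
    by (rule has_partial_unique[symmetric], intro has_partial_add_scaleR p f g)
  moreover have "partial_deriv b (\<lambda>x. partial_deriv b f x + c *\<^sub>R partial_deriv b g x) =
      (\<lambda>x. partial_deriv b (partial_deriv b f) x + c *\<^sub>R partial_deriv b (partial_deriv b g) x)"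
    by (rule has_partial_unique[symmetric], intro has_partial_add_scaleR p f g)
  ultimately show "partial_deriv b (partial_deriv b (\<lambda>x. f x + c *\<^sub>R g x)) x =
      partial_deriv b (partial_deriv b f) x + c *\<^sub>R partial_deriv b (partial_deriv b g) x" by simp
qed

lemma test_laplacian:
  assumes "f \<in> test_functions"
  shows "continuous_on UNIV (laplacian f)" "vanishes_outside R f \<Longrightarrow> vanishes_outside R (laplacian f)"
proof -
  have t: "partial_deriv b (partial_deriv b f) \<in> test_functions" if "b \<in> Basis" for b
    using test_partial assms that by blast
  show "continuous_on UNIV (laplacian f)"
    unfolding laplacian_def[abs_def] using t by (intro continuous_on_sum test_continuous)
  assume R: "vanishes_outside R f"
  have "vanishes_outside R (partial_deriv b (partial_deriv b f))" if b: "b \<in> Basis" for b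
    by (rule has_partial_vanishes[OF test_partial(1)[OF test_partial(2)[OF assms b] b]
        has_partial_vanishes[OF test_partial(1)[OF assms b] R]])
  then show "vanishes_outside R (laplacian f)"
    unfolding vanishes_outside_def laplacian_def by simp
qed

lemma integral_inner_compact_support:
  fixes f g :: "'a::euclidean_space \<Rightarrow> complex"
  assumes "continuous_on UNIV f" "continuous_on UNIV g" "vanishes_outside R g"
  shows "integrable lborel (\<lambda>x. inner (f x) (g x))"
  by (rule compact_support_integrable[of _ R])
     (use assms in \<open>auto simp: vanishes_outside_def intro!: continuous_intros\<close>)

text \<open>For each \<open>b\<close> the derivative along \<open>b\<close> of
  \<open>inner (partial_deriv b f x) (g x)\<close> has integral zero by
  \<open>integral_partial_zero\<close>; summing over \<open>b\<close> moves one derivative to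
  \<open>g\<close>.\<close>

lemma green:
  assumes f: "f \<in> test_functions" and g: "g \<in> test_functions"
  shows "(LINT x|lborel. inner (- laplacian f x) (g x)) =
         (\<Sum>b\<in>Basis. LINT x|lborel. inner (partial_deriv b f x) (partial_deriv b g x))"
proof -
  obtain R where R: "vanishes_outside R g" using test_vanishes[OF g] .
  have int: "integrable lborel (\<lambda>x. inner (h x) (k x))"
    if "h \<in> test_functions" "k \<in> test_functions" for h k :: "'a \<Rightarrow> complex"
    using that test_vanishes[OF that(2)] integral_inner_compact_support test_continuous by metis
  have p: "(LINT x|lborel. inner (- partial_deriv b (partial_deriv b f) x) (g x)) =
      (LINT x|lborel. inner (partial_deriv b f x) (partial_deriv b g x))" if b: "b \<in> Basis" for b
  proof -
    define f1 where "f1 = partial_deriv b f"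
    define f2 where "f2 = partial_deriv b f1"
    define g1 where "g1 = partial_deriv b g"
    have t: "f1 \<in> test_functions" "f2 \<in> test_functions" "g1 \<in> test_functions"
      "has_partial b f1 f2" "has_partial b g g1"
      unfolding f1_def f2_def g1_def using test_partial f g b by blast+
    have "(LINT x|lborel. inner (f1 x) (g1 x) + inner (f2 x) (g x)) = 0"
      by (rule integral_partial_zero[OF _ _ has_partial_inner[OF t(4,5)], of R])
         (use t g R in \<open>auto simp: vanishes_outside_def intro!: continuous_intros test_continuous\<close>)
    then have "(LINT x|lborel. inner (f1 x) (g1 x)) + (LINT x|lborel. inner (f2 x) (g x)) = 0"
      using int t g by simp
    then show ?thesis unfolding f1_def[symmetric] f2_def[symmetric] g1_def[symmetric] by simp
  qed
  have "(LINT x|lborel. inner (- laplacian f x) (g x)) =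
      (LINT x|lborel. (\<Sum>b\<in>Basis. inner (- partial_deriv b (partial_deriv b f) x) (g x)))"
    unfolding laplacian_def by (simp add: inner_sum_left sum_negf)
  also have "\<dots> = (\<Sum>b\<in>Basis. LINT x|lborel. inner (- partial_deriv b (partial_deriv b f) x) (g x))"
    by (rule Bochner_Integration.integral_sum)
       (use int[OF test_partial(2)[OF test_partial(2)[OF f]] g] in simp)
  finally show ?thesis using p by simp
qed

section \<open>The operator as a relation between classes\<close>

definition hamiltonian :: "('a::euclidean_space \<Rightarrow> real) \<Rightarrow> ('a \<Rightarrow> complex) \<Rightarrow> 'a \<Rightarrow> complex" where
  "hamiltonian V f x = - laplacian f x + complex_of_real (V x) * f x"

lemma schrodinger_op0_eq:
  "schrodinger_op0 V = {(f, hamiltonian V f) |f. f \<in> test_functions}"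
  unfolding schrodinger_op0_def hamiltonian_def[abs_def] by simp

lemma continuous_support_L2:
  assumes "continuous_on UNIV f" "vanishes_outside R f"
  shows "f \<in> L2"
proof -
  have "integrable lborel (\<lambda>x. (cmod (f x))\<^sup>2)"
    by (rule compact_support_integrable[of _ R])
       (use assms in \<open>auto simp: vanishes_outside_def intro!: continuous_intros\<close>)
  then show ?thesis unfolding L2_def using assms by (simp add: borel_measurable_continuous_onI)
qed

lemma test_L2: "f \<in> test_functions \<Longrightarrow> f \<in> L2"
  using test_vanishes test_continuous continuous_support_L2 by metis

definition test_rel :: "('a::euclidean_space \<Rightarrow> real) \<Rightarrow> ('a l2 \<times> 'a l2) set" where
  "test_rel V = {(abs_l2 f, abs_l2 (hamiltonian V f)) |f. f \<in> test_functions}"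

definition schrodinger_rel :: "('a::euclidean_space \<Rightarrow> real) \<Rightarrow> ('a l2 \<times> 'a l2) set" where
  "schrodinger_rel V = closure (test_rel V)"

context
  fixes V :: "'a::euclidean_space \<Rightarrow> real"
  assumes V: "continuous_on UNIV V"
begin

lemma hamiltonian_continuous: "f \<in> test_functions \<Longrightarrow> continuous_on UNIV (hamiltonian V f)"
  unfolding hamiltonian_def[abs_def] using V
  by (intro continuous_intros test_laplacian(1) test_continuous) auto

lemma hamiltonian_vanishes:
  "f \<in> test_functions \<Longrightarrow> vanishes_outside R f \<Longrightarrow> vanishes_outside R (hamiltonian V f)"
  using test_laplacian(2) unfolding vanishes_outside_def hamiltonian_def by fastforce

lemma hamiltonian_L2: "f \<in> test_functions \<Longrightarrow> hamiltonian V f \<in> L2"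
  using test_vanishes hamiltonian_continuous hamiltonian_vanishes continuous_support_L2 by metis

lemma hamiltonian_form:
  assumes f: "f \<in> test_functions" and g: "g \<in> test_functions"
  shows "(LINT x|lborel. inner (hamiltonian V f x) (g x)) =
     (\<Sum>b\<in>Basis. LINT x|lborel. inner (partial_deriv b f x) (partial_deriv b g x)) +
     (LINT x|lborel. V x * inner (f x) (g x))"
proof -
  obtain R where R: "vanishes_outside R g" using test_vanishes[OF g] .
  have e: "inner (complex_of_real v * z) w = v * inner z w" for v z w
    by (metis inner_scaleR_left scaleR_conv_of_real)
  have i1: "integrable lborel (\<lambda>x. inner (- laplacian f x) (g x))"
    by (rule integral_inner_compact_support[OF _ _ R])
       (use test_laplacian(1)[OF f] test_continuous[OF g] in \<open>auto intro: continuous_intros\<close>)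
  have i2: "integrable lborel (\<lambda>x. V x * inner (f x) (g x))"
    by (rule compact_support_integrable[of _ R])
       (use R V test_continuous[OF f] test_continuous[OF g] in
         \<open>auto simp: vanishes_outside_def intro!: continuous_intros\<close>)
  have "(LINT x|lborel. inner (hamiltonian V f x) (g x)) =
      (LINT x|lborel. inner (- laplacian f x) (g x) + V x * inner (f x) (g x))"
    unfolding hamiltonian_def inner_add_left e ..
  also have "\<dots> = (LINT x|lborel. inner (- laplacian f x) (g x)) + (LINT x|lborel. V x * inner (f x) (g x))"
    using i1 i2 by (rule Bochner_Integration.integral_add)
  finally show ?thesis unfolding green[OF f g] .
qed

lemma hamiltonian_add_scaleR:
  "f \<in> test_functions \<Longrightarrow> g \<in> test_functions \<Longrightarrow>
    hamiltonian V (\<lambda>x. f x + c *\<^sub>R g x) = (\<lambda>x. hamiltonian V f x + c *\<^sub>R hamiltonian V g x)"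
  unfolding hamiltonian_def[abs_def] by (auto simp: laplacian_add_scaleR algebra_simps)

lemma subspace_test_rel: "subspace (test_rel V)"
proof -
  have "hamiltonian V (\<lambda>x. 0) = (\<lambda>x. 0)"
    using hamiltonian_add_scaleR[OF test_zero test_zero, of "-1"] by simp
  then have 0: "0 \<in> test_rel V"
    unfolding test_rel_def zero_prod_def abs_l2_zero using test_zero by force
  have comb: "p + c *\<^sub>R q \<in> test_rel V" if pq: "p \<in> test_rel V" "q \<in> test_rel V" for p q c
  proof -
    obtain f g where fg: "f \<in> test_functions" "p = (abs_l2 f, abs_l2 (hamiltonian V f))"
      "g \<in> test_functions" "q = (abs_l2 g, abs_l2 (hamiltonian V g))"
      using pq unfolding test_rel_def by blast
    then have "p + c *\<^sub>R q = (abs_l2 (\<lambda>x. f x + c *\<^sub>R g x), abs_l2 (hamiltonian V (\<lambda>x. f x + c *\<^sub>R g x)))"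
      by (simp add: abs_l2_add abs_l2_scaleR L2_scale test_L2 hamiltonian_L2 hamiltonian_add_scaleR)
    then show ?thesis unfolding test_rel_def using test_add_scaleR[OF fg(1,3)] by blast
  qed
  show ?thesis
    unfolding subspace_def using 0 comb[of _ _ 1] comb[OF 0] by auto
qed

lemma sym_test_rel:
  assumes "(u, f) \<in> test_rel V" "(v, g) \<in> test_rel V"
  shows "inner f v = inner u g"
proof -
  obtain p q where p: "p \<in> test_functions" "u = abs_l2 p" "f = abs_l2 (hamiltonian V p)"
    and q: "q \<in> test_functions" "v = abs_l2 q" "g = abs_l2 (hamiltonian V q)"
    using assms unfolding test_rel_def by blast
  have "inner f v = (LINT x|lborel. inner (hamiltonian V p x) (q x))"
    "inner g u = (LINT x|lborel. inner (hamiltonian V q x) (p x))"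
    unfolding p(2,3) q(2,3) using p(1) q(1) by (simp_all add: inner_abs_l2 test_L2 hamiltonian_L2)
  then have "inner f v = inner g u"
    unfolding hamiltonian_form[OF p(1) q(1)] hamiltonian_form[OF q(1) p(1)]
    by (simp add: inner_commute)
  then show ?thesis by (simp add: inner_commute)
qed

lemma schrodinger_rel_sequence:
  assumes "(u, f) \<in> schrodinger_rel V"
  obtains p g where "\<And>n. (p n, g n) \<in> test_rel V" "p \<longlonglongrightarrow> u" "g \<longlonglongrightarrow> f"
proof -
  obtain x where x: "\<And>n. x n \<in> test_rel V" "x \<longlonglongrightarrow> (u, f)"
    using assms unfolding schrodinger_rel_def closure_sequential by blast
  show thesis
    by (rule that[of "fst \<circ> x" "snd \<circ> x"])
       (use x tendsto_fst[OF x(2)] tendsto_snd[OF x(2)] in \<open>auto simp: o_def\<close>)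
qed

lemma schrodinger_relI:
  assumes "\<And>n. (p n, g n) \<in> test_rel V" "p \<longlonglongrightarrow> u" "g \<longlonglongrightarrow> f"
  shows "(u, f) \<in> schrodinger_rel V"
  unfolding schrodinger_rel_def closure_sequential
  by (rule exI[of _ "\<lambda>n. (p n, g n)"]) (use assms tendsto_Pair in auto)

lemma symmetric_schrodinger_rel: "symmetric_relation UNIV (schrodinger_rel V)"
proof
  show "subspace (schrodinger_rel V)"
    unfolding subspace_def
  proof (intro conjI ballI allI)
    show "0 \<in> schrodinger_rel V"
      using subspace_0[OF subspace_test_rel] closure_subset unfolding schrodinger_rel_def by blast
    fix x y assume "x \<in> schrodinger_rel V" "y \<in> schrodinger_rel V"
    then obtain p q where "\<And>n. p n \<in> test_rel V" "\<And>n. q n \<in> test_rel V" "p \<longlonglongrightarrow> x" "q \<longlonglongrightarrow> y"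
      unfolding schrodinger_rel_def closure_sequential by blast
    then show "x + y \<in> schrodinger_rel V"
      unfolding schrodinger_rel_def closure_sequential
      by (intro exI[of _ "\<lambda>n. p n + q n"]) (auto intro: subspace_add[OF subspace_test_rel] tendsto_add)
  next
    fix c x assume "x \<in> schrodinger_rel V"
    then obtain p where "\<And>n. p n \<in> test_rel V" "p \<longlonglongrightarrow> x"
      unfolding schrodinger_rel_def closure_sequential by blast
    then show "c *\<^sub>R x \<in> schrodinger_rel V"
      unfolding schrodinger_rel_def closure_sequential
      by (intro exI[of _ "\<lambda>n. c *\<^sub>R p n"])
         (auto intro: subspace_scale[OF subspace_test_rel] tendsto_scaleR)
  qed
  fix u f v g assume "(u, f) \<in> schrodinger_rel V" "(v, g) \<in> schrodinger_rel V"
  then obtain p h q k where s: "\<And>n. (p n, h n) \<in> test_rel V" "p \<longlonglongrightarrow> u" "h \<longlonglongrightarrow> f"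
    "\<And>n. (q n, k n) \<in> test_rel V" "q \<longlonglongrightarrow> v" "k \<longlonglongrightarrow> g"
    using schrodinger_rel_sequence by metis
  have "(\<lambda>n. inner (h n) (q n)) \<longlonglongrightarrow> inner f v" "(\<lambda>n. inner (p n) (k n)) \<longlonglongrightarrow> inner u g"
    using s by (auto intro: tendsto_inner)
  then show "inner f v = inner u g"
    using sym_test_rel[OF s(1) s(4)] LIMSEQ_unique by simp
qed auto

text \<open>The bridge from functions to the Hilbert space. \<open>L2_norm\<close> of a difference
  is the distance of classes, so \<open>op_closure\<close> becomes the topological closure of
  \<open>test_rel V\<close> in the product space.\<close>

lemma schrodinger_op_iff:
  "(u, f) \<in> schrodinger_op V \<longleftrightarrow> u \<in> L2 \<and> f \<in> L2 \<and> (abs_l2 u, abs_l2 f) \<in> schrodinger_rel V"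
proof (cases "u \<in> L2 \<and> f \<in> L2")
  case True
  have tf: "p \<in> L2 \<and> g \<in> L2" if "(p, g) \<in> schrodinger_op0 V" for p g
    using that test_L2 hamiltonian_L2 unfolding schrodinger_op0_eq by auto
  show ?thesis
  proof
    assume "(u, f) \<in> schrodinger_op V"
    then obtain p g where pg: "\<And>n. (p n, g n) \<in> schrodinger_op0 V"
      "(\<lambda>n. L2_norm (\<lambda>x. p n x - u x)) \<longlonglongrightarrow> 0" "(\<lambda>n. L2_norm (\<lambda>x. g n x - f x)) \<longlonglongrightarrow> 0"
      unfolding schrodinger_op_def op_closure_def by auto
    have L: "p n \<in> L2" "g n \<in> L2" for n using tf[OF pg(1)] by auto
    have "(abs_l2 u, abs_l2 f) \<in> schrodinger_rel V"
    proof (rule schrodinger_relI)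
      show "(abs_l2 (p n), abs_l2 (g n)) \<in> test_rel V" for n
        using pg(1)[of n] unfolding schrodinger_op0_eq test_rel_def by auto
      show "(\<lambda>n. abs_l2 (p n)) \<longlonglongrightarrow> abs_l2 u" "(\<lambda>n. abs_l2 (g n)) \<longlonglongrightarrow> abs_l2 f"
        unfolding tendsto_dist_iff[of _ "abs_l2 u"] tendsto_dist_iff[of _ "abs_l2 f"]
        using pg True L by (simp_all add: dist_abs_l2)
    qed
    then show "u \<in> L2 \<and> f \<in> L2 \<and> (abs_l2 u, abs_l2 f) \<in> schrodinger_rel V" using True by simp
  next
    assume "u \<in> L2 \<and> f \<in> L2 \<and> (abs_l2 u, abs_l2 f) \<in> schrodinger_rel V"
    then obtain P G where PG: "\<And>n. (P n, G n) \<in> test_rel V" "P \<longlonglongrightarrow> abs_l2 u" "G \<longlonglongrightarrow> abs_l2 f"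
      using schrodinger_rel_sequence by metis
    have "\<exists>p. p \<in> test_functions \<and> P n = abs_l2 p \<and> G n = abs_l2 (hamiltonian V p)" for n
      using PG(1)[of n] unfolding test_rel_def by blast
    then obtain p where p: "\<And>n. p n \<in> test_functions" "\<And>n. P n = abs_l2 (p n)"
      "\<And>n. G n = abs_l2 (hamiltonian V (p n))" by metis
    have "(\<lambda>n. L2_norm (\<lambda>x. p n x - u x)) \<longlonglongrightarrow> 0"
      "(\<lambda>n. L2_norm (\<lambda>x. hamiltonian V (p n) x - f x)) \<longlonglongrightarrow> 0"
      using PG(2,3) True p unfolding tendsto_dist_iff[of P] tendsto_dist_iff[of G]
      by (simp_all add: dist_abs_l2 test_L2 hamiltonian_L2)
    moreover have "\<And>n. (p n, hamiltonian V (p n)) \<in> schrodinger_op0 V"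
      using p(1) unfolding schrodinger_op0_eq by blast
    ultimately show "(u, f) \<in> schrodinger_op V"
      unfolding schrodinger_op_def op_closure_def mem_Collect_eq prod.case using True
      by (intro conjI exI[of _ p] exI[of _ "\<lambda>n. hamiltonian V (p n)"]) simp_all
  qed
next
  case False
  then show ?thesis unfolding schrodinger_op_def op_closure_def by auto
qed

section \<open>The spectral hypotheses in the real Hilbert space\<close>

lemma regular_value_of_resolvent:
  assumes "complex_of_real l \<in> resolvent_set (schrodinger_op V)"
  shows "regular_value UNIV (schrodinger_rel V) l"
proof -
  have e: "abs_l2 f - l *\<^sub>R abs_l2 u = abs_l2 (\<lambda>x. f x - complex_of_real l * u x)"
    if "u \<in> L2" "f \<in> L2" for u f :: "'a \<Rightarrow> complex"
    using that by (simp add: abs_l2_scaleR abs_l2_diff L2_scale scaleR_conv_of_real)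
       (simp add: abs_l2_diff L2_mult_const)
  have "\<exists>u f. (u, f) \<in> schrodinger_rel V \<and> f - l *\<^sub>R u = g" for g :: "'a l2"
  proof -
    obtain g' where g: "g' \<in> L2" "g = abs_l2 g'" by (rule l2_cases)
    obtain u f where uf: "(u, f) \<in> schrodinger_op V" "AE x in lborel. f x - complex_of_real l * u x = g' x"
      using assms g(1) unfolding resolvent_set_def by auto
    then have L: "u \<in> L2" "f \<in> L2" "(abs_l2 u, abs_l2 f) \<in> schrodinger_rel V"
      using schrodinger_op_iff by auto
    have "abs_l2 f - l *\<^sub>R abs_l2 u = g"
      unfolding e[OF L(1,2)] g using uf(2) L g
      by (subst abs_l2_eq_iff) (auto intro: L2_diff L2_mult_const)
    then show ?thesis using L by blast
  qed
  moreover obtain C where C: "\<And>u f. (u, f) \<in> schrodinger_op V \<Longrightarrow>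
      L2_norm u \<le> C * L2_norm (\<lambda>x. f x - complex_of_real l * u x)"
    using assms unfolding resolvent_set_def by blast
  have "norm u \<le> C * norm (f - l *\<^sub>R u)" if "(u, f) \<in> schrodinger_rel V" for u f
  proof -
    obtain u' where u: "u' \<in> L2" "u = abs_l2 u'" by (rule l2_cases)
    obtain f' where f: "f' \<in> L2" "f = abs_l2 f'" by (rule l2_cases)
    have "(u', f') \<in> schrodinger_op V" using that u f schrodinger_op_iff by simp
    from C[OF this] show ?thesis
      unfolding u f e[OF u(1) f(1)] using u f by (simp add: norm_abs_l2 L2_diff L2_mult_const)
  qed
  ultimately show ?thesis unfolding regular_value_def by blast
qed

text \<open>A complex multiple of \<open>e\<close> is a real combination of \<open>e\<close> and
  \<open>\<i> * e\<close>. Doubling the spanning set therefore turns finite complex multiplicity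
  into finite real dimension.\<close>

lemma abs_l2_sum_in_span:
  assumes "finite B" "B \<subseteq> L2"
  shows "(\<lambda>x. \<Sum>e\<in>B. c e * e x) \<in> L2 \<and>
    abs_l2 (\<lambda>x. \<Sum>e\<in>B. c e * e x) \<in> span (abs_l2 ` B \<union> (\<lambda>e. abs_l2 (\<lambda>x. \<i> * e x)) ` B)"
  using assms
proof (induction B)
  case empty
  then show ?case by (simp add: L2_zero flip: abs_l2_zero)
next
  case (insert e B)
  let ?S = "\<lambda>B. abs_l2 ` B \<union> (\<lambda>e. abs_l2 (\<lambda>x. \<i> * e x)) ` B"
  have e: "e \<in> L2" using insert by simp
  have ce: "(\<lambda>x. c e * e x) \<in> L2" using L2_mult_const[OF e] .
  have "abs_l2 (\<lambda>x. c e * e x) = Re (c e) *\<^sub>R abs_l2 e + Im (c e) *\<^sub>R abs_l2 (\<lambda>x. \<i> * e x)"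
    using e L2_mult_const[OF e, of "\<i>"]
    by (simp add: abs_l2_scaleR abs_l2_add L2_scale)
       (rule arg_cong[of _ _ abs_l2], auto simp: complex_eq_iff)
  also have "\<dots> \<in> span (?S (insert e B))"
    by (intro span_add span_scale span_base) auto
  finally have a: "abs_l2 (\<lambda>x. c e * e x) \<in> span (?S (insert e B))" .
  have b: "abs_l2 (\<lambda>x. \<Sum>e\<in>B. c e * e x) \<in> span (?S (insert e B))"
    using insert span_mono[of "?S B" "?S (insert e B)"] by auto
  show ?case using insert ce span_add[OF a b]
    by (simp add: L2_add abs_l2_add)
qed

text \<open>Everything passes through \<open>spec\<close>: a real number that is not regular belongs
  to the spectrum, where the lower bound, isolation and finite multiplicity are available.\<close>

lemma discrete_schrodinger_rel:
  assumes d: "discrete_spectrum (schrodinger_op V)"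
    and c: "\<And>l. l \<in> op_spectrum (schrodinger_op V) \<Longrightarrow> c \<le> Re l"
  shows "discrete_symmetric_relation (schrodinger_rel V) c"
proof -
  interpret symmetric_relation UNIV "schrodinger_rel V" by (rule symmetric_schrodinger_rel)
  have spec: "complex_of_real l \<in> op_spectrum (schrodinger_op V)"
    if "\<not> regular_value UNIV (schrodinger_rel V) l" for l
    using that regular_value_of_resolvent unfolding op_spectrum_def by blast
  show ?thesis
  proof
    fix l assume "l < c"
    then show "regular_value UNIV (schrodinger_rel V) l" using spec c by force
  next
    fix l assume l: "\<not> regular_value UNIV (schrodinger_rel V) l"
    have "complex_of_real l isolated_in op_spectrum (schrodinger_op V)"
      using spec[OF l] d unfolding discrete_spectrum_def by blast
    then obtain T where T: "open T" "T \<inter> op_spectrum (schrodinger_op V) = {complex_of_real l}"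
      unfolding isolated_in_def by blast
    then have "complex_of_real l \<in> T" by blast
    then obtain \<epsilon> where e: "\<epsilon> > 0" "ball (complex_of_real l) \<epsilon> \<subseteq> T"
      using T(1) open_contains_ball by blast
    show "\<exists>\<epsilon>>0. \<forall>z. z \<noteq> l \<longrightarrow> \<bar>z - l\<bar> < \<epsilon> \<longrightarrow> regular_value UNIV (schrodinger_rel V) z"
    proof (intro exI[of _ \<epsilon>] conjI allI impI e)
      fix z assume z: "z \<noteq> l" "\<bar>z - l\<bar> < \<epsilon>"
      have "dist (complex_of_real l) (complex_of_real z) = \<bar>z - l\<bar>"
        by (metis dist_commute dist_of_real dist_real_def)
      then have "complex_of_real z \<in> T" using e z by (auto simp: subset_iff)
      moreover have "complex_of_real z \<noteq> complex_of_real l" using z by simp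
      ultimately show "regular_value UNIV (schrodinger_rel V) z" using spec T by blast
    qed
    have "finite_multiplicity (schrodinger_op V) (complex_of_real l)"
      using spec[OF l] d unfolding discrete_spectrum_def by blast
    then obtain B where B: "finite B" "B \<subseteq> L2"
      "\<forall>u\<in>op_eigenspace (schrodinger_op V) (complex_of_real l).
         \<exists>c. AE x in lborel. u x = (\<Sum>e\<in>B. c e * e x)"
      unfolding finite_multiplicity_def by (elim exE conjE)
    let ?B = "abs_l2 ` B \<union> (\<lambda>e. abs_l2 (\<lambda>x. \<i> * e x)) ` B"
    have "u \<in> span ?B" if u: "(u, l *\<^sub>R u) \<in> schrodinger_rel V" for u
    proof -
      obtain u' where u': "u' \<in> L2" "u = abs_l2 u'" by (rule l2_cases)
      have "(u', \<lambda>x. l *\<^sub>R u' x) \<in> schrodinger_op V"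
        using u u' by (simp add: schrodinger_op_iff L2_scale abs_l2_scaleR)
      then have "u' \<in> op_eigenspace (schrodinger_op V) (complex_of_real l)"
        unfolding op_eigenspace_def by (auto simp: scaleR_conv_of_real)
      with B(3) have "\<exists>c. AE x in lborel. u' x = (\<Sum>e\<in>B. c e * e x)" by (rule bspec)
      then obtain c where "AE x in lborel. u' x = (\<Sum>e\<in>B. c e * e x)" ..
      then have "u = abs_l2 (\<lambda>x. \<Sum>e\<in>B. c e * e x)"
        using abs_l2_sum_in_span[OF B(1,2), of c] u' by (simp add: abs_l2_eq_iff)
      then show ?thesis using abs_l2_sum_in_span[OF B(1,2), of c] by simp
    qed
    then show "\<exists>B. finite B \<and> {u. (u, l *\<^sub>R u) \<in> schrodinger_rel V} \<subseteq> span B"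
      using B(1) by (intro exI[of _ ?B]) auto
  qed
qed

end

section \<open>The form at infinity\<close>

lemma hamiltonian_local:
  assumes f: "f \<in> test_functions" and S: "open S" "\<And>x. x \<in> S \<Longrightarrow> f x = 0" "x \<in> S"
  shows "hamiltonian V f x = 0"
proof -
  have "partial_deriv b (partial_deriv b f) x = 0" if b: "b \<in> Basis" for b
  proof (rule has_partial_zero_on_open[OF test_partial(1)[OF test_partial(2)[OF f b] b] S(1) _ S(3)])
    show "partial_deriv b f z = 0" if "z \<in> S" for z
      by (rule has_partial_zero_on_open[OF test_partial(1)[OF f b] S(1,2) that])
  qed
  then show ?thesis using S unfolding hamiltonian_def laplacian_def by simp
qed

definition form_bounded :: "('a::euclidean_space \<Rightarrow> real) \<Rightarrow> real \<Rightarrow> real \<Rightarrow> 'a \<Rightarrow> bool" where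
  "form_bounded V r l y \<longleftrightarrow> (\<forall>f\<in>test_functions. (\<forall>x. dist y x > r \<longrightarrow> f x = 0) \<longrightarrow>
     l * (LINT x|lborel. (cmod (f x))\<^sup>2) \<le> (LINT x|lborel. inner (hamiltonian V f x) (f x)))"

text \<open>
  Otherwise there are infinitely many test functions with disjoint supports on which the form
  stays below \<open>l\<close>, and a combination of them is orthogonal to the finite set on whose complement
  the form exceeds \<open>l\<close>.
\<close>

lemma form_bound_at_infinity:
  fixes V :: "'a::euclidean_space \<Rightarrow> real"
  assumes V: "continuous_on UNIV V" and H: "discrete_symmetric_relation (schrodinger_rel V) c"
    and r: "r > 0"
  shows "\<exists>\<rho>. \<forall>y. norm y > \<rho> \<longrightarrow> form_bounded V r l y"
proof (rule ccontr)
  interpret H: discrete_symmetric_relation "schrodinger_rel V" c by (rule H)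
  define bad where "bad = (\<lambda>(y, f). f \<in> test_functions \<and> (\<forall>x. dist y x > r \<longrightarrow> f x = 0) \<and>
     (LINT x|lborel. inner (hamiltonian V f x) (f x)) < l * (LINT x|lborel. (cmod (f x))\<^sup>2))"
  assume "\<not> ?thesis"
  then have ex: "\<exists>p. bad p \<and> norm (fst p) > \<rho>" for \<rho> unfolding bad_def form_bounded_def by fastforce
  \<comment> \<open>The norms of successive centres grow by more than \<open>2 * r\<close>, which
    makes the closed balls of radius \<open>r\<close> that carry the functions disjoint.\<close>
  have "\<exists>p. \<forall>n. bad (p n) \<and> norm (fst (p (Suc n))) > norm (fst (p n)) + 2 * r"
    by (rule dependent_nat_choice) (use ex in blast)+
  then obtain p where p: "\<And>n. bad (p n)" "\<And>n. norm (fst (p (Suc n))) > norm (fst (p n)) + 2 * r"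
    by blast
  define Y where "Y n = fst (p n)" for n
  define f where "f n = snd (p n)" for n
  have f: "f n \<in> test_functions" "\<And>x. dist (Y n) x > r \<Longrightarrow> f n x = 0"
    "(LINT x|lborel. inner (hamiltonian V (f n) x) (f n x)) < l * (LINT x|lborel. (cmod (f n x))\<^sup>2)" for n
    using p(1)[of n] unfolding bad_def Y_def f_def by (auto simp: split_beta)
  have Y_mono: "norm (Y j) > norm (Y i) + 2 * r" if "i < j" for i j
    using that
  proof (induction j)
    case (Suc j)
    then show ?case using p(2)[of j] r unfolding Y_def by (cases "i = j") auto
  qed simp
  have disj: "dist (Y i) x > r \<or> dist (Y j) x > r" if "i \<noteq> j" for i j x
  proof (rule ccontr)
    assume "\<not> ?thesis"
    then have "dist (Y i) (Y j) \<le> 2 * r" using dist_triangle2[of "Y i" "Y j" x] by simp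
    moreover have "norm (Y i) \<le> norm (Y j) + dist (Y i) (Y j)"
      "norm (Y j) \<le> norm (Y i) + dist (Y i) (Y j)"
      using norm_triangle_sub[of "Y i" "Y j"] norm_triangle_sub[of "Y j" "Y i"]
      by (auto simp: dist_norm norm_minus_commute)
    ultimately show False using Y_mono[of i j] Y_mono[of j i] that by (cases "i < j") auto
  qed
  \<comment> \<open>The operator is local, so it does not enlarge supports; this removes the
    off-diagonal terms of the form.\<close>
  have Hf: "hamiltonian V (f n) x = 0" if "dist (Y n) x > r" for n x
  proof (rule hamiltonian_local[OF f(1)])
    show "open {x. dist (Y n) x > r}" by (intro open_Collect_less continuous_intros)
  qed (use f(2) that in auto)
  have fL: "f n \<in> L2" "hamiltonian V (f n) \<in> L2" for n
    using test_L2[OF f(1)] hamiltonian_L2[OF V f(1)] by auto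
  obtain E where E: "finite E"
    "\<And>u g. (u, g) \<in> schrodinger_rel V \<Longrightarrow> u \<in> orth_compl E \<Longrightarrow> l * (norm u)\<^sup>2 \<le> inner g u"
    using H.finite_codim_form_bound[of l] by blast
  define u where "u n = abs_l2 (f n)" for n
  define h where "h n = abs_l2 (hamiltonian V (f n))" for n
  have uh: "(u n, h n) \<in> schrodinger_rel V" for n
    using closure_subset[of "test_rel V"] f(1)
    unfolding schrodinger_rel_def test_rel_def u_def h_def by blast
  have diag: "inner (h n) (u n) < l * (norm (u n))\<^sup>2" for n
    using f(3)[of n] unfolding u_def h_def
    by (simp add: inner_abs_l2 fL power2_norm_eq_inner)
  have off: "inner (h i) (u j) = 0" "inner (u i) (u j) = 0" if "i \<noteq> j" for i j
  proof -
    have "inner (hamiltonian V (f i) x) (f j x) = 0" "inner (f i x) (f j x) = 0" for x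
      using disj[OF that, of x] Hf f(2) by auto
    then show "inner (h i) (u j) = 0" "inner (u i) (u j) = 0"
      unfolding u_def h_def by (simp_all add: inner_abs_l2 fL)
  qed
  obtain a where a: "\<exists>i\<le>card E. a i \<noteq> 0" "(\<Sum>i\<le>card E. a i *\<^sub>R u i) \<in> orth_compl E"
    using exists_combination_orth[OF E(1), of u] by blast
  define w where "w = (\<Sum>i\<le>card E. a i *\<^sub>R u i)"
  define k where "k = (\<Sum>i\<le>card E. a i *\<^sub>R h i)"
  have "(w, k) = (\<Sum>i\<le>card E. a i *\<^sub>R (u i, h i))"
    unfolding w_def k_def by (simp add: sum_prod)
  also have "\<dots> \<in> schrodinger_rel V"
    by (intro subspace_sum[OF H.subspace_H] subspace_scale[OF H.subspace_H] uh)
  finally have wk: "(w, k) \<in> schrodinger_rel V" .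
  have dsum: "(\<Sum>i\<le>card E. \<Sum>j\<le>card E. a i * a j * F i j) = (\<Sum>i\<le>card E. (a i)\<^sup>2 * F i i)"
    if F: "\<And>i j. i \<noteq> j \<Longrightarrow> F i j = 0" for F :: "nat \<Rightarrow> nat \<Rightarrow> real"
  proof (rule sum.cong[OF refl])
    fix i assume i: "i \<in> {..card E}"
    have "(\<Sum>j\<le>card E. a i * a j * F i j) = (\<Sum>j\<in>{i}. a i * a j * F i j)"
      by (rule sum.mono_neutral_right) (use i F in auto)
    then show "(\<Sum>j\<le>card E. a i * a j * F i j) = (a i)\<^sup>2 * F i i" by (simp add: power2_eq_square)
  qed
  have "inner k w = (\<Sum>i\<le>card E. \<Sum>j\<le>card E. a i * a j * inner (h i) (u j))"
    unfolding w_def k_def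
    by (simp add: inner_sum_left inner_sum_right sum_distrib_left, subst sum.swap,
        simp add: mult.assoc mult.left_commute)
  also have "\<dots> = (\<Sum>i\<le>card E. (a i)\<^sup>2 * inner (h i) (u i))" by (rule dsum) (rule off)
  also have "\<dots> < (\<Sum>i\<le>card E. (a i)\<^sup>2 * (l * (norm (u i))\<^sup>2))"
  proof (rule sum_strict_mono_ex1)
    show "\<forall>i\<in>{..card E}. (a i)\<^sup>2 * inner (h i) (u i) \<le> (a i)\<^sup>2 * (l * (norm (u i))\<^sup>2)"
      by (intro ballI mult_left_mono less_imp_le[OF diag]) simp
    obtain i where "i \<le> card E" "a i \<noteq> 0" using a(1) by blast
    then show "\<exists>i\<in>{..card E}. (a i)\<^sup>2 * inner (h i) (u i) < (a i)\<^sup>2 * (l * (norm (u i))\<^sup>2)"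
      using diag[of i] by (intro bexI[of _ i] mult_strict_left_mono) auto
  qed auto
  also have "\<dots> = l * (\<Sum>i\<le>card E. (a i)\<^sup>2 * inner (u i) (u i))"
    by (simp add: sum_distrib_left power2_norm_eq_inner algebra_simps)
  also have "(\<Sum>i\<le>card E. (a i)\<^sup>2 * inner (u i) (u i)) =
      (\<Sum>i\<le>card E. \<Sum>j\<le>card E. a i * a j * inner (u i) (u j))"
    by (rule dsum[symmetric]) (rule off)
  also have "\<dots> = (norm w)\<^sup>2"
    unfolding w_def power2_norm_eq_inner
    by (simp add: inner_sum_left inner_sum_right sum_distrib_left mult.assoc mult.left_commute inner_commute)
  finally show False using E(2)[OF wk] a(2) unfolding w_def[symmetric] by simp
qed

section \<open>Smoothing of Lipschitz functions\<close>

text \<open>\<open>flat 0\<close> is the classical function \<open>exp (- 1 / x)\<close>, extended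
  by zero. The powers of \<open>inverse x\<close> are those that its derivatives produce, so that
  the derivative of each member is a combination of members.\<close>

definition flat :: "nat \<Rightarrow> real \<Rightarrow> real" where
  "flat m x = (if x > 0 then exp (- inverse x) * inverse x ^ m else 0)"

lemma flat_nonneg: "flat m x \<ge> 0"
  unfolding flat_def by simp

lemma flat_tendsto_0: "(flat m \<longlongrightarrow> 0) (at 0)"
proof (rule filterlim_split_at_real)
  have "((\<lambda>x. inverse x ^ m / exp (inverse x)) \<longlongrightarrow> 0) (at_right (0::real))"
    by (rule filterlim_compose[OF tendsto_power_div_exp_0 filterlim_inverse_at_top_right])
  then show "(flat m \<longlongrightarrow> 0) (at_right 0)"
    by (rule Lim_transform_eventually)
       (auto simp: flat_def eventually_at_right_field exp_minus field_simps intro!: exI[of _ 1])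
  show "(flat m \<longlongrightarrow> 0) (at_left 0)"
    by (rule Lim_transform_eventually[OF tendsto_const])
       (auto simp: flat_def eventually_at_left_field intro!: exI[of _ "-1"])
qed

lemma flat_derivative:
  "(flat m has_real_derivative (flat (m + 2) x - real m * flat (m + 1) x)) (at x)"
proof (cases x "0::real" rule: linorder_cases)
  case less
  have "(flat m has_real_derivative 0) (at x)"
    by (rule has_field_derivative_transform_within_open[where S = "{..<0}" and f = "\<lambda>_. 0"])
       (use less in \<open>auto simp: flat_def\<close>)
  then show ?thesis using less by (simp add: flat_def)
next
  case equal
  \<comment> \<open>The difference quotient of \<open>flat m\<close> at zero is
    \<open>flat (m + 1)\<close>, so its limit is already known.\<close>
  have "((\<lambda>y. (flat m y - flat m 0) / (y - 0)) \<longlongrightarrow> 0) (at 0)"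
    by (rule Lim_transform_eventually[OF flat_tendsto_0[of "m + 1"]])
       (auto simp: flat_def eventually_at_filter field_simps)
  then show ?thesis using equal by (simp add: has_field_derivative_iff flat_def)
next
  case greater
  have x: "x \<noteq> 0" using greater by simp
  have "((\<lambda>x. inverse x ^ m) has_real_derivative (- real m * inverse x ^ (m + 1))) (at x)"
    using DERIV_power_Suc[OF DERIV_inverse[OF x]]
    by (cases m) (auto simp: power_add algebra_simps)
  moreover have "((\<lambda>x. exp (- inverse x)) has_real_derivative
      exp (- inverse x) * inverse x ^ 2) (at x)"
    using x by (auto intro!: derivative_eq_intros simp: power2_eq_square)
  ultimately have "((\<lambda>x. exp (- inverse x) * inverse x ^ m) has_real_derivative
      (exp (- inverse x) * (- real m * inverse x ^ (m + 1)) +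
       (exp (- inverse x) * inverse x ^ 2) * inverse x ^ m)) (at x)"
    by (intro DERIV_mult')
  then have "((\<lambda>x. exp (- inverse x) * inverse x ^ m) has_real_derivative
      (flat (m + 2) x - real m * flat (m + 1) x)) (at x)"
    by (rule DERIV_cong) (use greater in \<open>simp add: flat_def power2_eq_square algebra_simps\<close>)
  then show ?thesis
    by (rule has_field_derivative_transform_within_open[where S = "{0<..}"])
       (use greater in \<open>auto simp: flat_def\<close>)
qed

lemma continuous_flat: "continuous_on UNIV (flat m)"
  using flat_derivative by (meson DERIV_isCont continuous_at_imp_continuous_on)

text \<open>
  This family contains the bump function and is closed under partial derivatives, which yields
  all orders of differentiability at once.
\<close>

inductive_set smooth_gen :: "real \<Rightarrow> ('a::euclidean_space \<Rightarrow> real) set" for d :: real where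
  const: "(\<lambda>x. c) \<in> smooth_gen d"
| coord: "(\<lambda>x. inner x b) \<in> smooth_gen d"
| flat: "(\<lambda>x. flat m (d - inner x x)) \<in> smooth_gen d"
| add: "f \<in> smooth_gen d \<Longrightarrow> g \<in> smooth_gen d \<Longrightarrow> (\<lambda>x. f x + g x) \<in> smooth_gen d"
| mult: "f \<in> smooth_gen d \<Longrightarrow> g \<in> smooth_gen d \<Longrightarrow> (\<lambda>x. f x * g x) \<in> smooth_gen d"

lemma smooth_gen_continuous: "f \<in> smooth_gen d \<Longrightarrow> continuous_on UNIV f"
  by (induction rule: smooth_gen.induct)
     (auto intro!: continuous_intros continuous_on_compose2[OF continuous_flat])

lemma smooth_gen_partial:
  "f \<in> smooth_gen d \<Longrightarrow> \<exists>g\<in>smooth_gen d. has_partial b f g"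
proof (induction rule: smooth_gen.induct)
  case (const c)
  show ?case by (intro bexI[of _ "\<lambda>x. 0"] smooth_gen.const) (simp add: has_partial_def)
next
  case (coord b')
  have "has_partial b (\<lambda>x. inner x b') (\<lambda>x. inner b b')"
    unfolding has_partial_def inner_add_left
    by (auto intro!: derivative_eq_intros simp flip: has_real_derivative_iff_has_vector_derivative)
  then show ?case using smooth_gen.const by blast
next
  case (flat m)
  have "has_partial b (\<lambda>x. flat m (d - inner x x))
     (\<lambda>x. (flat (m + 2) (d - inner x x) + (- real m) * flat (m + 1) (d - inner x x)) *
        ((-2) * inner x b))"
    unfolding has_partial_def
  proof
    fix x :: 'a
    have "((\<lambda>t. d - (inner x x + 2 * t * inner x b + t * t * inner b b)) has_real_derivative (-2) * inner x b) (at 0)"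
      by (auto intro!: derivative_eq_intros)
    moreover have "(\<lambda>t. d - (inner x x + 2 * t * inner x b + t * t * inner b b)) =
       (\<lambda>t. d - inner (x + t *\<^sub>R b) (x + t *\<^sub>R b))"
      by (auto simp: inner_add_left inner_add_right inner_commute algebra_simps)
    ultimately have "((\<lambda>t. d - inner (x + t *\<^sub>R b) (x + t *\<^sub>R b)) has_real_derivative (-2) * inner x b) (at 0)"
      by simp
    from DERIV_chain2[OF flat_derivative this]
    show "((\<lambda>t. flat m (d - inner (x + t *\<^sub>R b) (x + t *\<^sub>R b))) has_vector_derivative
       (flat (m + 2) (d - inner x x) + (- real m) * flat (m + 1) (d - inner x x)) *
        ((-2) * inner x b)) (at 0)"
      by (simp flip: has_real_derivative_iff_has_vector_derivative)
  qed
  moreover have "(\<lambda>x. (flat (m + 2) (d - inner x x) + (- real m) * flat (m + 1) (d - inner x x)) *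
        ((-2) * inner x b)) \<in> smooth_gen d"
    by (intro smooth_gen.intros)
  ultimately show ?case by blast
next
  case (add f g)
  then obtain f' g' where "f' \<in> smooth_gen d" "has_partial b f f'" "g' \<in> smooth_gen d" "has_partial b g g'"
    by blast
  then show ?case using has_partial_add smooth_gen.add by blast
next
  case (mult f g)
  then obtain f' g' where fg: "f' \<in> smooth_gen d" "has_partial b f f'" "g' \<in> smooth_gen d" "has_partial b g g'"
    by blast
  have "has_partial b (\<lambda>x. f x * g x) (\<lambda>x. f x * g' x + f' x * g x)"
    using has_partial_inner[OF fg(2,4)] by simp
  then show ?case using mult.hyps fg smooth_gen.add smooth_gen.mult by blast
qed

text \<open>The variable \<open>x\<close> sits in the kernel \<open>g\<close>, so that all
  derivatives fall on the smooth factor and \<open>\<phi>\<close> only has to be continuous.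
  \<open>K\<close> will be a box that contains the support of \<open>\<phi>\<close>.\<close>

definition mollify :: "'a::euclidean_space set \<Rightarrow> ('a \<Rightarrow> real) \<Rightarrow> ('a \<Rightarrow> real) \<Rightarrow> 'a \<Rightarrow> real" where
  "mollify K \<phi> g x = integral K (\<lambda>z. \<phi> z * g (x - z))"

context
  fixes \<phi> :: "'a::euclidean_space \<Rightarrow> real" and a c :: 'a
  assumes phi: "continuous_on UNIV \<phi>"
begin

lemma mollify_continuous:
  assumes g: "continuous_on UNIV g"
  shows "continuous_on UNIV (mollify (cbox a c) \<phi> g)"
  unfolding mollify_def[abs_def]
proof (rule integral_continuous_on_param)
  show "continuous_on (UNIV \<times> cbox a c) (\<lambda>(x, z). \<phi> z * g (x - z))"
    unfolding split_beta
    by (intro continuous_intros continuous_on_compose2[OF phi] continuous_on_compose2[OF g]) auto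
qed

lemma mollify_partial:
  assumes g: "continuous_on UNIV g" and g': "continuous_on UNIV g'" and p: "has_partial b g g'"
  shows "has_partial b (mollify (cbox a c) \<phi> g) (mollify (cbox a c) \<phi> g')"
  unfolding has_partial_def
proof
  fix x
  have "((\<lambda>t. integral (cbox a c) (\<lambda>z. \<phi> z * g (x + t *\<^sub>R b - z))) has_field_derivative
      integral (cbox a c) (\<lambda>z. \<phi> z * g' (x + 0 *\<^sub>R b - z))) (at 0 within UNIV)"
  proof (rule leibniz_rule_field_derivative)
    fix t :: real and z
    have "((\<lambda>t. g (x - z + t *\<^sub>R b)) has_real_derivative g' (x - z + t *\<^sub>R b)) (at t)"
      using has_partial_at[OF p] by (simp add: has_real_derivative_iff_has_vector_derivative)
    from DERIV_cmult[OF this, of "\<phi> z"]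
    show "((\<lambda>t. \<phi> z * g (x + t *\<^sub>R b - z)) has_field_derivative \<phi> z * g' (x + t *\<^sub>R b - z)) (at t within UNIV)"
      by (simp add: algebra_simps)
    show "(\<lambda>z. \<phi> z * g (x + t *\<^sub>R b - z)) integrable_on cbox a c"
      by (rule integrable_continuous)
         (intro continuous_intros continuous_on_compose2[OF phi] continuous_on_compose2[OF g]; auto)
    show "continuous_on (UNIV \<times> cbox a c) (\<lambda>(t, z). \<phi> z * g' (x + t *\<^sub>R b - z))"
      unfolding split_beta
      by (intro continuous_intros continuous_on_compose2[OF phi] continuous_on_compose2[OF g']) auto
  qed auto
  then show "((\<lambda>t. mollify (cbox a c) \<phi> g (x + t *\<^sub>R b)) has_vector_derivative
      mollify (cbox a c) \<phi> g' x) (at 0)"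
    unfolding mollify_def by (simp add: has_real_derivative_iff_has_vector_derivative)
qed

text \<open>The kernel \<open>g\<close> is generalised in the induction: a partial derivative of the
  mollification is the mollification with a partial derivative of the kernel, which is again in
  \<open>smooth_gen d\<close>.\<close>

lemma mollify_C_k:
  "g \<in> smooth_gen d \<Longrightarrow> C_k k (\<lambda>x. complex_of_real (mollify (cbox a c) \<phi> g x))"
proof (induction k arbitrary: g)
  case 0
  then show ?case
    using mollify_continuous[OF smooth_gen_continuous] by (auto intro!: continuous_intros)
next
  case (Suc k)
  show ?case
  proof (rule C_k_SucI)
    show "continuous_on UNIV (\<lambda>x. complex_of_real (mollify (cbox a c) \<phi> g x))"
      using mollify_continuous[OF smooth_gen_continuous[OF Suc.prems]] by (intro continuous_intros)
    fix b :: 'a assume "b \<in> Basis"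
    obtain g' where g': "g' \<in> smooth_gen d" "has_partial b g g'"
      using smooth_gen_partial[OF Suc.prems] by blast
    have "has_partial b (mollify (cbox a c) \<phi> g) (mollify (cbox a c) \<phi> g')"
      by (rule mollify_partial) (use smooth_gen_continuous g' Suc.prems in auto)
    then have "has_partial b (\<lambda>x. complex_of_real (mollify (cbox a c) \<phi> g x))
        (\<lambda>x. complex_of_real (mollify (cbox a c) \<phi> g' x))"
      unfolding has_partial_def by (auto intro: bounded_linear.has_vector_derivative[OF bounded_linear_of_real])
    then show "\<exists>h. has_partial b (\<lambda>x. complex_of_real (mollify (cbox a c) \<phi> g x)) h \<and> C_k k h"
      using Suc.IH[OF g'(1)] by blast
  qed
qed

end

section \<open>The normalised smoothing and its estimates\<close>

lemma lborel_integral_reflect: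
  fixes g :: "'a::euclidean_space \<Rightarrow> real"
  assumes [measurable]: "g \<in> borel_measurable borel"
  shows "(LINT z|lborel. g (x - z)) = (LINT z|lborel. g z)"
proof -
  have "(LINT z|lborel. g z) = (LINT z|distr lborel borel (\<lambda>z. x + (-1) *\<^sub>R z). g z)"
    using lborel_affine[of "-1" x] by (simp add: density_1)
  also have "\<dots> = (LINT z|lborel. g (x - z))" by (subst integral_distr) auto
  finally show ?thesis by simp
qed

definition bump :: "real \<Rightarrow> 'a::euclidean_space \<Rightarrow> real" where
  "bump d x = flat 0 (d\<^sup>2 - inner x x)"

lemma bump_nonneg: "bump d x \<ge> 0"
  unfolding bump_def by (rule flat_nonneg)

lemma bump_eq_0: "d > 0 \<Longrightarrow> norm x \<ge> d \<Longrightarrow> bump d x = 0"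
  using power_mono[of d "norm x" 2] unfolding bump_def flat_def by (simp add: power2_norm_eq_inner)

lemma bump_gen: "bump d \<in> smooth_gen (d\<^sup>2)"
  unfolding bump_def[abs_def] by (rule smooth_gen.flat)

lemma bump_continuous: "continuous_on UNIV (bump d)"
  by (rule smooth_gen_continuous[OF bump_gen])

lemma bump_integrable: "d > 0 \<Longrightarrow> integrable lborel (bump d)"
  by (rule compact_support_integrable[OF bump_continuous, of d])
     (auto simp: vanishes_outside_def bump_eq_0)

lemma bump_integral_pos:
  assumes d: "d > 0"
  shows "(LINT x|lborel. bump d (x::'a::euclidean_space)) > 0"
proof -
  have "(LINT x|lborel. bump d (x::'a)) \<noteq> 0"
  proof
    assume "(LINT x|lborel. bump d (x::'a)) = 0"
    then have "AE x::'a in lborel. bump d x = 0"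
      using integral_nonneg_eq_0_iff_AE[OF bump_integrable[OF d]] bump_nonneg by auto
    then have "AE x::'a in lborel. x \<notin> ball 0 d"
    proof eventually_elim
      fix x :: 'a assume "bump d x = 0"
      then have "d\<^sup>2 \<le> (norm x)\<^sup>2"
        unfolding bump_def flat_def by (auto simp: power2_norm_eq_inner split: if_splits)
      then have "d \<le> norm x" using d by (simp add: power2_le_iff_abs_le)
      then show "x \<notin> ball 0 d" by simp
    qed
    then have "emeasure lborel (ball (0::'a) d) = 0"
      by (subst (asm) AE_iff_measurable[of "ball 0 d"]) auto
    then show False using d unit_ball_vol_pos[of "real DIM('a)"] by (simp add: emeasure_ball)
  qed
  moreover have "0 \<le> (LINT x|lborel. bump d (x::'a))"
    by (rule integral_nonneg_AE) (simp add: bump_nonneg)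
  ultimately show ?thesis by simp
qed


definition smoothing :: "'a::euclidean_space set \<Rightarrow> ('a \<Rightarrow> real) \<Rightarrow> real \<Rightarrow> 'a \<Rightarrow> real" where
  "smoothing K \<phi> d x = mollify K \<phi> (bump d) x / (LINT z|lborel. bump d (z::'a))"

context
  fixes \<phi> :: "'a::euclidean_space \<Rightarrow> real" and L r :: real and y a c :: 'a
  assumes lip: "\<And>x z. \<bar>\<phi> x - \<phi> z\<bar> \<le> L * dist x z"
    and supp: "\<And>x. dist y x > r \<Longrightarrow> \<phi> x = 0"
    and K: "cball y r \<subseteq> cbox a c"
begin

lemma lip_continuous: "continuous_on UNIV \<phi>"
proof -
  have "(max L 0)-lipschitz_on UNIV \<phi>"
  proof (rule lipschitz_onI)
    fix x z :: 'a
    show "dist (\<phi> x) (\<phi> z) \<le> max L 0 * dist x z"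
      using lip[of x z] mult_right_mono[of L "max L 0" "dist x z"] by (simp add: dist_real_def)
  qed simp
  then show ?thesis by (rule lipschitz_on_continuous_on)
qed

text \<open>Differentiation needs the translation on the kernel; the Lipschitz and support estimates
  need it on \<open>\<phi>\<close>. Reflection passes from one form to the other.\<close>

lemma mollify_bump_eq: "mollify (cbox a c) \<phi> (bump d) x = (LINT z|lborel. \<phi> (x - z) * bump d z)"
proof -
  have cont: "continuous_on UNIV (\<lambda>z. \<phi> z * bump d (x - z))"
    by (intro continuous_intros lip_continuous continuous_on_compose2[OF bump_continuous]) auto
  have ind: "(\<lambda>z. indicator (cbox a c) z *\<^sub>R (\<phi> z * bump d (x - z))) = (\<lambda>z. \<phi> z * bump d (x - z))"
  proof
    fix z
    show "indicator (cbox a c) z *\<^sub>R (\<phi> z * bump d (x - z)) = \<phi> z * bump d (x - z)"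
      using supp[of z] K by (cases "z \<in> cball y r") (auto simp: indicator_def subset_iff)
  qed
  have "set_integrable lborel (cbox a c) (\<lambda>z. \<phi> z * bump d (x - z))"
    unfolding set_integrable_def
    by (rule borel_integrable_compact) (auto intro: continuous_on_subset[OF cont])
  from set_borel_integral_eq_integral(2)[OF this]
  have "mollify (cbox a c) \<phi> (bump d) x = (LINT z|lborel. \<phi> z * bump d (x - z))"
    unfolding mollify_def set_lebesgue_integral_def ind by simp
  also have "\<dots> = (LINT z|lborel. \<phi> (x - z) * bump d (x - (x - z)))"
    by (rule lborel_integral_reflect[symmetric, of "\<lambda>z. \<phi> z * bump d (x - z)"])
       (rule borel_measurable_continuous_onI[OF cont])
  finally show ?thesis by simp
qed

context
  fixes d :: real
  assumes d: "d > 0"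
begin

lemma bump_product_integrable: "integrable lborel (\<lambda>z. \<phi> (x - z) * bump d z)"
  by (rule compact_support_integrable[of _ d])
     (auto simp: vanishes_outside_def bump_eq_0[OF d]
       intro!: continuous_intros bump_continuous continuous_on_compose2[OF lip_continuous])

lemma weighted_difference_bound:
  assumes "\<And>z. norm z < d \<Longrightarrow> \<bar>f z - g z\<bar> \<le> C"
    and "integrable lborel (\<lambda>z::'a. f z * bump d z)" "integrable lborel (\<lambda>z. g z * bump d z)"
  shows "\<bar>(LINT z|lborel. f z * bump d z) - (LINT z|lborel. g z * bump d z)\<bar>
    \<le> C * (LINT z|lborel. bump d (z::'a))"
proof -
  have "\<bar>LINT z|lborel. f z * bump d z - g z * bump d z\<bar> \<le> (LINT z|lborel. C * bump d (z::'a))"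
  proof (rule integral_abs_bound_integral)
    fix z :: 'a
    show "\<bar>f z * bump d z - g z * bump d z\<bar> \<le> C * bump d z"
    proof (cases "norm z < d")
      case True
      then show ?thesis using mult_right_mono[OF assms(1)[OF True] bump_nonneg[of d z]]
        by (simp add: left_diff_distrib[symmetric] abs_mult bump_nonneg)
    next
      case False
      then show ?thesis using bump_eq_0[OF d, of z] by simp
    qed
  qed (use assms bump_integrable[OF d] in auto)
  then show ?thesis using assms by simp
qed

lemma smoothing_lipschitz: "\<bar>smoothing (cbox a c) \<phi> d x - smoothing (cbox a c) \<phi> d x'\<bar> \<le> L * dist x x'"
proof -
  have "\<bar>(LINT z|lborel. \<phi> (x - z) * bump d z) - (LINT z|lborel. \<phi> (x' - z) * bump d z)\<bar>
    \<le> L * dist x x' * (LINT z|lborel. bump d (z::'a))"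
  proof (rule weighted_difference_bound)
    show "\<bar>\<phi> (x - z) - \<phi> (x' - z)\<bar> \<le> L * dist x x'" for z
      using lip[of "x - z" "x' - z"] by (simp add: dist_norm)
  qed (rule bump_product_integrable)+
  then show ?thesis using bump_integral_pos[OF d, where 'a = 'a]
    unfolding smoothing_def mollify_bump_eq by (simp add: diff_divide_distrib[symmetric] field_simps)
qed

lemma smoothing_close: "\<bar>smoothing (cbox a c) \<phi> d x - \<phi> x\<bar> \<le> \<bar>L\<bar> * d"
proof -
  have "\<bar>(LINT z|lborel. \<phi> (x - z) * bump d z) - (LINT z|lborel. \<phi> x * bump d (z::'a))\<bar>
    \<le> \<bar>L\<bar> * d * (LINT z|lborel. bump d (z::'a))"
  proof (rule weighted_difference_bound[where f = "\<lambda>z. \<phi> (x - z)" and g = "\<lambda>z. \<phi> x"])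
    fix z :: 'a assume z: "norm z < d"
    have "\<bar>\<phi> (x - z) - \<phi> x\<bar> \<le> \<bar>L\<bar> * norm z"
      using lip[of "x - z" x] mult_right_mono[OF abs_ge_self[of L] norm_ge_zero[of z]]
      by (simp add: dist_norm)
    also have "\<dots> \<le> \<bar>L\<bar> * d" using z by (intro mult_left_mono) auto
    finally show "\<bar>\<phi> (x - z) - \<phi> x\<bar> \<le> \<bar>L\<bar> * d" .
  qed (use bump_product_integrable bump_integrable[OF d] in auto)
  then show ?thesis using bump_integral_pos[OF d, where 'a = 'a]
    unfolding smoothing_def mollify_bump_eq by (simp add: field_simps)
qed

lemma smoothing_support:
  assumes "dist y x > r + d"
  shows "smoothing (cbox a c) \<phi> d x = 0"
proof -
  have "\<phi> (x - z) * bump d z = 0" for z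
  proof (cases "norm z < d")
    case True
    have "dist y x \<le> dist y (x - z) + norm z"
      using dist_triangle[of y x "x - z"] by (simp add: dist_norm)
    then have "dist y (x - z) > r" using True assms by simp
    then show ?thesis using supp by simp
  next
    case False
    then show ?thesis using bump_eq_0[OF d, of z] by simp
  qed
  then have "(\<lambda>z. \<phi> (x - z) * bump d z) = (\<lambda>z. 0)" by (rule ext)
  then show ?thesis unfolding smoothing_def mollify_bump_eq by simp
qed

lemma smoothing_test: "(\<lambda>x. complex_of_real (smoothing (cbox a c) \<phi> d x)) \<in> test_functions"
proof -
  let ?I = "LINT z|lborel. bump d (z::'a)"
  have "C_k k (\<lambda>x. inverse ?I *\<^sub>R complex_of_real (mollify (cbox a c) \<phi> (bump d) x))" for k
    using C_k_add_scaleR[OF C_k_zero mollify_C_k[OF lip_continuous bump_gen]] by simp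
  moreover have "(\<lambda>x. inverse ?I *\<^sub>R complex_of_real (mollify (cbox a c) \<phi> (bump d) x)) =
      (\<lambda>x. complex_of_real (smoothing (cbox a c) \<phi> d x))"
    unfolding smoothing_def by (auto simp: scaleR_conv_of_real divide_inverse)
  moreover have "vanishes_outside (norm y + r + d) (\<lambda>x::'a. complex_of_real (smoothing (cbox a c) \<phi> d x))"
    unfolding vanishes_outside_def
  proof (intro allI impI)
    fix x :: 'a assume "norm y + r + d < norm x"
    moreover have "norm x \<le> norm y + dist y x"
      using norm_triangle_sub[of x y] by (simp add: dist_norm norm_minus_commute)
    ultimately show "complex_of_real (smoothing (cbox a c) \<phi> d x) = 0"
      using smoothing_support[of x] by simp
  qed
  ultimately show ?thesis unfolding test_functions_iff by auto
qed

end

end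

lemma has_partial_lipschitz_bound:
  fixes f :: "'a::euclidean_space \<Rightarrow> complex"
  assumes p: "has_partial b f g" and b: "b \<in> Basis" and lip: "\<And>x z. cmod (f x - f z) \<le> L * dist x z"
  shows "cmod (g x) \<le> L"
proof -
  have "((\<lambda>t. f (x + t *\<^sub>R b)) has_vector_derivative g x) (at 0)"
    using p unfolding has_partial_def by blast
  then have "((\<lambda>t. cmod (f (x + t *\<^sub>R b) - f x - t *\<^sub>R g x) / \<bar>t\<bar>) \<longlongrightarrow> 0) (at 0)"
    unfolding has_vector_derivative_def has_derivative_at by simp
  moreover have "cmod (g x) - L \<le> cmod (f (x + t *\<^sub>R b) - f x - t *\<^sub>R g x) / \<bar>t\<bar>" if "t \<noteq> 0" for t
  proof -
    have "\<bar>t\<bar> * cmod (g x) \<le> cmod (f (x + t *\<^sub>R b) - f x) + cmod (f (x + t *\<^sub>R b) - f x - t *\<^sub>R g x)"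
      using norm_triangle_ineq4[of "f (x + t *\<^sub>R b) - f x" "f (x + t *\<^sub>R b) - f x - t *\<^sub>R g x"] by simp
    moreover have "cmod (f (x + t *\<^sub>R b) - f x) \<le> L * \<bar>t\<bar>"
      using lip[of "x + t *\<^sub>R b" x] b by (simp add: dist_norm)
    ultimately show ?thesis using that by (simp add: field_simps)
  qed
  then have "\<forall>\<^sub>F t in at 0. cmod (g x) - L \<le> cmod (f (x + t *\<^sub>R b) - f x - t *\<^sub>R g x) / \<bar>t\<bar>"
    by (auto simp: eventually_at_filter)
  ultimately have "cmod (g x) - L \<le> 0" by (rule tendsto_lowerbound) simp
  then show ?thesis by simp
qed

text \<open>
  Only the bound \<open>\<bar>\<partial>\<^sub>b \<phi>\<bar> \<le> L\<close> of the smoothed function survives in the kinetic term, so no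
  convergence of derivatives is needed.
\<close>

lemma lipschitz_form_bound:
  fixes V :: "'a::euclidean_space \<Rightarrow> real"
  assumes V: "continuous_on UNIV V"
    and form: "form_bounded V (r + 1) l y"
    and lip: "\<And>x z. \<bar>\<phi> x - \<phi> z\<bar> \<le> L * dist x z"
    and supp: "\<And>x. dist y x > r \<Longrightarrow> \<phi> x = 0"
  shows "l * (LINT x|lborel. (\<phi> x)\<^sup>2) \<le>
    real DIM('a) * L\<^sup>2 * measure lborel (cball y (r + 1)) + (LINT x|lborel. V x * (\<phi> x)\<^sup>2)"
proof -
  let ?B = "cball y (r + 1)"
  obtain a c where K: "cball y r \<subseteq> cbox a c"
    using bounded_subset_cbox_symmetric[OF bounded_cball] by metis
  \<comment> \<open>Widths of at most \<open>1\<close> keep the smoothed functions supported in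
    \<open>cball y (r + 1)\<close>, the ball for which the form bound is assumed.\<close>
  define d where "d n = inverse (real (Suc n))" for n
  have d: "0 < d n" "d n \<le> 1" for n unfolding d_def by (auto simp: inverse_le_1_iff)
  have d_lim: "d \<longlonglongrightarrow> 0" unfolding d_def by (rule LIMSEQ_inverse_real_of_nat)
  define \<psi> where "\<psi> n = smoothing (cbox a c) \<phi> (d n)" for n
  define f where "f n x = complex_of_real (\<psi> n x)" for n x
  have cphi: "continuous_on UNIV \<phi>" by (rule lip_continuous[OF lip supp K])
  have f_test: "f n \<in> test_functions" for n
    unfolding f_def[abs_def] \<psi>_def by (rule smoothing_test[OF lip supp K d(1)])
  have psi_supp: "\<psi> n x = 0" if "dist y x > r + 1" for n x
    unfolding \<psi>_def by (rule smoothing_support[OF lip supp K d(1)]) (use that d(2)[of n] in linarith)+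
  have psi_close: "\<bar>\<psi> n x - \<phi> x\<bar> \<le> \<bar>L\<bar> * d n" for n x
    unfolding \<psi>_def by (rule smoothing_close[OF lip supp K d(1)])
  have f_lip: "cmod (f n x - f n z) \<le> L * dist x z" for n x z
    unfolding f_def \<psi>_def of_real_diff[symmetric] norm_of_real
    by (rule smoothing_lipschitz[OF lip supp K d(1)])
  have f_supp: "f n x = 0" if "dist y x > r + 1" for n x
    unfolding f_def using psi_supp[OF that] by simp
  have cpsi: "continuous_on UNIV (\<psi> n)" for n
  proof -
    have "continuous_on UNIV (\<lambda>x. Re (f n x))"
      by (intro continuous_intros test_continuous f_test)
    then show ?thesis unfolding f_def by simp
  qed
  have n1: "(LINT x|lborel. (cmod (f n x))\<^sup>2) = (LINT x|lborel. (\<psi> n x)\<^sup>2)" for n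
    unfolding f_def by simp
  define P where "P n b = partial_deriv b (f n)" for n b
  have kin: "(LINT x|lborel. inner (P n b x) (P n b x))
      \<le> L\<^sup>2 * measure lborel (?B)" if b: "b \<in> Basis" for n b
  proof -
    have p: "has_partial b (f n) (P n b)" "P n b \<in> test_functions"
      unfolding P_def using test_partial[OF f_test b] by auto
    have bd: "inner (P n b x) (P n b x) \<le> indicator (?B) x * L\<^sup>2" for x
    proof (cases "x \<in> ?B")
      case True
      have "cmod (P n b x) \<le> L"
        by (rule has_partial_lipschitz_bound[OF p(1) b f_lip])
      then have "(cmod (P n b x))\<^sup>2 \<le> L\<^sup>2" by (intro power_mono) auto
      then show ?thesis using True by (simp add: power2_norm_eq_inner)
    next
      case False
      have "P n b x = 0"
      proof (rule has_partial_zero_on_open[OF p(1)])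
        show "open {x. dist y x > r + 1}" by (intro open_Collect_less continuous_intros)
      qed (use False f_supp in auto)
      then show ?thesis using False by simp
    qed
    obtain R where R: "vanishes_outside R (P n b)" using test_vanishes[OF p(2)] .
    have "(LINT x|lborel. inner (P n b x) (P n b x))
        \<le> (LINT x|lborel. indicator (?B) x * L\<^sup>2)"
      by (rule integral_mono)
         (use bd integral_inner_compact_support[OF test_continuous[OF p(2)] test_continuous[OF p(2)] R] in
            \<open>auto intro!: integrable_mult_left integrable_real_indicator emeasure_bounded_finite\<close>)
    then show ?thesis by (simp add: mult.commute)
  qed
  have step: "l * (LINT x|lborel. (\<psi> n x)\<^sup>2) \<le>
      real DIM('a) * (L\<^sup>2 * measure lborel (?B)) + (LINT x|lborel. V x * (\<psi> n x)\<^sup>2)" for n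
  proof -
    have "l * (LINT x|lborel. (\<psi> n x)\<^sup>2) \<le> (LINT x|lborel. inner (hamiltonian V (f n) x) (f n x))"
      using form f_test[of n] f_supp[of _ n] unfolding form_bounded_def n1[symmetric] by blast
    also have "\<dots> = (\<Sum>b\<in>Basis. LINT x|lborel. inner (P n b x) (P n b x)) +
        (LINT x|lborel. V x * inner (f n x) (f n x))"
      unfolding P_def by (rule hamiltonian_form[OF V f_test f_test])
    also have "(\<lambda>x. V x * inner (f n x) (f n x)) = (\<lambda>x. V x * (\<psi> n x)\<^sup>2)"
      unfolding f_def by (simp add: power2_norm_eq_inner[symmetric])
    also have "(\<Sum>b\<in>Basis. LINT x|lborel. inner (P n b x) (P n b x)) \<le>
        real DIM('a) * (L\<^sup>2 * measure lborel (?B))"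
      using sum_bounded_above[of "Basis::'a set", OF kin] by simp
    finally show ?thesis by simp
  qed
  have conv: "(\<lambda>n. LINT x|lborel. U x * (\<psi> n x)\<^sup>2) \<longlonglongrightarrow> (LINT x|lborel. U x * (\<phi> x)\<^sup>2)"
    if U: "continuous_on UNIV U" for U
  proof (rule integral_dominated_convergence[where w = "\<lambda>x. indicator (?B) x *\<^sub>R (\<bar>U x\<bar> * (\<bar>\<phi> x\<bar> + \<bar>L\<bar>)\<^sup>2)"])
    show "(\<lambda>x. U x * (\<phi> x)\<^sup>2) \<in> borel_measurable lborel"
      by (simp, intro borel_measurable_continuous_onI continuous_intros U cphi)
    show "(\<lambda>x. U x * (\<psi> n x)\<^sup>2) \<in> borel_measurable lborel" for n
      by (simp, intro borel_measurable_continuous_onI continuous_intros U cpsi)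
    show "integrable lborel (\<lambda>x. indicator (?B) x *\<^sub>R (\<bar>U x\<bar> * (\<bar>\<phi> x\<bar> + \<bar>L\<bar>)\<^sup>2))"
      by (rule borel_integrable_compact)
         (auto intro!: continuous_intros continuous_on_subset[OF U] continuous_on_subset[OF cphi])
    show "AE x in lborel. (\<lambda>n. U x * (\<psi> n x)\<^sup>2) \<longlonglongrightarrow> U x * (\<phi> x)\<^sup>2"
    proof (rule AE_I2)
      fix x
      have "(\<lambda>n. \<psi> n x - \<phi> x) \<longlonglongrightarrow> 0"
        by (rule Lim_null_comparison[of _ "\<lambda>n. \<bar>L\<bar> * d n"])
           (use psi_close tendsto_mult_right_zero[OF d_lim] in auto)
      then have "(\<lambda>n. \<psi> n x) \<longlonglongrightarrow> \<phi> x" by (simp add: LIM_zero_iff)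
      then show "(\<lambda>n. U x * (\<psi> n x)\<^sup>2) \<longlonglongrightarrow> U x * (\<phi> x)\<^sup>2" by (intro tendsto_intros)
    qed
    show "AE x in lborel. norm (U x * (\<psi> n x)\<^sup>2) \<le> indicator (?B) x *\<^sub>R (\<bar>U x\<bar> * (\<bar>\<phi> x\<bar> + \<bar>L\<bar>)\<^sup>2)" for n
    proof (rule AE_I2)
      fix x
      have "\<bar>\<psi> n x\<bar> \<le> \<bar>\<phi> x\<bar> + \<bar>L\<bar>"
        using psi_close[of n x] mult_left_mono[OF d(2)[of n], of "\<bar>L\<bar>"] by simp
      then have "(\<psi> n x)\<^sup>2 \<le> (\<bar>\<phi> x\<bar> + \<bar>L\<bar>)\<^sup>2"
        using power_mono[of "\<bar>\<psi> n x\<bar>" _ 2] by simp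
      then show "norm (U x * (\<psi> n x)\<^sup>2) \<le> indicator (?B) x *\<^sub>R (\<bar>U x\<bar> * (\<bar>\<phi> x\<bar> + \<bar>L\<bar>)\<^sup>2)"
        using psi_supp[of x n] by (cases "x \<in> ?B") (auto simp: abs_mult mult_left_mono)
    qed
  qed
  have "(\<lambda>n. l * (LINT x|lborel. (\<psi> n x)\<^sup>2)) \<longlonglongrightarrow> l * (LINT x|lborel. (\<phi> x)\<^sup>2)"
    using tendsto_mult_left[OF conv[of "\<lambda>x. 1"], of l] by simp
  moreover have "(\<lambda>n. real DIM('a) * (L\<^sup>2 * measure lborel (?B)) + (LINT x|lborel. V x * (\<psi> n x)\<^sup>2))
      \<longlonglongrightarrow> real DIM('a) * (L\<^sup>2 * measure lborel (?B)) + (LINT x|lborel. V x * (\<phi> x)\<^sup>2)"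
    by (intro tendsto_add tendsto_const conv V)
  ultimately show ?thesis using step LIMSEQ_le[of _ _ _ "_ + _"] by (fastforce simp: mult.assoc)
qed

section \<open>Averages of radial integrals\<close>

text \<open>The case distinction inside an integral over the whole space makes the integrand jointly
  measurable in the point and the radius, ready for Fubini.\<close>

definition radial_integral :: "('a::euclidean_space \<Rightarrow> real) \<Rightarrow> 'a \<Rightarrow> real \<Rightarrow> real" where
  "radial_integral U y t = (LINT x|lborel. (if dist y x < t then U x else 0))"

lemma radial_integral_measurable:
  fixes U :: "'a::euclidean_space \<Rightarrow> real"
  assumes [measurable]: "U \<in> borel_measurable borel"
  shows "radial_integral U y \<in> borel_measurable borel"
  unfolding radial_integral_def[abs_def] by measurable

text \<open>Fubini for the kernel equal to \<open>U x\<close> where \<open>dist y x < g p\<close>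
  and zero elsewhere. Averaging ball integrals over random radii \<open>g p\<close> integrates
  \<open>U\<close> against the tail probability of the radius.\<close>

lemma layer_cake:
  fixes U :: "'a::euclidean_space \<Rightarrow> real" and N :: "'p measure"
  assumes N: "finite_measure N" and g[measurable]: "g \<in> borel_measurable N"
    and U: "integrable lborel U"
  shows "integrable N (\<lambda>p. radial_integral U y (g p))" (is ?i)
    and "(LINT p|N. radial_integral U y (g p)) =
      (LINT x|lborel. U x * measure N {p\<in>space N. dist y x < g p})" (is ?e)
    and "integrable lborel (\<lambda>x. U x * measure N {p\<in>space N. dist y x < g p})" (is ?j)
proof -
  interpret N: finite_measure N by (rule N)
  interpret pair_sigma_finite lborel N
    by unfold_locales
  have [measurable]: "U \<in> borel_measurable borel" using U by auto
  define k where "k x p = (if dist y x < g p then U x else 0)" for x p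
  have k_meas: "case_prod k \<in> borel_measurable (lborel \<Otimes>\<^sub>M N)"
    unfolding k_def by measurable
  have "integrable (lborel \<Otimes>\<^sub>M N) (\<lambda>(x, p). U x)"
  proof (rule Fubini_integrable)
    show "(\<lambda>(x, p). U x) \<in> borel_measurable (lborel \<Otimes>\<^sub>M N)" by measurable
    show "integrable lborel (\<lambda>x. LINT p|N. norm (case (x, p) of (x, p) \<Rightarrow> U x))"
      using U by simp
  qed simp
  then have k_int: "integrable (lborel \<Otimes>\<^sub>M N) (case_prod k)"
    by (rule Bochner_Integration.integrable_bound[OF _ k_meas]) (auto simp: k_def)
  have slice: "(LINT p|N. k x p) = U x * measure N {p\<in>space N. dist y x < g p}" for x
  proof -
    have [measurable]: "{p\<in>space N. dist y x < g p} \<in> sets N" by measurable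
    have "(LINT p|N. k x p) = (LINT p|N. U x * indicator {p\<in>space N. dist y x < g p} p)"
      by (intro Bochner_Integration.integral_cong) (auto simp: k_def)
    then show ?thesis by simp
  qed
  show ?i using integrable_snd[OF k_int] unfolding k_def radial_integral_def .
  show ?e using Fubini_integral[OF k_int] unfolding slice unfolding k_def radial_integral_def .
  show ?j using integrable_fst[OF k_int] unfolding slice .
qed

section \<open>Uniformly distributed radii\<close>

lemma measure_interval_le:
  fixes T :: "real set"
  assumes "T \<in> sets borel" "emeasure lborel T \<noteq> \<infinity>" "s \<le> t"
  shows "measure lborel (T \<inter> {s<..t}) \<le> t - s"
proof -
  have "measure lborel (T \<inter> {s<..t}) \<le> measure lborel {s<..t}"
    by (rule measure_mono_fmeasurable) (use assms in \<open>auto simp: fmeasurable_def\<close>)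
  then show ?thesis using assms by simp
qed

text \<open>The probability that a uniformly distributed point of \<open>T\<close> exceeds
  \<open>t\<close>. As a function of \<open>t\<close> it decreases only across \<open>T\<close>, at
  rate at most one over the measure of \<open>T\<close>.\<close>

definition tail :: "real set \<Rightarrow> real \<Rightarrow> real" where
  "tail T t = measure lborel (T \<inter> {t<..}) / measure lborel T"

definition unif :: "real set \<Rightarrow> real measure" where
  "unif T = uniform_measure lborel T"

definition unif2 :: "real set \<Rightarrow> (real \<times> real) measure" where
  "unif2 T = unif T \<Otimes>\<^sub>M unif T"

lemma tail_nonneg: "0 \<le> tail T t"
  unfolding tail_def by simp

lemma tail_eq_0:
  assumes "T \<subseteq> {..t}"
  shows "tail T t = 0"
proof -
  have "T \<inter> {t<..} = {}" using assms by auto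
  then show ?thesis unfolding tail_def by simp
qed

context
  fixes T :: "real set"
  assumes T[measurable]: "T \<in> sets borel" and T_fin: "emeasure lborel T \<noteq> \<infinity>"
    and T_pos: "measure lborel T > 0"
begin

lemma tail_le_1: "tail T t \<le> 1"
  unfolding tail_def using T_pos T_fin
  by (auto simp: divide_le_eq intro!: measure_mono_fmeasurable simp: fmeasurable_def top.not_eq_extremum)

lemma tail_increment:
  assumes "s \<le> t"
  shows "tail T s - tail T t = measure lborel (T \<inter> {s<..t}) / measure lborel T"
proof -
  have "T \<inter> {s<..} = (T \<inter> {s<..t}) \<union> (T \<inter> {t<..})" using assms by auto
  moreover have "measure lborel ((T \<inter> {s<..t}) \<union> (T \<inter> {t<..})) =
      measure lborel (T \<inter> {s<..t}) + measure lborel (T \<inter> {t<..})"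
  proof (rule measure_Union)
    have "emeasure lborel (T \<inter> X) \<noteq> \<infinity>" for X
      using emeasure_mono[of "T \<inter> X" T lborel] T_fin by (auto simp: top_unique)
    then show "emeasure lborel (T \<inter> {s<..t}) \<noteq> \<infinity>" "emeasure lborel (T \<inter> {t<..}) \<noteq> \<infinity>"
      by blast+
  qed auto
  ultimately show ?thesis unfolding tail_def by (simp add: diff_divide_distrib[symmetric])
qed

lemma tail_lipschitz:
  assumes k: "\<kappa> > 0" "\<kappa> \<le> measure lborel T"
  shows "\<bar>tail T s - tail T t\<bar> \<le> 1 / \<kappa> * \<bar>s - t\<bar>"
proof -
  have *: "\<bar>tail T s - tail T t\<bar> \<le> 1 / \<kappa> * \<bar>s - t\<bar>" if "s \<le> t" for s t
  proof -
    have "\<bar>tail T s - tail T t\<bar> = measure lborel (T \<inter> {s<..t}) / measure lborel T"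
      using tail_increment[OF that] by simp
    also have "\<dots> \<le> (t - s) / \<kappa>"
      using measure_interval_le[OF T T_fin that] k that by (intro frac_le) auto
    finally show ?thesis using that by simp
  qed
  show ?thesis using *[of s t] *[of t s] by (cases "s \<le> t") (auto simp: abs_minus_commute)
qed

lemma tail_eq_1: "T \<subseteq> {t<..} \<Longrightarrow> tail T t = 1"
  unfolding tail_def using T_pos by (simp add: Int_absorb2)

lemma tail_ge:
  assumes "T \<subseteq> {0<..}" "t \<ge> 0"
  shows "1 - t / measure lborel T \<le> tail T t"
  using tail_increment[of 0 t] measure_interval_le[OF T T_fin assms(2)] tail_eq_1[OF assms(1)] assms(2) T_pos
  by (simp add: field_simps)

lemma unif_prob: "finite_measure (unif T)" "measure (unif T) (space (unif T)) = 1"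
  "sets (unif T) = sets borel" "space (unif T) = UNIV"
  and unif_measure: "B \<in> sets borel \<Longrightarrow> measure (unif T) B = measure lborel (T \<inter> B) / measure lborel T"
  and unif_AE: "AE x in (unif T). x \<in> T"
proof -
  have n0: "emeasure lborel T \<noteq> 0" using T_pos by (auto simp: measure_def)
  show s: "sets (unif T) = sets borel" "space (unif T) = UNIV" unfolding unif_def by auto
  show m: "measure (unif T) B = measure lborel (T \<inter> B) / measure lborel T" if "B \<in> sets borel" for B
    unfolding unif_def using measure_uniform_measure[OF n0 T_fin] that by simp
  have "emeasure (unif T) UNIV = emeasure lborel T / emeasure lborel T"
    unfolding unif_def using emeasure_uniform_measure[of T lborel UNIV] n0 T_fin by simp
  also have "\<dots> = 1" using n0 T_fin by (simp add: ennreal_divide_self less_top)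
  finally have "emeasure (unif T) UNIV = 1" .
  then show "finite_measure (unif T)" "measure (unif T) (space (unif T)) = 1"
    by (auto intro!: finite_measureI simp: s measure_def)
  show "AE x in (unif T). x \<in> T" unfolding unif_def by (rule AE_uniform_measureI) auto
qed

lemma unif2_finite: "finite_measure (unif2 T)"
  unfolding unif2_def by (intro finite_measure_pair_measure unif_prob)

lemma sets_unif2: "sets (unif2 T) = sets (borel \<Otimes>\<^sub>M borel)"
  unfolding unif2_def using unif_prob(3) by (intro sets_pair_measure_cong)

lemma space_unif2: "space (unif2 T) = UNIV"
  unfolding unif2_def by (simp add: space_pair_measure unif_prob)

lemma unif2_times:
  assumes "B \<in> sets borel" "C \<in> sets borel"
  shows "measure (unif2 T) (B \<times> C) = measure (unif T) B * measure (unif T) C"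
proof -
  interpret U: finite_measure "unif T" by (rule unif_prob)
  show ?thesis unfolding unif2_def measure_def
    using assms by (simp add: U.emeasure_pair_measure_Times unif_prob enn2real_mult)
qed

text \<open>The minimum of two independent points exceeds \<open>t\<close> exactly when both do,
  whence the square.\<close>

lemma unif2_tail: "measure (unif2 T) {p\<in>space (unif2 T). t < min (fst p) (snd p)} = (tail T t)\<^sup>2"
proof -
  have "{p\<in>space (unif2 T). t < min (fst p) (snd p)} = {t<..} \<times> {t<..}"
    unfolding space_unif2 by auto
  then show ?thesis by (simp add: unif2_times unif_measure tail_def power2_eq_square)
qed

text \<open>The maximum fails to exceed \<open>t\<close> exactly when both points fail. This is the
  weight that matches the rising part of a shell profile.\<close>

lemma unif2_head: "measure (unif2 T) {p\<in>space (unif2 T). t < max (fst p) (snd p)} = 1 - (1 - tail T t)\<^sup>2"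
proof -
  interpret N: finite_measure "unif2 T" by (rule unif2_finite)
  have e: "{p\<in>space (unif2 T). t < max (fst p) (snd p)} = space (unif2 T) - {..t} \<times> {..t}"
    unfolding space_unif2 by auto
  have s: "measure (unif2 T) (space (unif2 T)) = 1"
    using unif2_times[of UNIV UNIV] unif_prob by (simp add: space_unif2)
  have h: "measure (unif T) {..t} = 1 - tail T t"
  proof -
    interpret U: finite_measure "unif T" by (rule unif_prob)
    have "measure (unif T) (space (unif T) - {t<..}) = measure (unif T) (space (unif T)) - measure (unif T) {t<..}"
      by (rule U.finite_measure_compl) (simp add: unif_prob)
    moreover have "space (unif T) - {t<..} = {..t}" by (auto simp: unif_prob)
    ultimately show ?thesis using unif_prob(2) by (simp add: unif_measure tail_def)
  qed
  have "{..t} \<times> {..t} \<in> sets (unif2 T)" unfolding sets_unif2 by (intro pair_measureI) auto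
  then have "measure (unif2 T) (space (unif2 T) - {..t} \<times> {..t}) = 1 - measure (unif2 T) ({..t} \<times> {..t})"
    using N.finite_measure_compl s by simp
  then show ?thesis unfolding e by (simp add: unif2_times h power2_eq_square)
qed

text \<open>The minimum or maximum of two points of \<open>T\<close> is one of these points, so a
  bound valid on \<open>T\<close> survives.\<close>

lemma unif2_AE:
  assumes F: "F \<in> borel_measurable borel" and P: "\<And>u. u \<in> T \<Longrightarrow> F u \<le> (A::real)"
    and g: "g \<in> {min, max :: real \<Rightarrow> real \<Rightarrow> real}"
  shows "AE p in (unif2 T). F (g (fst p) (snd p)) \<le> A"
proof -
  note [measurable] = F
  interpret U: finite_measure "unif T" by (rule unif_prob)
  interpret pair_sigma_finite "unif T" "unif T" by unfold_locales
  have [measurable_cong]: "sets (unif T) = sets borel" by (rule unif_prob)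
  have gm [measurable]: "(\<lambda>p. g (fst p) (snd p)) \<in> borel_measurable ((unif T) \<Otimes>\<^sub>M (unif T))"
    using g by auto
  show ?thesis unfolding unif2_def
  proof (rule AE_pair_measure)
    show "{x \<in> space ((unif T) \<Otimes>\<^sub>M (unif T)). F (g (fst x) (snd x)) \<le> A} \<in> sets ((unif T) \<Otimes>\<^sub>M (unif T))"
      by measurable
    show "AE x in (unif T). AE y in (unif T). F (g (fst (x, y)) (snd (x, y))) \<le> A"
      using unif_AE
    proof eventually_elim
      fix x assume x: "x \<in> T"
      show "AE y in (unif T). F (g (fst (x, y)) (snd (x, y))) \<le> A"
        using unif_AE by eventually_elim (use x g P in \<open>auto simp: min_def max_def\<close>)
    qed
  qed
qed

lemma unif2_average_le:
  assumes F: "F \<in> borel_measurable borel" and P: "\<And>u. u \<in> T \<Longrightarrow> F u \<le> (A::real)"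
    and g: "g \<in> {min, max :: real \<Rightarrow> real \<Rightarrow> real}"
    and int: "integrable (unif2 T) (\<lambda>p. F (g (fst p) (snd p)))"
  shows "(LINT p|(unif2 T). F (g (fst p) (snd p))) \<le> A"
proof -
  interpret N: finite_measure "unif2 T" by (rule unif2_finite)
  have "(LINT p|(unif2 T). F (g (fst p) (snd p))) \<le> (LINT p|(unif2 T). A)"
    by (rule integral_mono_AE[OF int _ unif2_AE[OF F P g]]) auto
  also have "\<dots> = A"
    using unif2_times[of UNIV UNIV] unif_prob by (simp add: space_unif2)
  finally show ?thesis .
qed

lemma unif2_measurable: "g \<in> {min, max :: real \<Rightarrow> real \<Rightarrow> real} \<Longrightarrow>
    (\<lambda>p. g (fst p) (snd p)) \<in> borel_measurable (unif2 T)"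
proof -
  have [measurable_cong]: "sets (unif2 T) = sets (borel \<Otimes>\<^sub>M borel)" by (rule sets_unif2)
  show "g \<in> {min, max} \<Longrightarrow> ?thesis" by auto
qed

context
  fixes U :: "'a::euclidean_space \<Rightarrow> real"
  assumes U: "integrable lborel U"
begin

lemma tail_average_le:
  assumes "\<And>t. t \<in> T \<Longrightarrow> radial_integral U y t \<le> A"
  shows "(LINT x|lborel. U x * (tail T (dist y x))\<^sup>2) \<le> A"
    and "integrable lborel (\<lambda>x. U x * (tail T (dist y x))\<^sup>2)"
proof -
  have m: "(\<lambda>p. min (fst p) (snd p)) \<in> borel_measurable (unif2 T)" by (rule unif2_measurable) simp
  have r: "radial_integral U y \<in> borel_measurable borel"
    by (rule radial_integral_measurable) (use U in auto)
  note lc = layer_cake[OF unif2_finite m U, of y, unfolded unif2_tail]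
  show "integrable lborel (\<lambda>x. U x * (tail T (dist y x))\<^sup>2)" by (rule lc(3))
  show "(LINT x|lborel. U x * (tail T (dist y x))\<^sup>2) \<le> A"
    unfolding lc(2)[symmetric]
    by (rule unif2_average_le[OF r assms, of min]) (use lc(1) in auto)
qed

lemma head_average_ge:
  assumes "\<And>t. t \<in> T \<Longrightarrow> A \<le> radial_integral U y t"
  shows "A \<le> (LINT x|lborel. U x * (1 - (1 - tail T (dist y x))\<^sup>2))"
    and "integrable lborel (\<lambda>x. U x * (1 - (1 - tail T (dist y x))\<^sup>2))"
proof -
  have m: "(\<lambda>p. max (fst p) (snd p)) \<in> borel_measurable (unif2 T)" by (rule unif2_measurable) simp
  have r: "radial_integral U y \<in> borel_measurable borel"
    by (rule radial_integral_measurable) (use U in auto)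
  note lc = layer_cake[OF unif2_finite m U, of y, unfolded unif2_head]
  show "integrable lborel (\<lambda>x. U x * (1 - (1 - tail T (dist y x))\<^sup>2))" by (rule lc(3))
  have "(LINT p|(unif2 T). - radial_integral U y (max (fst p) (snd p))) \<le> - A"
    by (rule unif2_average_le[of "\<lambda>t. - radial_integral U y t" _ max]) (use lc(1) r assms in auto)
  then show "A \<le> (LINT x|lborel. U x * (1 - (1 - tail T (dist y x))\<^sup>2))"
    unfolding lc(2)[symmetric] by simp
qed

end

end

text \<open>An approximate quantile, taken just below the supremum of the levels \<open>c\<close>
  whose upper level set has measure at least \<open>\<kappa>\<close>. The slack \<open>1\<close>
  avoids the question whether the supremum is attained; it is paid for later by \<open>A + 1\<close>
  in place of \<open>A\<close>.\<close>

lemma quantile: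
  fixes f :: "real \<Rightarrow> real"
  assumes S[measurable]: "S \<in> sets borel" and S_fin: "emeasure lborel S \<noteq> \<infinity>"
    and f[measurable]: "f \<in> borel_measurable borel"
    and bd: "\<And>s. s \<in> S \<Longrightarrow> \<bar>f s\<bar> \<le> B" and k: "0 < \<kappa>" "\<kappa> \<le> measure lborel S"
  shows "\<exists>c. \<kappa> \<le> measure lborel {s\<in>S. c \<le> f s} \<and> measure lborel {s\<in>S. c + 1 \<le> f s} \<le> \<kappa>"
proof -
  have fin: "{s\<in>S. c \<le> f s} \<in> fmeasurable lborel" for c
  proof (rule fmeasurableI2)
    show "S \<in> fmeasurable lborel" using S_fin by (simp add: fmeasurable_def top.not_eq_extremum)
    have "{s\<in>S. c \<le> f s} \<in> sets borel" by measurable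
    then show "{s\<in>S. c \<le> f s} \<in> sets lborel" by simp
  qed auto
  define C where "C = {c. \<kappa> \<le> measure lborel {s\<in>S. c \<le> f s}}"
  have down: "c \<in> C" if "c' \<in> C" "c \<le> c'" for c c'
  proof -
    have "measure lborel {s\<in>S. c' \<le> f s} \<le> measure lborel {s\<in>S. c \<le> f s}"
      by (rule measure_mono_fmeasurable) (use that fin in auto)
    then show ?thesis using that unfolding C_def by auto
  qed
  have "{s\<in>S. - B \<le> f s} = S" using bd by (auto simp: abs_le_iff) (metis minus_le_iff)
  then have C0: "- B \<in> C" unfolding C_def using k by simp
  have C_bdd: "bdd_above C"
  proof (rule bdd_aboveI[of _ B])
    fix c assume c: "c \<in> C"
    show "c \<le> B"
    proof (rule ccontr)
      assume "\<not> c \<le> B"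
      then have "{s\<in>S. c \<le> f s} = {}" using bd by (auto simp: abs_le_iff) (meson order_trans)
      then have "measure lborel {s\<in>S. c \<le> f s} = 0" by (simp only: measure_empty)
      then show False using c k unfolding C_def by simp
    qed
  qed
  obtain c where "c \<in> C" "Sup C - 1 / 2 < c" using less_cSupD[of C "Sup C - 1 / 2"] C0 by auto
  moreover have "c + 1 \<notin> C" using cSup_upper[OF _ C_bdd, of "c + 1"] calculation(2) by auto
  ultimately show ?thesis unfolding C_def by auto
qed

section \<open>Radial test functions\<close>

lemma locally_Holder_imp_continuous:
  fixes V :: "'a::euclidean_space \<Rightarrow> real"
  assumes "locally_Holder_continuous V"
  shows "continuous_on UNIV V"
  unfolding continuous_on_eq_continuous_at[OF open_UNIV]
proof
  fix x :: 'a
  obtain \<alpha> C where C: "0 < \<alpha>" "\<And>z w. z \<in> cball x 1 \<Longrightarrow> w \<in> cball x 1 \<Longrightarrow> \<bar>V z - V w\<bar> \<le> C * dist z w powr \<alpha>"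
    using assms compact_cball[of x 1] unfolding locally_Holder_continuous_def by metis
  have "((\<lambda>z. V z - V x) \<longlongrightarrow> 0) (at x)"
  proof (rule Lim_null_comparison)
    have "\<forall>\<^sub>F z in at x. z \<in> cball x 1"
      by (rule eventually_at_in_open'[of "ball x 1", THEN eventually_mono]) auto
    then show "\<forall>\<^sub>F z in at x. norm (V z - V x) \<le> C * dist z x powr \<alpha>"
      by eventually_elim (use C(2) in auto)
    have "((\<lambda>z. dist z x powr \<alpha>) \<longlongrightarrow> 0) (at x)"
      by (rule tendsto_zero_powrI[where b = \<alpha>]) (use C(1) in \<open>auto intro: tendsto_dist_iff[THEN iffD1] tendsto_ident_at\<close>)
    then show "((\<lambda>z. C * dist z x powr \<alpha>) \<longlongrightarrow> 0) (at x)" by (rule tendsto_mult_right_zero)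
  qed
  then show "isCont V x" unfolding isCont_def by (simp add: LIM_zero_iff)
qed

lemma AE_not_sphere: "AE x in lborel. dist (y::'a::euclidean_space) x \<noteq> s"
proof (cases "s \<ge> 0")
  case True
  have "emeasure lborel (cball y s - ball y s) = emeasure lborel (cball y s) - emeasure lborel (ball y s)"
    by (rule emeasure_Diff) (use True in \<open>auto simp: emeasure_ball\<close>)
  then have "emeasure lborel (cball y s - ball y s) = 0"
    using True by (simp add: emeasure_ball emeasure_cball)
  then have "cball y s - ball y s \<in> null_sets lborel" by (simp add: null_sets_def)
  from AE_not_in[OF this] show ?thesis by eventually_elim auto
next
  case False
  then have "dist y x \<noteq> s" for x using zero_le_dist[of y x] by linarith
  then show ?thesis by simp
qed

text \<open>\<open>V\<close> is only locally integrable, while averaging requires an integrable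
  function. Nothing is lost for radii up to \<open>r\<close> or for profiles that vanish beyond
  \<open>r\<close>.\<close>

definition cutoff :: "('a::euclidean_space \<Rightarrow> real) \<Rightarrow> real \<Rightarrow> 'a \<Rightarrow> 'a \<Rightarrow> real" where
  "cutoff V r y x = indicator (cball y r) x *\<^sub>R V x"

text \<open>Bounds the kinetic energy of a profile with Lipschitz constant \<open>1\<close>: each of
  the \<open>DIM('a)\<close> partial derivatives is at most \<open>1\<close> and lives on a ball of
  radius \<open>r + 1\<close>. The value does not depend on the centre.\<close>

definition kinetic_const :: "'a::euclidean_space itself \<Rightarrow> real \<Rightarrow> real" where
  "kinetic_const _ r = real DIM('a) * measure lborel (cball (0::'a) (r + 1))"

context
  fixes V :: "'a::euclidean_space \<Rightarrow> real" and r :: real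
  assumes V: "continuous_on UNIV V" and r: "r > 0"
begin

lemma V_set_integrable: "set_integrable lborel (cball y s) V"
  unfolding set_integrable_def
  by (rule borel_integrable_compact) (auto intro: continuous_on_subset[OF V])

lemma V_measurable: "V \<in> borel_measurable borel"
  by (rule borel_measurable_continuous_onI[OF V])

text \<open>Spheres are null sets, so subtracting the integral over the open ball amounts to
  removing the closed one.\<close>

lemma shell_integral_eq:
  assumes "s < t"
  shows "shell_integral V y s t = (LINT x:(ball y t - cball y s)|lborel. V x)"
proof -
  have i: "set_integrable lborel (ball y t) V" for t
    by (rule set_integrable_subset[OF V_set_integrable[of y t]]) auto
  have "ball_integral V y s = (LINT x:cball y s|lborel. V x)"
    unfolding ball_integral_def set_lebesgue_integral_def
  proof (rule integral_cong_AE)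
    show "AE x in lborel. indicat_real (ball y s) x *\<^sub>R V x = indicat_real (cball y s) x *\<^sub>R V x"
      using AE_not_sphere[of y s] by eventually_elim (auto simp: indicator_def)
  qed (use V_measurable in \<open>auto intro!: borel_measurable_times borel_measurable_indicator\<close>)
  moreover have "(LINT x:(ball y t - cball y s)|lborel. V x) =
      (LINT x:ball y t|lborel. V x) - (LINT x:cball y s|lborel. V x)"
  proof -
    have "ball y t = (ball y t - cball y s) \<union> cball y s" using assms by (auto simp: subset_iff)
    then have "(LINT x:ball y t|lborel. V x) = (LINT x:((ball y t - cball y s) \<union> cball y s)|lborel. V x)"
      by simp
    also have "\<dots> = (LINT x:(ball y t - cball y s)|lborel. V x) + (LINT x:cball y s|lborel. V x)"
      by (rule set_integral_Un) (auto intro: V_set_integrable set_integrable_subset[OF i[of t]])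
    finally show ?thesis by simp
  qed
  ultimately show ?thesis unfolding shell_integral_def ball_integral_def by simp
qed

lemma cutoff_integrable: "integrable lborel (cutoff V r y)"
  using V_set_integrable[of y r] unfolding set_integrable_def cutoff_def[abs_def] .

lemma radial_cutoff:
  assumes "t \<le> r"
  shows "radial_integral (cutoff V r y) y t = ball_integral V y t"
  unfolding radial_integral_def ball_integral_def set_lebesgue_integral_def cutoff_def
  by (intro Bochner_Integration.integral_cong) (use assms in \<open>auto simp: indicator_def\<close>)

lemma radial_cutoff_measurable: "radial_integral (cutoff V r y) y \<in> borel_measurable borel"
  by (rule radial_integral_measurable) (use cutoff_integrable[of y] in auto)

lemma radial_cutoff_bounded: "\<bar>radial_integral (cutoff V r y) y t\<bar> \<le> (LINT x|lborel. \<bar>cutoff V r y x\<bar>)"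
proof -
  have "\<bar>radial_integral (cutoff V r y) y t\<bar> \<le> (LINT x|lborel. \<bar>if dist y x < t then cutoff V r y x else 0\<bar>)"
    unfolding radial_integral_def by (rule integral_abs_bound)
  also have "\<dots> \<le> (LINT x|lborel. \<bar>cutoff V r y x\<bar>)"
  proof (rule integral_mono)
    show "integrable lborel (\<lambda>x. \<bar>if dist y x < t then cutoff V r y x else 0\<bar>)"
      by (rule Bochner_Integration.integrable_bound[OF cutoff_integrable[of y]])
         (use borel_measurable_integrable[OF cutoff_integrable[of y]] in \<open>auto, measurable\<close>)
  qed (use cutoff_integrable[of y] in auto)
  finally show ?thesis .
qed

section \<open>Energy estimates for radial profiles\<close>

lemma radial_form_bound:
  assumes fb: "form_bounded V (r + 1) l y"
    and lip: "\<And>s t. 0 \<le> s \<Longrightarrow> 0 \<le> t \<Longrightarrow> \<bar>\<psi> s - \<psi> t\<bar> \<le> L * \<bar>s - t\<bar>" and L: "L \<ge> 0"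
    and supp: "\<And>t. t > r \<Longrightarrow> \<psi> t = 0"
  shows "l * (LINT x|lborel. (\<psi> (dist y x))\<^sup>2) \<le>
    L\<^sup>2 * kinetic_const TYPE('a) r + (LINT x|lborel. cutoff V r y x * (\<psi> (dist y x))\<^sup>2)"
proof -
  have "l * (LINT x|lborel. (\<psi> (dist y x))\<^sup>2) \<le>
    real DIM('a) * L\<^sup>2 * measure lborel (cball y (r + 1)) + (LINT x|lborel. V x * (\<psi> (dist y x))\<^sup>2)"
  proof (rule lipschitz_form_bound[OF V fb])
    fix x z
    have "\<bar>\<psi> (dist y x) - \<psi> (dist y z)\<bar> \<le> L * \<bar>dist y x - dist y z\<bar>" by (rule lip) auto
    also have "\<dots> \<le> L * dist x z"
      using abs_dist_diff_le[of x y z] L by (intro mult_left_mono) (auto simp: dist_commute)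
    finally show "\<bar>\<psi> (dist y x) - \<psi> (dist y z)\<bar> \<le> L * dist x z" .
  qed (use supp in auto)
  also have "(\<lambda>x. V x * (\<psi> (dist y x))\<^sup>2) = (\<lambda>x. cutoff V r y x * (\<psi> (dist y x))\<^sup>2)"
  proof
    fix x
    show "V x * (\<psi> (dist y x))\<^sup>2 = cutoff V r y x * (\<psi> (dist y x))\<^sup>2"
      unfolding cutoff_def using supp[of "dist y x"] by (cases "dist y x \<le> r") auto
  qed
  also have "measure lborel (cball y (r + 1)) = measure lborel (cball (0::'a) (r + 1))"
    using r by (simp add: content_cball)
  finally show ?thesis unfolding kinetic_const_def by (simp add: mult_ac)
qed

lemma compact_radial_integrable:
  assumes "\<And>s t. 0 \<le> s \<Longrightarrow> 0 \<le> t \<Longrightarrow> \<bar>\<psi> s - \<psi> t\<bar> \<le> L * \<bar>s - t\<bar>" and L: "L \<ge> 0"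
    and "\<And>t. t > r \<Longrightarrow> \<psi> t = 0"
  shows "integrable lborel (\<lambda>x::'a. (\<psi> (dist y x))\<^sup>2)"
proof -
  have "L-lipschitz_on {0..} \<psi>"
    by (rule lipschitz_onI) (use assms in \<open>auto simp: dist_real_def\<close>)
  then have c: "continuous_on {0..} \<psi>" by (rule lipschitz_on_continuous_on)
  have "continuous_on UNIV (\<lambda>x::'a. (\<psi> (dist y x))\<^sup>2)"
    by (intro continuous_intros continuous_on_compose2[OF c]) auto
  moreover have "vanishes_outside (norm y + r) (\<lambda>x::'a. (\<psi> (dist y x))\<^sup>2)"
    unfolding vanishes_outside_def
  proof (intro allI impI)
    fix x :: 'a assume "norm y + r < norm x"
    then have "dist y x > r" using norm_triangle_sub[of x y] by (simp add: dist_norm norm_minus_commute)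
    then show "(\<psi> (dist y x))\<^sup>2 = 0" using assms by simp
  qed
  ultimately show ?thesis by (rule compact_support_integrable)
qed

text \<open>The profile is \<open>tail T\<close>, with Lipschitz constant
  \<open>1 / \<epsilon>\<close>. It is at least \<open>1/2\<close> on the ball of radius
  \<open>\<epsilon> / 2\<close>, which bounds its norm from below independently of \<open>T\<close>
  and \<open>y\<close>; its potential energy is an average of ball integrals over radii in
  \<open>T\<close>.\<close>

lemma small_ball_estimate:
  assumes fb: "form_bounded V (r + 1) l y" and l: "l \<ge> 0" and e: "\<epsilon> > 0"
    and T[measurable]: "T \<in> sets borel" and T_sub: "T \<subseteq> {0<..<r}" and T_meas: "\<epsilon> \<le> measure lborel T"
    and T_le: "\<And>t. t \<in> T \<Longrightarrow> ball_integral V y t \<le> A"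
  shows "l * (1 / 4 * measure lborel (ball (0::'a) (\<epsilon> / 2))) \<le> (1 / \<epsilon>)\<^sup>2 * kinetic_const TYPE('a) r + A"
proof -
  have "bounded T" by (rule bounded_subset[OF bounded_closed_interval[of 0 r]]) (use T_sub in auto)
  from emeasure_bounded_finite[OF this] have T_fin: "emeasure lborel T \<noteq> \<infinity>" by simp
  have T_pos: "measure lborel T > 0" using e T_meas by simp
  note lip = tail_lipschitz[OF T T_fin T_pos e T_meas]
  have supp: "tail T t = 0" if "t > r" for t
    by (rule tail_eq_0) (use T_sub that in force)
  have int: "integrable lborel (\<lambda>x. (tail T (dist y x))\<^sup>2)"
    by (rule compact_radial_integrable[of _ "1 / \<epsilon>"]) (use lip supp e in auto)
  have "1 / 4 * measure lborel (ball y (\<epsilon> / 2)) = (LINT x|lborel. 1 / 4 * indicator (ball y (\<epsilon> / 2)) x)"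
    by simp
  also have "\<dots> \<le> (LINT x|lborel. (tail T (dist y x))\<^sup>2)"
  proof (rule integral_mono[OF _ int])
    show "integrable lborel (\<lambda>x. 1 / 4 * indicat_real (ball y (\<epsilon> / 2)) x)"
      using emeasure_bounded_finite[OF bounded_ball, of y "\<epsilon> / 2"]
      by (intro integrable_mult_right integrable_real_indicator) auto
    fix x :: 'a
    show "1 / 4 * indicator (ball y (\<epsilon> / 2)) x \<le> (tail T (dist y x))\<^sup>2"
    proof (cases "x \<in> ball y (\<epsilon> / 2)")
      case True
      have "dist y x / measure lborel T \<le> dist y x / \<epsilon>"
        using e T_meas by (intro divide_left_mono) auto
      also have "\<dots> \<le> 1 / 2" using True e by (simp add: field_simps)
      finally have "1 / 2 \<le> tail T (dist y x)"
        using tail_ge[OF T T_fin T_pos, of "dist y x"] T_sub by (auto simp: subset_iff)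
      then have "(1 / 2)\<^sup>2 \<le> (tail T (dist y x))\<^sup>2" by (intro power_mono) auto
      then show ?thesis using True by (simp add: power2_eq_square)
    qed simp
  qed
  finally have "l * (1 / 4 * measure lborel (ball y (\<epsilon> / 2))) \<le> l * (LINT x|lborel. (tail T (dist y x))\<^sup>2)"
    using l by (rule mult_left_mono)
  also have "\<dots> \<le> (1 / \<epsilon>)\<^sup>2 * kinetic_const TYPE('a) r + (LINT x|lborel. cutoff V r y x * (tail T (dist y x))\<^sup>2)"
    by (rule radial_form_bound[OF fb lip _ supp]) (use e in auto)
  also have "(LINT x|lborel. cutoff V r y x * (tail T (dist y x))\<^sup>2) \<le> A"
    by (rule tail_average_le(1)[OF T T_fin T_pos cutoff_integrable])
       (use T_le T_sub in \<open>auto simp: radial_cutoff subset_iff\<close>)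
  also have "measure lborel (ball y (\<epsilon> / 2)) = measure lborel (ball (0::'a) (\<epsilon> / 2))"
    using e by (simp add: content_ball)
  finally show ?thesis by simp
qed

text \<open>The profile \<open>(1 - tail S t) * tail T t\<close> rises over \<open>S\<close>, falls
  over \<open>T\<close> and equals \<open>1\<close> on the shell between the radii \<open>a\<close>
  and \<open>b\<close>, whose volume bounds the norm from below. Each factor has Lipschitz constant
  \<open>1 / \<kappa>\<close>, which explains \<open>2 / \<kappa>\<close>. The potential energy is
  at most an average bounded by \<open>A + c\<close> minus one that is at least \<open>c\<close>, so
  the unknown level \<open>c\<close> drops out.\<close>

lemma shell_estimate:
  assumes fb: "form_bounded V (r + 1) l y" and l: "l \<ge> 0" and k: "\<kappa> > 0" and c12: "0 \<le> a" "a < b" "b \<le> r"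
    and S[measurable]: "S \<in> sets borel" and S_sub: "S \<subseteq> {0<..a}" and S_meas: "\<kappa> \<le> measure lborel S"
    and T[measurable]: "T \<in> sets borel" and T_sub: "T \<subseteq> {b..r}" and T_meas: "\<kappa> \<le> measure lborel T"
    and S_ge: "\<And>t. t \<in> S \<Longrightarrow> c \<le> ball_integral V y t"
    and T_le: "\<And>t. t \<in> T \<Longrightarrow> ball_integral V y t \<le> A + c"
  shows "l * (measure lborel (ball (0::'a) b) - measure lborel (cball (0::'a) a)) \<le> (2 / \<kappa>)\<^sup>2 * kinetic_const TYPE('a) r + A"
proof -
  have "bounded T" by (rule bounded_subset[OF bounded_closed_interval T_sub])
  from emeasure_bounded_finite[OF this] have T_fin: "emeasure lborel T \<noteq> \<infinity>" by simp
  have "bounded S" by (rule bounded_subset[OF bounded_closed_interval[of 0 a]]) (use S_sub in auto)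
  from emeasure_bounded_finite[OF this] have S_fin: "emeasure lborel S \<noteq> \<infinity>" by simp
  have T_pos: "measure lborel T > 0" and S_pos: "measure lborel S > 0" using k T_meas S_meas by auto
  note lT = tail_lipschitz[OF T T_fin T_pos k T_meas] and lS = tail_lipschitz[OF S S_fin S_pos k S_meas]
  have S0: "tail S t = 0" if "t \<ge> a" for t by (rule tail_eq_0) (use S_sub that in force)
  have T1: "tail T t = 1" if "t < b" for t by (rule tail_eq_1[OF T T_fin T_pos]) (use T_sub that in force)
  have T0: "tail T t = 0" if "t \<ge> r" for t by (rule tail_eq_0) (use T_sub that in force)
  define \<psi> where "\<psi> t = (1 - tail S t) * tail T t" for t
  have lip: "\<bar>\<psi> s - \<psi> t\<bar> \<le> 2 / \<kappa> * \<bar>s - t\<bar>" for s t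
  proof -
    have "\<psi> s - \<psi> t = (1 - tail S s) * (tail T s - tail T t) - (tail S s - tail S t) * tail T t"
      unfolding \<psi>_def by (simp add: algebra_simps)
    then have "\<bar>\<psi> s - \<psi> t\<bar> \<le> \<bar>(1 - tail S s) * (tail T s - tail T t)\<bar> + \<bar>(tail S s - tail S t) * tail T t\<bar>"
      by (simp add: abs_triangle_ineq4)
    also have "\<bar>(1 - tail S s) * (tail T s - tail T t)\<bar> \<le> \<bar>tail T s - tail T t\<bar>"
      using tail_nonneg[of S s] tail_le_1[OF S S_fin S_pos, of s] by (simp add: abs_mult mult_left_le_one_le)
    also have "\<bar>(tail S s - tail S t) * tail T t\<bar> \<le> \<bar>tail S s - tail S t\<bar>"
      using tail_nonneg[of T t] tail_le_1[OF T T_fin T_pos, of t] by (simp add: abs_mult mult_left_le)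
    finally show ?thesis using lT[of s t] lS[of s t] by simp
  qed
  have supp: "\<psi> t = 0" if "t > r" for t using T0[of t] that unfolding \<psi>_def by simp
  \<comment> \<open>Everywhere one of the two factors is \<open>1\<close>, which turns the square of the product into a
    difference of two averages.\<close>
  have psi2: "(\<psi> t)\<^sup>2 = (tail T t)\<^sup>2 - (1 - (1 - tail S t)\<^sup>2)" for t
    using S0[of t] T1[of t] c12 unfolding \<psi>_def by (cases "t \<ge> a") auto
  have int: "integrable lborel (\<lambda>x. (\<psi> (dist y x))\<^sup>2)"
    by (rule compact_radial_integrable[of _ "2 / \<kappa>"]) (use lip supp k in auto)
  have "measure lborel (ball (0::'a) b) - measure lborel (cball (0::'a) a) = measure lborel (ball y b - cball y a)"
  proof -
    have "measure lborel (ball y b - cball y a) = measure lborel (ball y b) - measure lborel (cball y a)"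
      using emeasure_bounded_finite[OF bounded_ball, of y b]
      by (intro measure_Diff) (use c12 in \<open>auto simp: subset_iff\<close>)
    then show ?thesis using c12 by (simp add: content_ball content_cball)
  qed
  also have "\<dots> = (LINT x|lborel. indicator (ball y b - cball y a) x)" by simp
  also have "\<dots> \<le> (LINT x|lborel. (\<psi> (dist y x))\<^sup>2)"
  proof (rule integral_mono[OF _ int])
    show "integrable lborel (indicat_real (ball y b - cball y a))"
      using emeasure_bounded_finite[OF bounded_diff[OF bounded_ball], of y b "cball y a"]
      by (intro integrable_real_indicator) auto
    fix x :: 'a
    show "indicator (ball y b - cball y a) x \<le> (\<psi> (dist y x))\<^sup>2"
      using S0[of "dist y x"] T1[of "dist y x"] by (auto simp: indicator_def \<psi>_def)
  qed
  finally have "l * (measure lborel (ball (0::'a) b) - measure lborel (cball (0::'a) a))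
      \<le> l * (LINT x|lborel. (\<psi> (dist y x))\<^sup>2)"
    using l by (rule mult_left_mono)
  also have "\<dots> \<le> (2 / \<kappa>)\<^sup>2 * kinetic_const TYPE('a) r + (LINT x|lborel. cutoff V r y x * (\<psi> (dist y x))\<^sup>2)"
    by (rule radial_form_bound[OF fb lip _ supp]) (use k in auto)
  also have "(LINT x|lborel. cutoff V r y x * (\<psi> (dist y x))\<^sup>2) \<le> A"
  proof -
    have T_ball: "radial_integral (cutoff V r y) y t \<le> A + c" if "t \<in> T" for t
      using T_le[OF that] T_sub that by (auto simp: radial_cutoff subset_iff)
    have S_ball: "c \<le> radial_integral (cutoff V r y) y t" if "t \<in> S" for t
      using S_ge[OF that] S_sub that c12 by (auto simp: radial_cutoff subset_iff)
    note t = tail_average_le[OF T T_fin T_pos cutoff_integrable[of y] T_ball]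
    note s = head_average_ge[OF S S_fin S_pos cutoff_integrable[of y] S_ball]
    have "(LINT x|lborel. cutoff V r y x * (\<psi> (dist y x))\<^sup>2) =
      (LINT x|lborel. cutoff V r y x * (tail T (dist y x))\<^sup>2 - cutoff V r y x * (1 - (1 - tail S (dist y x))\<^sup>2))"
      unfolding psi2 by (simp only: right_diff_distrib)
    also have "\<dots> = (LINT x|lborel. cutoff V r y x * (tail T (dist y x))\<^sup>2) -
        (LINT x|lborel. cutoff V r y x * (1 - (1 - tail S (dist y x))\<^sup>2))"
      by (rule Bochner_Integration.integral_diff[OF t(2) s(2)]) auto
    also have "\<dots> \<le> A" using t(1) s(1) by simp
    finally show ?thesis .
  qed
  finally show ?thesis by simp
qed

end

section \<open>Limits at infinity\<close>

lemma measure_lborel_Times: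
  fixes A :: "real set" and B :: "real set"
  assumes "A \<in> sets borel" "B \<in> sets borel"
  shows "measure lborel (A \<times> B) = measure lborel A * measure lborel B"
  unfolding lborel_prod[symmetric] measure_def
  using assms by (simp add: lborel.emeasure_pair_measure_Times enn2real_mult)

lemma bounded_borel_fmeasurable:
  fixes S :: "'a::euclidean_space set"
  shows "bounded S \<Longrightarrow> S \<in> sets borel \<Longrightarrow> S \<in> fmeasurable lborel"
  using emeasure_bounded_finite[of S] by (simp add: fmeasurable_def)

text \<open>The bad set of pairs, written with the cut-off potential so that it is a Borel set in
  the whole plane; inside the triangle it agrees with the condition on
  \<open>shell_integral\<close>.\<close>

definition low_shell :: "('a::euclidean_space \<Rightarrow> real) \<Rightarrow> real \<Rightarrow> real \<Rightarrow> 'a \<Rightarrow> (real \<times> real) set" where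
  "low_shell V r A y =
     {p. radial_integral (cutoff V r y) y (snd p) - radial_integral (cutoff V r y) y (fst p) \<le> A}"

context
  fixes V :: "'a::euclidean_space \<Rightarrow> real" and r :: real
  assumes V: "continuous_on UNIV V" and r: "r > 0"
    and fb: "\<And>l. \<exists>\<rho>. \<forall>y. norm y > \<rho> \<longrightarrow> form_bounded V (r + 1) l y"
begin

text \<open>The level \<open>l\<close> is free, whereas \<open>v\<close> and \<open>C\<close> depend
  neither on \<open>l\<close> nor on \<open>y\<close>: \<open>l = (C + 1) / v\<close> violates the
  estimate, so \<open>Q y\<close> must hold far out.\<close>

lemma form_bounded_contradiction:
  assumes v: "v > 0" and C: "C \<ge> 0"
    and Q: "\<And>l y. l \<ge> 0 \<Longrightarrow> form_bounded V (r + 1) l y \<Longrightarrow> \<not> Q y \<Longrightarrow> l * v \<le> C"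
  shows "\<exists>\<rho>. \<forall>y. norm y > \<rho> \<longrightarrow> Q y"
proof -
  define l where "l = (C + 1) / v"
  have l: "l \<ge> 0" "l * v = C + 1" unfolding l_def using v C by auto
  obtain \<rho> where "\<And>y. norm y > \<rho> \<Longrightarrow> form_bounded V (r + 1) l y" using fb by blast
  then show ?thesis using Q[OF l(1)] l(2) by (intro exI[of _ \<rho>]) force
qed

lemma ball_integral_limit:
  assumes A: "A > 0"
  shows "((\<lambda>y. measure lebesgue {t \<in> {0<..<r}. ball_integral V y t \<le> A}) \<longlongrightarrow> 0) at_infinity"
proof (rule tendstoI)
  fix e :: real assume e: "e > 0"
  define T where "T y = {t \<in> {0<..<r}. ball_integral V y t \<le> A}" for y
  have T_meas: "T y \<in> sets borel" for y
  proof -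
    note [measurable] = radial_cutoff_measurable[OF V r, of y]
    have "{t \<in> {0<..<r}. radial_integral (cutoff V r y) y t \<le> A} \<in> sets borel" by measurable
    moreover have "{t \<in> {0<..<r}. radial_integral (cutoff V r y) y t \<le> A} = T y"
      unfolding T_def using radial_cutoff[OF V r] by auto
    ultimately show ?thesis by (simp only:)
  qed
  have "\<exists>\<rho>. \<forall>y. norm y > \<rho> \<longrightarrow> measure lborel (T y) < e"
  proof (rule form_bounded_contradiction)
    show "1 / 4 * measure lborel (ball (0::'a) (e / 2)) > 0"
      using e unit_ball_vol_pos[of "real DIM('a)"] by (simp add: content_ball)
    show "0 \<le> (1 / e)\<^sup>2 * kinetic_const TYPE('a) r + A" using A by (simp add: kinetic_const_def)
    show "l * (1 / 4 * measure lborel (ball (0::'a) (e / 2))) \<le> (1 / e)\<^sup>2 * kinetic_const TYPE('a) r + A"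
      if "l \<ge> 0" "form_bounded V (r + 1) l y" "\<not> measure lborel (T y) < e" for l y
      by (rule small_ball_estimate[OF V r that(2,1) e T_meas[of y]])
         (use that(3) in \<open>auto simp: T_def\<close>)
  qed
  then obtain \<rho> where "\<And>y. norm y > \<rho> \<Longrightarrow> measure lborel (T y) < e" by blast
  then have "dist (measure lebesgue (T y)) 0 < e" if "norm y \<ge> \<rho> + 1" for y
    using that T_meas[of y] by simp
  then show "\<forall>\<^sub>F y in at_infinity. dist (measure lebesgue {t \<in> {0<..<r}. ball_integral V y t \<le> A}) 0 < e"
    unfolding eventually_at_infinity T_def by blast
qed

lemma low_shell_measurable: "low_shell V r A y \<in> sets borel"
proof -
  note m = radial_cutoff_measurable[OF V r, of y]
  have "(\<lambda>p::real \<times> real. radial_integral (cutoff V r y) y (snd p) - radial_integral (cutoff V r y) y (fst p))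
      \<in> borel_measurable borel"
    by (intro borel_measurable_diff measurable_compose[OF _ m] borel_measurable_continuous_onI
        continuous_intros)
  from measurable_sets[OF this, of "{..A}"] show ?thesis
    unfolding low_shell_def by (simp add: vimage_def)
qed

text \<open>Since \<open>s2 < t1\<close>, the shell between these radii has positive volume and
  \<open>shell_estimate\<close> applies. The bad set is not a product, but a quantile level
  \<open>c\<close> of the ball integral on \<open>{s1..s2}\<close> covers it by two products: one
  over the few \<open>s\<close> with value at least \<open>c + 1\<close>, one over the
  \<open>t\<close> with value at most \<open>A + 1 + c\<close>. If the bad set is large, the second
  set of radii must be large too.\<close>

lemma low_shell_box:
  assumes A: "A > 0" and e: "e > 0" and b: "0 < s1" "s1 \<le> s2" "s2 < t1" "t1 \<le> t2" "t2 < r"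
  shows "\<exists>\<rho>. \<forall>y. norm y > \<rho> \<longrightarrow> measure lborel (({s1..s2} \<times> {t1..t2}) \<inter> low_shell V r A y) \<le> e"
proof -
  let ?Q = "\<lambda>y. ({s1..s2} \<times> {t1..t2}) \<inter> low_shell V r A y"
  \<comment> \<open>Chosen so that the first product, of measure at most
    \<open>\<kappa> * r\<close>, takes up half of \<open>e\<close> and leaves the other half to
    \<open>T\<close>.\<close>
  define \<kappa> where "\<kappa> = e / (2 * r)"
  have k: "\<kappa> > 0" unfolding \<kappa>_def using e r by simp
  show ?thesis
  proof (rule form_bounded_contradiction)
    have "s2 ^ DIM('a) < t1 ^ DIM('a)" using b by (intro power_strict_mono) auto
    then show "measure lborel (ball (0::'a) t1) - measure lborel (cball (0::'a) s2) > 0"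
      using b unit_ball_vol_pos[of "real DIM('a)"] by (simp add: content_ball content_cball)
    show "0 \<le> (2 / \<kappa>)\<^sup>2 * kinetic_const TYPE('a) r + (A + 1)" using A by (simp add: kinetic_const_def)
    fix l y
    assume l: "l \<ge> 0" "form_bounded V (r + 1) l y"
      and "\<not> measure lborel (?Q y) \<le> e"
    then have big: "e < measure lborel (?Q y)" by simp
    define W where "W = radial_integral (cutoff V r y) y"
    have W[measurable]: "W \<in> borel_measurable borel"
      unfolding W_def by (rule radial_cutoff_measurable[OF V r])
    have box: "?Q y \<in> sets lborel"
    proof -
      have "{s1..s2} \<times> {t1..t2} \<in> sets borel" by (intro borel_closed closed_Times) auto
      then show ?thesis using low_shell_measurable[of A y] by (simp add: sets.Int)
    qed
    \<comment> \<open>A box of measure above \<open>e\<close> whose second side is at most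
      \<open>r\<close> has a first side longer than \<open>e / r\<close>, hence longer than
      \<open>\<kappa>\<close>, as the quantile requires.\<close>
    have "e < measure lborel ({s1..s2} \<times> {t1..t2})"
    proof (rule less_le_trans[OF big], rule measure_mono_fmeasurable)
      show "{s1..s2} \<times> {t1..t2} \<in> fmeasurable lborel"
        by (intro bounded_borel_fmeasurable bounded_Times borel_closed closed_Times) auto
    qed (use box in auto)
    also have "\<dots> = (s2 - s1) * (t2 - t1)" using b by (simp add: measure_lborel_Times)
    also have "\<dots> \<le> (s2 - s1) * r" using b by (intro mult_left_mono) auto
    finally have "e / r < s2 - s1" using r by (simp add: field_simps)
    moreover have "\<kappa> \<le> e / r" unfolding \<kappa>_def using e r by (simp add: field_simps)
    ultimately have k2: "\<kappa> \<le> measure lborel {s1..s2}" using b by simp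
    have "\<exists>c. \<kappa> \<le> measure lborel {s\<in>{s1..s2}. c \<le> W s} \<and>
        measure lborel {s\<in>{s1..s2}. c + 1 \<le> W s} \<le> \<kappa>"
    proof (rule quantile[OF _ _ W _ k k2])
      show "\<bar>W s\<bar> \<le> (LINT x|lborel. \<bar>cutoff V r y x\<bar>)" for s
        unfolding W_def by (rule radial_cutoff_bounded[OF V r])
    qed (use b in auto)
    then obtain c where c: "\<kappa> \<le> measure lborel {s\<in>{s1..s2}. c \<le> W s}"
      "measure lborel {s\<in>{s1..s2}. c + 1 \<le> W s} \<le> \<kappa>" by blast
    define S where "S = {s\<in>{s1..s2}. c \<le> W s}"
    define S' where "S' = {s\<in>{s1..s2}. c + 1 \<le> W s}"
    define T where "T = {t\<in>{t1..t2}. W t \<le> (A + 1) + c}"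
    have [measurable]: "S \<in> sets borel" "S' \<in> sets borel" "T \<in> sets borel"
      unfolding S_def S'_def T_def by measurable
    have bd: "bounded S'" "bounded T"
      unfolding S'_def T_def by (auto intro: bounded_subset[OF bounded_closed_interval])
    have "measure lborel (?Q y) \<le>
        measure lborel ((S' \<times> {t1..t2}) \<union> ({s1..s2} \<times> T))"
    proof (rule measure_mono_fmeasurable)
      show "(S' \<times> {t1..t2}) \<union> ({s1..s2} \<times> T) \<in> fmeasurable lborel"
        by (intro bounded_borel_fmeasurable bounded_Un[THEN iffD2] conjI bounded_Times bd sets.Un)
           (auto simp: borel_prod[symmetric] intro!: pair_measureI)
      \<comment> \<open>If the value at \<open>s\<close> is below \<open>c + 1\<close>, a difference
        of at most \<open>A\<close> forces the value at \<open>t\<close> to be at most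
        \<open>A + 1 + c\<close>.\<close>
      show "?Q y \<subseteq> (S' \<times> {t1..t2}) \<union> ({s1..s2} \<times> T)"
        unfolding low_shell_def S'_def T_def W_def[symmetric] by auto
    qed (use box in auto)
    also have "\<dots> \<le> measure lborel (S' \<times> {t1..t2}) + measure lborel ({s1..s2} \<times> T)"
      by (rule measure_Un_le) (auto simp: borel_prod[symmetric] intro!: pair_measureI)
    also have "\<dots> = measure lborel S' * (t2 - t1) + (s2 - s1) * measure lborel T"
      using b by (simp add: measure_lborel_Times)
    also have "\<dots> \<le> \<kappa> * r + r * measure lborel T"
      using b c(2) k r unfolding S'_def[symmetric] by (intro add_mono mult_mono) auto
    finally have "e < e / 2 + r * measure lborel T" using big r unfolding \<kappa>_def by simp
    then have kT: "\<kappa> \<le> measure lborel T" unfolding \<kappa>_def using r by (simp add: field_simps)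
    have W_eq: "W t = ball_integral V y t" if "t \<le> r" for t
      unfolding W_def by (rule radial_cutoff[OF V r that])
    show "l * (measure lborel (ball (0::'a) t1) - measure lborel (cball (0::'a) s2))
        \<le> (2 / \<kappa>)\<^sup>2 * kinetic_const TYPE('a) r + (A + 1)"
    proof (rule shell_estimate[OF V r l(2,1) k, where S = S and T = T and c = c])
      show "c \<le> ball_integral V y t" if "t \<in> S" for t
        using that W_eq[of t] b unfolding S_def by auto
      show "ball_integral V y t \<le> (A + 1) + c" if "t \<in> T" for t
        using that W_eq[of t] b unfolding T_def by auto
      show "\<kappa> \<le> measure lborel S" using c(1) unfolding S_def .
      show "S \<subseteq> {0<..s2}" "T \<subseteq> {t1..r}" unfolding S_def T_def using b by auto
    qed (use b kT in auto)
  qed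
qed

lemma open_triangle_open: "open (open_triangle r)"
proof -
  have "open_triangle r = {p. 0 < fst p} \<inter> {p. fst p < snd p} \<inter> {p. snd p < r}"
    unfolding open_triangle_def by auto
  then show ?thesis by (auto intro!: open_Int open_Collect_less continuous_intros)
qed

lemma open_triangle_fmeasurable: "open_triangle r \<in> fmeasurable lborel"
proof (rule bounded_borel_fmeasurable)
  have "open_triangle r \<subseteq> {0..r} \<times> {0..r}" unfolding open_triangle_def by auto
  then show "bounded (open_triangle r)"
    by (rule bounded_subset[rotated]) (intro bounded_Times bounded_closed_interval)
qed (rule borel_open[OF open_triangle_open])

text \<open>The box estimate degenerates at the diagonal, so the open triangle is written as a
  countable union of closed boxes. Finitely many of them miss only measure \<open>e / 2\<close>, and
  the bad set is made small in each of these.\<close>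

lemma shell_integral_limit:
  assumes A: "A > 0"
  shows "((\<lambda>y. measure lebesgue {(s, t) \<in> open_triangle r. shell_integral V y s t \<le> A}) \<longlongrightarrow> 0) at_infinity"
proof (rule tendstoI)
  fix e :: real assume e: "e > 0"
  let ?D = "open_triangle r"
  have D_sets: "?D \<in> sets lborel" using open_triangle_fmeasurable by auto
  obtain \<D> where D: "countable \<D>" "\<D> \<subseteq> Pow ?D" "\<And>X. X \<in> \<D> \<Longrightarrow> \<exists>a b. X = cbox a b" "\<Union>\<D> = ?D"
    using open_countable_Union_open_cbox[OF open_triangle_open] by blast
  have "(r / 3, r / 2) \<in> ?D" unfolding open_triangle_def using r by simp
  then have "\<D> \<noteq> {}" using D(4) by auto
  define X where "X = from_nat_into \<D>"
  have X_range: "range X = \<D>" unfolding X_def by (rule range_from_nat_into[OF \<open>\<D> \<noteq> {}\<close> D(1)])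
  define B where "B n = (\<Union>i\<le>n. X i)" for n
  have X_box: "\<exists>a b. X i = cbox a b" "X i \<subseteq> ?D" for i using D(2,3) X_range by blast+
  have X_sets: "X i \<in> sets borel" for i using X_box(1)[of i] by auto
  have B_sets: "B n \<in> sets borel" for n unfolding B_def using X_sets by (intro sets.finite_UN) auto
  have UB: "(\<Union>n. B n) = ?D" unfolding B_def using D(4) X_range by auto
  have "(\<lambda>n. measure lborel (B n)) \<longlonglongrightarrow> measure lborel (\<Union>n. B n)"
  proof (rule Lim_measure_incseq)
    show "incseq B" unfolding B_def incseq_def by (auto intro: order_trans)
    show "emeasure lborel (\<Union>n. B n) \<noteq> \<infinity>"
      unfolding UB using fmeasurableD2[OF open_triangle_fmeasurable] by simp
  qed (use B_sets in auto)
  then obtain n where n: "dist (measure lborel (B n)) (measure lborel ?D) < e / 2"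
    unfolding UB using e by (metis half_gt_zero LIMSEQ_iff_nz metric_LIMSEQ_D order_refl)
  have small: "measure lborel (?D - B n) < e / 2"
  proof -
    have "measure lborel (?D - B n) = measure lborel ?D - measure lborel (B n)"
      by (rule measure_Diff) (use UB B_sets D_sets fmeasurableD2[OF open_triangle_fmeasurable] in auto)
    moreover have "measure lborel ?D - measure lborel (B n) < e / 2"
      using n unfolding dist_real_def abs_less_iff by linarith
    ultimately show ?thesis by simp
  qed
  \<comment> \<open>The union \<open>B n\<close> consists of \<open>Suc n\<close> boxes, so their
    bad parts add up to at most \<open>e / 4\<close>.\<close>
  define \<delta> where "\<delta> = e / (4 * real (Suc n))"
  have d: "\<delta> > 0" unfolding \<delta>_def using e by simp
  have "\<exists>\<rho>. \<forall>y. norm y > \<rho> \<longrightarrow> measure lborel (X i \<inter> low_shell V r A y) \<le> \<delta>" for i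
  proof (cases "X i = {}")
    case True
    then show ?thesis using d by simp
  next
    case False
    obtain s1 t1 s2 t2 where b: "X i = cbox (s1, t1) (s2, t2)" using X_box(1)[of i] by (metis surj_pair)
    then have X: "X i = {s1..s2} \<times> {t1..t2}" by (simp add: cbox_Pair_eq)
    then have le: "s1 \<le> s2" "t1 \<le> t2" using False by auto
    \<comment> \<open>The corner \<open>(s2, t1)\<close> is the one nearest to the diagonal; that it
      lies in the triangle gives \<open>s2 < t1\<close>.\<close>
    then have "(s1, t1) \<in> ?D" "(s2, t1) \<in> ?D" "(s2, t2) \<in> ?D" using X X_box(2)[of i] by auto
    then show ?thesis unfolding X
      by (intro low_shell_box[OF A d]) (use le in \<open>auto simp: open_triangle_def\<close>)
  qed
  then obtain \<rho> where \<rho>: "\<And>i y. norm y > \<rho> i \<Longrightarrow> measure lborel (X i \<inter> low_shell V r A y) \<le> \<delta>" by metis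
  have main: "measure lborel (?D \<inter> low_shell V r A y) < e" if y: "norm y > Max (\<rho> ` {..n})" for y
  proof -
    have ls: "low_shell V r A y \<in> sets lborel" using low_shell_measurable by simp
    have sets: "?D - B n \<in> sets lborel" "(\<Union>i\<le>n. X i \<inter> low_shell V r A y) \<in> sets lborel"
      using X_sets B_sets D_sets ls by auto
    have "measure lborel (?D \<inter> low_shell V r A y) \<le> measure lborel ((?D - B n) \<union> (\<Union>i\<le>n. X i \<inter> low_shell V r A y))"
    proof (rule measure_mono_fmeasurable)
      show "(?D - B n) \<union> (\<Union>i\<le>n. X i \<inter> low_shell V r A y) \<in> fmeasurable lborel"
        by (rule fmeasurableI2[OF open_triangle_fmeasurable]) (use X_box(2) sets in auto)
      show "?D \<inter> low_shell V r A y \<in> sets lborel" using D_sets ls by blast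
    qed (auto simp: B_def)
    also have "\<dots> \<le> measure lborel (?D - B n) + measure lborel (\<Union>i\<le>n. X i \<inter> low_shell V r A y)"
      by (rule measure_Un_le[OF sets])
    also have "measure lborel (\<Union>i\<le>n. X i \<inter> low_shell V r A y) \<le> (\<Sum>i\<le>n. measure lborel (X i \<inter> low_shell V r A y))"
      by (rule measure_UNION_le) (use X_sets ls in auto)
    also have "\<dots> \<le> (\<Sum>i\<le>n. \<delta>)"
    proof (rule sum_mono)
      fix i assume "i \<in> {..n}"
      then have "\<rho> i < norm y" using y by (auto simp: Max_less_iff)
      then show "measure lborel (X i \<inter> low_shell V r A y) \<le> \<delta>" by (rule \<rho>)
    qed
    also have "\<dots> = e / 4" unfolding \<delta>_def by (simp add: field_simps)
    finally show ?thesis using small e by simp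
  qed
  have eq: "{(s, t) \<in> ?D. shell_integral V y s t \<le> A} = ?D \<inter> low_shell V r A y" for y
    unfolding low_shell_def open_triangle_def shell_integral_def
    using radial_cutoff[OF V r, of _ y] by auto
  have "dist (measure lebesgue {(s, t) \<in> ?D. shell_integral V y s t \<le> A}) 0 < e"
    if "norm y \<ge> Max (\<rho> ` {..n}) + 1" for y
  proof -
    have "?D \<inter> low_shell V r A y \<in> sets lborel" using D_sets low_shell_measurable by auto
    moreover have "norm y > Max (\<rho> ` {..n})" using that by linarith
    ultimately show ?thesis unfolding eq using main[of y] by simp
  qed
  then show "\<forall>\<^sub>F y in at_infinity. dist (measure lebesgue {(s, t) \<in> ?D. shell_integral V y s t \<le> A}) 0 < e"
    unfolding eventually_at_infinity by blast
qed

end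

theorem theorem5p1:
  fixes V :: "real ^ 'n \<Rightarrow> real" and r :: real
  assumes "CARD('n) \<ge> 3"
    and "locally_Holder_continuous V"
    and "discrete_spectrum (schrodinger_op V)"
    and "spectrum_bounded_below (schrodinger_op V)"
    and "r > 0"
  shows "(\<forall>A>0. ((\<lambda>y. measure lebesgue {t \<in> {0<..<r}. ball_integral V y t \<le> A})
                   \<longlongrightarrow> 0) at_infinity) \<and>
         (\<forall>y. \<forall>(s, t) \<in> open_triangle r.
            shell_integral V y s t = (LINT x:(ball y t - cball y s)|lborel. V x)) \<and>
         (\<forall>A>0. ((\<lambda>y. measure lebesgue {(s, t) \<in> open_triangle r. shell_integral V y s t \<le> A})
                   \<longlongrightarrow> 0) at_infinity)"
proof -
  have V: "continuous_on UNIV V" by (rule locally_Holder_imp_continuous[OF assms(2)])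
  obtain c where c: "\<And>l. l \<in> op_spectrum (schrodinger_op V) \<Longrightarrow> c \<le> Re l"
    using assms(4) unfolding spectrum_bounded_below_def by blast
  have H: "discrete_symmetric_relation (schrodinger_rel V) c"
    by (rule discrete_schrodinger_rel[OF V assms(3) c])
  have r1: "r + 1 > 0" using assms(5) by simp
  note fb = form_bound_at_infinity[OF V H r1]
  show ?thesis
    using ball_integral_limit[OF V assms(5) fb] shell_integral_limit[OF V assms(5) fb]
      shell_integral_eq[OF V assms(5)] by (auto simp: open_triangle_def)
qed

end
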